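(* Let $\mathbf{k}\in\mathbb{N}^d$ and suppose that the mixed multiplicity of maximal degree $e(M;\mathbf{k})$ of $M$ of the type $\mathbf{k}$ is defined. Let $\mathbf{x}$ be an $S_{++}$-filter-regular sequence of the type $\mathbf{k}$ with respect to $M$. Then $$e(M;\mathbf{k})=\ell_A\big[(M/\mathbf{x}M)_{\mathbf{n}}\big]$$ for all large $\mathbf{n}$. Moreover, $e(M;\mathbf{k})\neq 0$ if and only if $\dim\mathrm{Supp}_{++}(M/\mathbf{x}M)=0$.
   Context: $\mathbb{N}$ denotes the nonnegative integers and $d\ge 1$ is an integer. $(A,\mathfrak{m})$ is an Artinian local ring with infinite residue field; $S=\bigoplus_{\mathbf{n}\in\mathbb{N}^d}S_{\mathbf{n}}$ is a finitely generated standard $\mathbb{N}^d$-graded (commutative) algebra over $A$, i.e. $S$ is generated over $A$ by elements of total degree $1$; $M=\bigoplus_{\mathbf{n}\in\mathbb{N}^d}M_{\mathbf{n}}$ is a finitely generated $\mathbb{N}^d$-graded $S$-module. On $\mathbb{N}^d$, $\le$ is componentwise, and $\mathbf{h}>\mathbf{k}$ means $\mathbf{h}\ge\mathbf{k}$ and $\mathbf{h}\ne\mathbf{k}$. "For all large $\mathbf{n}$" means for all $\mathbf{n}$ with every component sufficiently large. Let $\mathbf{e}_i$ be the $i$-th unit vector of $\mathbb{N}^d$, $S_i=S_{\mathbf{e}_i}$, and $S_{++}=\bigoplus_{\mathbf{n}\ge(1,\ldots,1)}S_{\mathbf{n}}$. $\mathrm{Proj}\,S$ is the set of homogeneous prime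 ideals of $S$ not containing $S_{++}$; $\mathrm{Supp}_{++}M=\{P\in\mathrm{Proj}\,S: M_P\ne0\}$; its dimension is the supremum of lengths of chains of primes in it, with $\dim\emptyset=-\infty$. Mixed multiplicities: $\ell_A$ denotes length. For all large $\mathbf{n}$, $\ell_A[M_{\mathbf{n}}]$ equals a polynomial $P_M(\mathbf{n})$ (the Hilbert polynomial), written uniquely as $P_M(\mathbf{n})=\sum_{\mathbf{k}\in\mathbb{N}^d}e(M;\mathbf{k})\binom{\mathbf{n}+\mathbf{k}}{\mathbf{k}}$ with $e(M;\mathbf{k})\in\mathbb{Z}$, where $\binom{\mathbf{n}+\mathbf{k}}{\mathbf{k}}=\prod_{i=1}^d\binom{n_i+k_i}{k_i}$. The mixed multiplicity (of maximal degree) of $M$ of the type $\mathbf{k}$ is defined if $e(M;\mathbf{h})=0$ for all $\mathbf{h}>\mathbf{k}$, and is then the number $e(M;\mathbf{k})$. Filter-regular sequences: a homogeneous element $a\in S$ is $S_{++}$-filter-regular with respect to $M$ if $(0_M:a)_{\mathbf{n}}=0$ for all large $\mathbf{n}$, where $0_M:a=\{m\in M: am=0\}$. A sequence $x_1,\ldots,x_t$ of homogeneous elements of $S$ is an $S_{++}$-filter-regular sequence with respect to $M$ if each $x_i$ is $S_{++}$-filter-regular with respect to $M/(x_1,\ldots,x_{i-1})M$. A sequence of elements of $\bigcup_{j=1}^dS_j$ consisting of $k_1$ elements of $S_1$, ..., $k_d$ elements of $S_d$ (in any order) is said to be of the type $\mathbf{k}=(k_1,\ldots,k_d)$. *)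

theory Defs
  imports
    "HOL-Algebra.Algebra"
    "HOL-Library.Function_Algebras"
    "HOL-Library.Extended_Real"
begin

text \<open>
  Multi-indices in \<open>\<nat>\<^sup>d\<close> are functions \<open>'d \<Rightarrow> nat\<close> on a finite type \<open>'d\<close> with \<open>d\<close> elements
  (types are inhabited, so \<open>d \<ge> 1\<close>). The pointwise library instances supply addition, the constant
  multi-index \<open>1 = (1,\<dots>,1)\<close>, the componentwise order, and a strict order with
  \<open>k < h \<longleftrightarrow> k \<le> h \<and> k \<noteq> h\<close>.
\<close>

type_synonym 'd multi = "'d \<Rightarrow> nat"

definition unit_multi :: "'d \<Rightarrow> 'd multi" where
  "unit_multi j = (\<lambda>i. if i = j then 1 else 0)"

definition for_all_large :: "('d::finite multi \<Rightarrow> bool) \<Rightarrow> bool" where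
  "for_all_large Q \<longleftrightarrow> (\<exists>N::nat. \<forall>n. (\<forall>i. N \<le> n i) \<longrightarrow> Q n)"

text \<open>Lengths \<open>r\<close> of strict chains \<open>X\<^sub>0 \<subset> X\<^sub>1 \<subset> \<dots> \<subset> X\<^sub>r\<close> of members of a family of sets.\<close>

definition chain_lengths :: "'a set set \<Rightarrow> nat set" where
  "chain_lengths \<C> = {r. \<exists>Xs. length Xs = Suc r \<and> set Xs \<subseteq> \<C> \<and> sorted_wrt (\<subset>) Xs}"


section \<open>Artinian local rings\<close>

locale artinian_local_ring = cring A + maximalideal \<mm> A for A (structure) and \<mm> +
  assumes unique_maximal: "maximalideal J A \<Longrightarrow> J = \<mm>"
    and descending_chain:
      "\<lbrakk>\<And>i::nat. ideal (I i) A; \<And>i. I (Suc i) \<subseteq> I i\<rbrakk> \<Longrightarrow> \<exists>N. \<forall>i\<ge>N. I i = I N"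


section \<open>Modules\<close>

definition gen_submodule ::
    "('s, 'x) ring_scheme \<Rightarrow> ('s, 'm, 'y) module_scheme \<Rightarrow> 'm set \<Rightarrow> 'm set" where
  "gen_submodule S M T = \<Inter>{N. submodule N S M \<and> T \<subseteq> N}"

definition finitely_generated_module ::
    "('s, 'x) ring_scheme \<Rightarrow> ('s, 'm, 'y) module_scheme \<Rightarrow> bool" where
  "finitely_generated_module S M \<longleftrightarrow>
     (\<exists>T. finite T \<and> T \<subseteq> carrier M \<and> gen_submodule S M T = carrier M)"

definition module_length ::
    "('s, 'x) ring_scheme \<Rightarrow> ('s, 'm, 'y) module_scheme \<Rightarrow> enat" where
  "module_length R M = (SUP r \<in> chain_lengths {N. submodule N R M}. enat r)"

text \<open>
  Quotient module \<open>M/N\<close>. The fields \<open>mult\<close> and \<open>one\<close> of a module record carry no meaning.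
\<close>

definition quot_module ::
    "('s, 'm, 'y) module_scheme \<Rightarrow> 'm set \<Rightarrow> ('s, 'm set) module" where
  "quot_module M N =
     \<lparr>carrier = a_rcosets\<^bsub>M\<^esub> N, monoid.mult = undefined, monoid.one = undefined, ring.zero = N,
      ring.add = set_add M,
      module.smult = (\<lambda>s C. \<Union>m\<in>C. N +>\<^bsub>M\<^esub> (s \<odot>\<^bsub>M\<^esub> m))\<rparr>"

text \<open>The submodule \<open>(x\<^sub>1, \<dots>, x\<^sub>t)M\<close>.\<close>

definition seq_mult ::
    "('s, 'x) ring_scheme \<Rightarrow> ('s, 'm, 'y) module_scheme \<Rightarrow> 's list \<Rightarrow> 'm set" where
  "seq_mult S M xs = gen_submodule S M {x \<odot>\<^bsub>M\<^esub> m | x m. x \<in> set xs \<and> m \<in> carrier M}"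

text \<open>
  Localization \<open>M\<^sub>P\<close>: fractions \<open>m/s\<close> with \<open>s \<notin> P\<close>, where \<open>m/s = m'/s'\<close> iff \<open>u(s'm - sm') = 0\<close> for some
  \<open>u \<notin> P\<close>. Only the underlying set and its zero \<open>0/1\<close> are needed to say \<open>M\<^sub>P \<noteq> 0\<close>.
\<close>

definition fraction_rel ::
    "('s, 'x) ring_scheme \<Rightarrow> ('s, 'm, 'y) module_scheme \<Rightarrow> 's set \<Rightarrow> (('m \<times> 's) \<times> ('m \<times> 's)) set"
  where
  "fraction_rel S M P =
     {((m, s), (m', s')) | m s m' s'.
        m \<in> carrier M \<and> m' \<in> carrier M \<and> s \<in> carrier S - P \<and> s' \<in> carrier S - P \<and>
        (\<exists>u \<in> carrier S - P. u \<odot>\<^bsub>M\<^esub> ((s' \<odot>\<^bsub>M\<^esub> m) \<ominus>\<^bsub>M\<^esub> (s \<odot>\<^bsub>M\<^esub> m')) = \<zero>\<^bsub>M\<^esub>)}"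

definition localization ::
    "('s, 'x) ring_scheme \<Rightarrow> ('s, 'm, 'y) module_scheme \<Rightarrow> 's set \<Rightarrow> ('m \<times> 's) set set" where
  "localization S M P = (carrier M \<times> (carrier S - P)) // fraction_rel S M P"

definition localization_zero ::
    "('s, 'x) ring_scheme \<Rightarrow> ('s, 'm, 'y) module_scheme \<Rightarrow> 's set \<Rightarrow> ('m \<times> 's) set" where
  "localization_zero S M P = fraction_rel S M P `` {(\<zero>\<^bsub>M\<^esub>, \<one>\<^bsub>S\<^esub>)}"


section \<open>Multigraded algebras and modules\<close>

text \<open>Internal direct sum decomposition \<open>G = \<Oplus>\<^sub>n G\<^sub>n\<close>.\<close>

locale multigraded_group = abelian_group G for G (structure) +
  fixes gr :: "'d::finite multi \<Rightarrow> _ set"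
  assumes gr_subgroup: "additive_subgroup (gr n) G"
    and gr_decomposition: "x \<in> carrier G \<Longrightarrow>
      \<exists>!f. (\<forall>n. f n \<in> gr n) \<and> finite {n. f n \<noteq> \<zero>} \<and> x = (\<Oplus>n\<in>{n. f n \<noteq> \<zero>}. f n)"

text \<open>The \<open>A\<close>-subalgebra generated by \<open>T\<close> is the subring generated by \<open>T\<close> and the image of \<open>A\<close>.\<close>

definition generates_algebra ::
    "('a, 'x) ring_scheme \<Rightarrow> ('a, 's, 'y) module_scheme \<Rightarrow> 's set \<Rightarrow> bool" where
  "generates_algebra A S T \<longleftrightarrow>
     T \<subseteq> carrier S \<and> generate_ring S (T \<union> (\<lambda>a. a \<odot>\<^bsub>S\<^esub> \<one>\<^bsub>S\<^esub>) ` carrier A) = carrier S"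

locale standard_multigraded_algebra =
  algebra A S + grading: multigraded_group S Sg
  for A and S (structure) and Sg :: "'d::finite multi \<Rightarrow> _ set" +
  assumes gr_submodule: "submodule (Sg n) A S"
    and one_gr: "\<one> \<in> Sg 0"
    and mult_gr: "\<lbrakk>x \<in> Sg k; y \<in> Sg n\<rbrakk> \<Longrightarrow> x \<otimes> y \<in> Sg (k + n)"
    and finitely_generated: "\<exists>T. finite T \<and> generates_algebra A S T"
    and standard: "generates_algebra A S (\<Union>j. Sg (unit_multi j))"

locale multigraded_module =
  module S M + grading: multigraded_group M Mg
  for S and Sg :: "'d::finite multi \<Rightarrow> _ set" and M (structure) and Mg :: "'d multi \<Rightarrow> _ set" +
  assumes smult_gr: "\<lbrakk>s \<in> Sg k; m \<in> Mg n\<rbrakk> \<Longrightarrow> s \<odot> m \<in> Mg (k + n)"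

definition quot_gr ::
    "('s, 'm, 'y) module_scheme \<Rightarrow> ('d multi \<Rightarrow> 'm set) \<Rightarrow> 'm set \<Rightarrow> 'd multi \<Rightarrow> 'm set set" where
  "quot_gr M Mg N n = (\<lambda>m. N +>\<^bsub>M\<^esub> m) ` Mg n"

text \<open>\<open>M\<^sub>n\<close> as an \<open>A\<close>-module, where \<open>A\<close> acts through its image in \<open>S\<close>.\<close>

definition component_module ::
    "('a, 's, 'x) module_scheme \<Rightarrow> ('s, 'm, 'y) module_scheme \<Rightarrow> ('d multi \<Rightarrow> 'm set) \<Rightarrow> 'd multi \<Rightarrow>
     ('a, 'm) module" where
  "component_module S M Mg n =
     \<lparr>carrier = Mg n, monoid.mult = monoid.mult M, monoid.one = \<one>\<^bsub>M\<^esub>, ring.zero = \<zero>\<^bsub>M\<^esub>,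
      ring.add = ring.add M,
      module.smult = (\<lambda>a m. (a \<odot>\<^bsub>S\<^esub> \<one>\<^bsub>S\<^esub>) \<odot>\<^bsub>M\<^esub> m)\<rparr>"


section \<open>Mixed multiplicities\<close>

definition component_length ::
    "('a, 'w) ring_scheme \<Rightarrow> ('a, 's, 'x) module_scheme \<Rightarrow> ('s, 'm, 'y) module_scheme \<Rightarrow>
     ('d multi \<Rightarrow> 'm set) \<Rightarrow> 'd multi \<Rightarrow> enat" where
  "component_length A S M Mg n = module_length A (component_module S M Mg n)"

definition is_hilbert_expansion ::
    "('a, 'w) ring_scheme \<Rightarrow> ('a, 's, 'x) module_scheme \<Rightarrow> ('s, 'm, 'y) module_scheme \<Rightarrow>
     ('d::finite multi \<Rightarrow> 'm set) \<Rightarrow> ('d multi \<Rightarrow> int) \<Rightarrow> bool" where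
  "is_hilbert_expansion A S M Mg e \<longleftrightarrow>
     finite {k. e k \<noteq> 0} \<and>
     for_all_large (\<lambda>n. \<exists>l::nat. component_length A S M Mg n = enat l \<and>
       int l = (\<Sum>k | e k \<noteq> 0. e k * int (\<Prod>i\<in>UNIV. (n i + k i) choose (k i))))"

text \<open>The coefficient \<open>e(M;k)\<close> of the Hilbert polynomial of \<open>M\<close>.\<close>

definition hilbert_coeff ::
    "('a, 'w) ring_scheme \<Rightarrow> ('a, 's, 'x) module_scheme \<Rightarrow> ('s, 'm, 'y) module_scheme \<Rightarrow>
     ('d::finite multi \<Rightarrow> 'm set) \<Rightarrow> 'd multi \<Rightarrow> int" where
  "hilbert_coeff A S M Mg = (THE e. is_hilbert_expansion A S M Mg e)"

definition mixed_multiplicity_defined ::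
    "('a, 'w) ring_scheme \<Rightarrow> ('a, 's, 'x) module_scheme \<Rightarrow> ('s, 'm, 'y) module_scheme \<Rightarrow>
     ('d::finite multi \<Rightarrow> 'm set) \<Rightarrow> 'd multi \<Rightarrow> bool" where
  "mixed_multiplicity_defined A S M Mg k \<longleftrightarrow> (\<forall>h>k. hilbert_coeff A S M Mg h = 0)"


section \<open>Filter-regular sequences\<close>

definition filter_regular ::
    "('d::finite multi \<Rightarrow> 's set) \<Rightarrow> ('s, 'm, 'y) module_scheme \<Rightarrow> ('d multi \<Rightarrow> 'm set) \<Rightarrow>
     's \<Rightarrow> bool" where
  "filter_regular Sg M Mg a \<longleftrightarrow>
     a \<in> (\<Union>n. Sg n) \<and>
     for_all_large (\<lambda>n. {m \<in> carrier M. a \<odot>\<^bsub>M\<^esub> m = \<zero>\<^bsub>M\<^esub>} \<inter> Mg n = {\<zero>\<^bsub>M\<^esub>})"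

definition filter_regular_seq ::
    "('s, 'x) ring_scheme \<Rightarrow> ('d::finite multi \<Rightarrow> 's set) \<Rightarrow> ('s, 'm, 'y) module_scheme \<Rightarrow>
     ('d multi \<Rightarrow> 'm set) \<Rightarrow> 's list \<Rightarrow> bool" where
  "filter_regular_seq S Sg M Mg xs \<longleftrightarrow>
     (\<forall>i<length xs. let N = seq_mult S M (take i xs) in
        filter_regular Sg (quot_module M N) (quot_gr M Mg N) (xs ! i))"

text \<open>
  The indices \<open>js\<close> record which \<open>S\<^sub>j\<close> each term is drawn from; they are determined by \<open>xs\<close> except for
  zero terms, as \<open>0\<close> lies in every \<open>S\<^sub>j\<close>.
\<close>

definition seq_of_type :: "('d multi \<Rightarrow> 's set) \<Rightarrow> 'd multi \<Rightarrow> 's list \<Rightarrow> bool" where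
  "seq_of_type Sg k xs \<longleftrightarrow>
     (\<exists>js. list_all2 (\<lambda>x j. x \<in> Sg (unit_multi j)) xs js \<and> (\<forall>j. count_list js j = k j))"


section \<open>Supports\<close>

definition homogeneous_ideal ::
    "'s set \<Rightarrow> ('s, 'x) ring_scheme \<Rightarrow> ('d multi \<Rightarrow> 's set) \<Rightarrow> bool" where
  "homogeneous_ideal I S Sg \<longleftrightarrow> ideal I S \<and> I = Idl\<^bsub>S\<^esub> (I \<inter> (\<Union>n. Sg n))"

definition S_plus_plus :: "('s, 'x) ring_scheme \<Rightarrow> ('d multi \<Rightarrow> 's set) \<Rightarrow> 's set" where
  "S_plus_plus S Sg =
     {(\<Oplus>\<^bsub>S\<^esub>n\<in>F. f n) | f F. finite F \<and> (\<forall>n\<in>F. 1 \<le> n \<and> f n \<in> Sg n)}"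

definition Proj :: "('s, 'x) ring_scheme \<Rightarrow> ('d multi \<Rightarrow> 's set) \<Rightarrow> 's set set" where
  "Proj S Sg = {P. primeideal P S \<and> homogeneous_ideal P S Sg \<and> \<not> S_plus_plus S Sg \<subseteq> P}"

definition Supp_plus_plus ::
    "('s, 'x) ring_scheme \<Rightarrow> ('d multi \<Rightarrow> 's set) \<Rightarrow> ('s, 'm, 'y) module_scheme \<Rightarrow> 's set set" where
  "Supp_plus_plus S Sg M = {P \<in> Proj S Sg. localization S M P \<noteq> {localization_zero S M P}}"

text \<open>For the empty set the supremum in \<open>ereal\<close> is \<open>-\<infinity>\<close>.\<close>

definition prime_dim :: "'s set set \<Rightarrow> ereal" where
  "prime_dim \<C> = (SUP r \<in> chain_lengths \<C>. ereal (real r))"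

end

theory Submission
  imports Defs
begin

text \<open>
  Let \<open>x \<in> S\<^sub>j\<close> be filter-regular with respect to \<open>N\<close>. In large degrees multiplication by \<open>x\<close> embeds
  \<open>N\<^sub>m\<close> into \<open>N\<^sub>n\<close> with cokernel \<open>(N/xN)\<^sub>n\<close>, where \<open>m\<close> is \<open>n\<close> lowered by \<open>1\<close> in coordinate \<open>j\<close>. So the Hilbert
  polynomial of \<open>N/xN\<close> is the backward difference of that of \<open>N\<close> in direction \<open>j\<close>, and by Pascal's rule
  its coefficients are those of \<open>N\<close> shifted by the \<open>j\<close>-th unit vector. Along a sequence of type \<open>k\<close> the
  coefficients of \<open>M\<close> are shifted by \<open>k\<close> (\<open>filter_regular_seq_hilbert\<close>). If they vanish strictly above
  \<open>k\<close>, the constant \<open>e(M;k)\<close> is left, which therefore is the length of \<open>M/xM\<close> in large degrees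
  (\<open>mixed_multiplicity_eq_length\<close>).

  For this the coefficients have to exist. The Hilbert polynomial is obtained by induction on the
  number of generators of \<open>S\<close> of total degree one (\<open>hilbert_polynomial\<close>): kernel and cokernel of
  multiplication by a generator are modules over fewer generators, so all differences of the length
  function are eventually polynomial, and such a function can be integrated
  (\<open>eventually_poly_from_differences\<close>). The kernels stay in the class of modules considered because
  \<open>M\<close> is Noetherian, by Hilbert's basis theorem over \<open>A\<close>, which has finite length.

  All modules that occur are subquotients \<open>L/N\<close> of \<open>M\<close>. They are represented by pairs \<open>N \<subseteq> L\<close> of
  subsets of \<open>M\<close>, and the length of \<open>L/N\<close> is the maximal length of chains between \<open>N\<close> and \<open>L\<close>; thus
  inductions can range over subquotients without a change of type. Two facts about lengths are used,
  additivity (\<open>rel_length_add\<close>) and the isomorphism theorem for multiplication by a scalar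
  (\<open>rel_length_colon_in\<close>).

  For the statement on supports, let \<open>M/Q\<close> have constant length \<open>c\<close> in large degrees. If \<open>c \<noteq> 0\<close>,
  choose a homogeneous \<open>N \<supseteq> Q\<close> maximal such that \<open>M/N\<close> is nonzero in arbitrarily large degrees. Each
  homogeneous element of \<open>S\<close> is either injective on \<open>M/N\<close> or kills it in large degrees, and the
  elements of the latter kind give a prime in the support of \<open>M/Q\<close> (\<open>Supp_nonempty\<close>). A proper
  inclusion of primes in the support would produce components of unbounded length (\<open>Supp_no_chain\<close>).
  So the dimension is \<open>0\<close>. If \<open>c = 0\<close>, elements of large degree outside a prime kill every localized
  element, and the support is empty (\<open>Supp_empty\<close>).
\<close>

section \<open>Numerical polynomials in several variables\<close>

lemma multi_induct [case_names zero plus]: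
  fixes n :: "'d::finite multi"
  assumes "P 0" and "\<And>n j. P n \<Longrightarrow> P (n + unit_multi j)"
  shows "P n"
proof (induction "\<Sum>i\<in>UNIV. n i" arbitrary: n)
  case 0
  then have "n = 0" by (auto simp: fun_eq_iff)
  with assms(1) show ?case by (simp only:)
next
  case (Suc t)
  from Suc.hyps(2) obtain j where j: "n j \<noteq> 0"
    by (metis nat.distinct(1) sum.neutral)
  have n: "n = (n - unit_multi j) + unit_multi j"
    using j by (auto simp: fun_eq_iff unit_multi_def)
  have "(\<Sum>i\<in>UNIV. n i) = (\<Sum>i\<in>UNIV. (n - unit_multi j) i) + (\<Sum>i\<in>UNIV. unit_multi j i)"
    by (subst n) (simp add: sum.distrib)
  moreover have "(\<Sum>i\<in>UNIV. unit_multi j i) = 1"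
    by (simp add: unit_multi_def)
  ultimately have "P (n - unit_multi j)"
    using Suc.hyps by simp
  from assms(2)[OF this, of j] n show ?case by simp
qed

lemma multi_diff_add_unit:
  fixes n :: "'d multi"
  assumes "n j \<noteq> 0"
  shows "n - unit_multi j + unit_multi j = n"
  using assms by (auto simp: fun_eq_iff unit_multi_def)

lemma for_all_large_mono:
  "for_all_large P \<Longrightarrow> (\<And>n. P n \<Longrightarrow> Q n) \<Longrightarrow> for_all_large Q"
  unfolding for_all_large_def by blast

lemma for_all_large_conj:
  assumes "for_all_large P" "for_all_large Q"
  shows "for_all_large (\<lambda>n. P n \<and> Q n)"
proof -
  from assms obtain N1 N2 where
    "\<And>n. (\<forall>i. N1 \<le> n i) \<Longrightarrow> P n" "\<And>n. (\<forall>i. N2 \<le> n i) \<Longrightarrow> Q n"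
    unfolding for_all_large_def by blast
  then have "\<forall>n. (\<forall>i. max N1 N2 \<le> n i) \<longrightarrow> P n \<and> Q n" by simp
  then show ?thesis unfolding for_all_large_def by blast
qed

lemma for_all_large_ex: "for_all_large Q \<Longrightarrow> \<exists>n. Q n"
  unfolding for_all_large_def by (erule exE, rule_tac x = "\<lambda>_. N" in exI) simp

lemma for_all_large_finite:
  assumes "finite I" "\<And>i. i \<in> I \<Longrightarrow> for_all_large (Q i)"
  shows "for_all_large (\<lambda>n. \<forall>i\<in>I. Q i n)"
  using assms
proof (induction I rule: finite_induct)
  case empty then show ?case by (simp add: for_all_large_def)
next
  case (insert i I)
  then show ?case
    using for_all_large_conj[of "Q i" "\<lambda>n. \<forall>i\<in>I. Q i n"] by simp
qed

lemma for_all_large_all: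
  fixes Q :: "'i::finite \<Rightarrow> _"
  assumes "\<And>i. for_all_large (Q i)"
  shows "for_all_large (\<lambda>n. \<forall>i. Q i n)"
  using for_all_large_finite[of UNIV Q] assms by simp

lemma for_all_large_shift:
  assumes "for_all_large Q"
  shows "for_all_large (\<lambda>n. Q (n + k))"
proof -
  from assms obtain N where N: "\<And>n. (\<forall>i. N \<le> n i) \<Longrightarrow> Q n"
    unfolding for_all_large_def by blast
  then have "\<forall>n. (\<forall>i. N \<le> n i) \<longrightarrow> Q (n + k)" by (simp add: trans_le_add1)
  then show ?thesis unfolding for_all_large_def by blast
qed

lemma for_all_large_unshift:
  assumes "for_all_large (\<lambda>n. Q (n + unit_multi j))"
  shows "for_all_large Q"
proof -
  from assms obtain N where N: "\<And>n. (\<forall>i. N \<le> n i) \<Longrightarrow> Q (n + unit_multi j)"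
    unfolding for_all_large_def by blast
  have "Q n" if n: "\<forall>i. Suc N \<le> n i" for n
  proof -
    have "N \<le> (n - unit_multi j) i" for i
      using n[rule_format, of i] by (auto simp: unit_multi_def)
    then have "Q (n - unit_multi j + unit_multi j)" by (intro N) simp
    moreover have "n j \<noteq> 0" using n[rule_format, of j] by simp
    ultimately show ?thesis by (simp add: multi_diff_add_unit)
  qed
  then show ?thesis unfolding for_all_large_def by blast
qed

definition mbinom :: "'d::finite multi \<Rightarrow> 'd multi \<Rightarrow> int" where
  "mbinom n k = int (\<Prod>i\<in>UNIV. (n i + k i) choose (k i))"

definition hsum :: "('d::finite multi \<Rightarrow> int) \<Rightarrow> 'd multi \<Rightarrow> int" where
  "hsum e n = (\<Sum>k | e k \<noteq> 0. e k * mbinom n k)"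

lemma hsum_superset:
  assumes "finite F" "{k. e k \<noteq> 0} \<subseteq> F"
  shows "hsum e n = (\<Sum>k\<in>F. e k * mbinom n k)"
  unfolding hsum_def by (rule sum.mono_neutral_left) (use assms in auto)

lemma mbinom_zero [simp]: "mbinom n 0 = 1"
  by (simp add: mbinom_def)

text \<open>Pascal's rule in the \<open>j\<close>-th coordinate.\<close>

lemma mbinom_diff:
  "mbinom (n + unit_multi j) k - mbinom n k =
     (if k j = 0 then 0 else mbinom (n + unit_multi j) (k - unit_multi j))"
proof -
  have split: "mbinom a b = int ((a j + b j) choose (b j)) *
      int (\<Prod>i\<in>UNIV - {j}. (a i + b i) choose (b i))" for a b :: "'a multi"
    unfolding mbinom_def by (subst prod.remove[of _ j]) auto
  have rest: "(\<Prod>i\<in>UNIV - {j}. ((n + unit_multi j) i + k' i) choose (k' i)) =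
      (\<Prod>i\<in>UNIV - {j}. (n i + k i) choose (k i))"
    if "\<And>i. i \<noteq> j \<Longrightarrow> k' i = k i" for k'
    by (rule prod.cong) (auto simp: unit_multi_def that)
  show ?thesis
  proof (cases "k j")
    case 0
    then show ?thesis by (simp add: split rest unit_multi_def)
  next
    case (Suc t)
    have "mbinom (n + unit_multi j) (k - unit_multi j) =
      int ((Suc (n j) + t) choose t) * int (\<Prod>i\<in>UNIV - {j}. (n i + k i) choose (k i))"
      by (subst split, subst rest) (auto simp: unit_multi_def Suc)
    moreover have "mbinom (n + unit_multi j) k =
      int ((Suc (n j) + Suc t) choose Suc t) * int (\<Prod>i\<in>UNIV - {j}. (n i + k i) choose (k i))"
      by (subst split, subst rest) (auto simp: unit_multi_def Suc)
    moreover have "mbinom n k =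
      int ((n j + Suc t) choose Suc t) * int (\<Prod>i\<in>UNIV - {j}. (n i + k i) choose (k i))"
      by (subst split) (auto simp: Suc)
    ultimately show ?thesis by (simp add: Suc algebra_simps)
  qed
qed

abbreviation (input) coeff_shift :: "'d multi \<Rightarrow> ('d multi \<Rightarrow> int) \<Rightarrow> 'd multi \<Rightarrow> int" where
  "coeff_shift k e \<equiv> \<lambda>h. e (h + k)"

lemma finite_coeff_shift:
  assumes "finite {k. e k \<noteq> (0::int)}"
  shows "finite {h. coeff_shift k e h \<noteq> 0}"
proof -
  have "inj (\<lambda>h. h + k)" by (auto simp: inj_on_def fun_eq_iff)
  from finite_vimageI[OF assms this] show ?thesis by (simp add: vimage_def)
qed

text \<open>
  The backward difference in direction \<open>j\<close> merely shifts the coefficients. This is why Hilbert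
  polynomials are expanded in this basis: passing to the quotient by a filter-regular element of
  \<open>S\<^sub>j\<close> will be such a difference.
\<close>

lemma hsum_diff:
  assumes fin: "finite {k. e k \<noteq> 0}"
  shows "hsum e (n + unit_multi j) - hsum e n = hsum (coeff_shift (unit_multi j) e) (n + unit_multi j)"
proof -
  let ?u = "unit_multi j" and ?K = "{k. e k \<noteq> 0}"
  have "hsum e (n + ?u) - hsum e n = (\<Sum>k\<in>?K. e k * (mbinom (n + ?u) k - mbinom n k))"
    by (simp add: hsum_def sum_subtractf algebra_simps)
  also have "\<dots> = (\<Sum>k\<in>?K. e k * (if k j = 0 then 0 else mbinom (n + ?u) (k - ?u)))"
    by (simp add: mbinom_diff)
  also have "\<dots> = (\<Sum>k\<in>{k\<in>?K. k j \<noteq> 0}. e k * mbinom (n + ?u) (k - ?u))"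
    by (rule sum.mono_neutral_cong_right) (use fin in auto)
  also have "\<dots> = (\<Sum>h | e (h + ?u) \<noteq> 0. e (h + ?u) * mbinom (n + ?u) h)"
    by (rule sum.reindex_bij_witness[of _ "\<lambda>h. h + ?u" "\<lambda>k. k - ?u"])
      (auto simp: multi_diff_add_unit, auto simp: unit_multi_def)
  finally show ?thesis by (simp add: hsum_def)
qed

lemma finite_support_diff:
  fixes a b :: "'k \<Rightarrow> int"
  assumes "finite {k. a k \<noteq> 0}" "finite {k. b k \<noteq> 0}"
  shows "finite {k. a k - b k \<noteq> 0}"
  by (rule finite_subset[OF _ finite_UnI[OF assms]]) auto

lemma hsum_diff_coeffs:
  assumes "finite {k. e k \<noteq> 0}" "finite {k. e' k \<noteq> 0}"
  shows "hsum (\<lambda>k. e k - e' k) n = hsum e n - hsum e' n"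
proof -
  let ?F = "{k. e k \<noteq> 0} \<union> {k. e' k \<noteq> 0}"
  have "finite ?F" using assms by simp
  then show ?thesis
    by (subst (1 2 3) hsum_superset[of ?F]) (auto simp: sum_subtractf algebra_simps)
qed

text \<open>
  If \<open>h\<close> has maximal total degree among the indices with \<open>e h \<noteq> 0\<close>, then differencing \<open>h i\<close> times in
  each direction \<open>i\<close> leaves the constant \<open>e h\<close>, while differences of an eventually vanishing function
  eventually vanish.
\<close>

lemma hsum_eventually_zero:
  assumes fin: "finite {k. e k \<noteq> 0}" and zero: "for_all_large (\<lambda>n. hsum e n = 0)"
  shows "e k = 0"
proof (rule ccontr)
  assume "e k \<noteq> 0"
  have shift: "for_all_large (\<lambda>n. hsum (coeff_shift k e) n = 0)" for k
  proof (induction k rule: multi_induct)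
    case zero show ?case using assms(2) by simp
  next
    case (plus k j)
    have "for_all_large (\<lambda>n. hsum (coeff_shift (k + unit_multi j) e) (n + unit_multi j) = 0)"
    proof (rule for_all_large_mono)
      show "for_all_large (\<lambda>n. hsum (coeff_shift k e) n = 0 \<and>
          hsum (coeff_shift k e) (n + unit_multi j) = 0)"
        by (intro for_all_large_conj plus for_all_large_shift[OF plus])
    next
      fix n
      assume "hsum (coeff_shift k e) n = 0 \<and> hsum (coeff_shift k e) (n + unit_multi j) = 0"
      then show "hsum (coeff_shift (k + unit_multi j) e) (n + unit_multi j) = 0"
        using hsum_diff[OF finite_coeff_shift[OF fin, of k], of n j] by (simp add: add_ac)
    qed
    then show ?case by (rule for_all_large_unshift)
  qed
  obtain h where h: "e h \<noteq> 0" and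
    max: "\<And>h'. e h' \<noteq> 0 \<Longrightarrow> (\<Sum>i\<in>UNIV. h' i) \<le> (\<Sum>i\<in>UNIV. h i)"
  proof -
    let ?D = "(\<lambda>h. \<Sum>i\<in>UNIV. h i) ` {k. e k \<noteq> 0}"
    have D: "finite ?D" "?D \<noteq> {}" using fin \<open>e k \<noteq> 0\<close> by auto
    from Max_in[OF D] obtain h where h: "e h \<noteq> 0" "Max ?D = (\<Sum>i\<in>UNIV. h i)"
      by auto
    have "(\<Sum>i\<in>UNIV. h' i) \<le> (\<Sum>i\<in>UNIV. h i)" if "e h' \<noteq> 0" for h'
      using Max_ge[OF D(1), of "\<Sum>i\<in>UNIV. h' i"] that h(2) by simp
    with h(1) show ?thesis using that by blast
  qed
  have "coeff_shift h e h' = 0" if "h' \<noteq> 0" for h'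
  proof (rule ccontr)
    assume "coeff_shift h e h' \<noteq> 0"
    from max[OF this] have "(\<Sum>i\<in>UNIV. h' i) = 0" by (simp add: sum.distrib)
    with that show False by (auto simp: fun_eq_iff)
  qed
  then have "hsum (coeff_shift h e) n = e h" for n
    by (subst hsum_superset[of "{0}"]) auto
  with for_all_large_ex[OF shift[of h]] h show False by simp
qed

lemma hsum_eventually_unique:
  assumes "finite {k. e k \<noteq> 0}" "finite {k. e' k \<noteq> 0}"
    and "for_all_large (\<lambda>n. f n = hsum e n)" "for_all_large (\<lambda>n. f n = hsum e' n)"
  shows "e = e'"
proof
  fix k
  have "finite {k. e k - e' k \<noteq> 0}" by (rule finite_support_diff[OF assms(1,2)])
  moreover have "for_all_large (\<lambda>n. hsum (\<lambda>k. e k - e' k) n = 0)"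
    by (rule for_all_large_mono[OF for_all_large_conj[OF assms(3,4)]])
      (simp add: hsum_diff_coeffs assms(1,2))
  ultimately have "e k - e' k = 0" by (rule hsum_eventually_zero)
  then show "e k = e' k" by simp
qed

definition eventually_poly :: "('d::finite multi \<Rightarrow> int) \<Rightarrow> bool" where
  "eventually_poly f \<longleftrightarrow> (\<exists>e. finite {k. e k \<noteq> 0} \<and> for_all_large (\<lambda>n. f n = hsum e n))"

lemma eventually_poly_diff_shift:
  assumes "eventually_poly f" "eventually_poly g"
  obtains e where "finite {k. e k \<noteq> 0}"
    "for_all_large (\<lambda>n. f (n + unit_multi j) - g n = hsum e (n + unit_multi j))"
proof -
  from assms obtain a b where
    a: "finite {k. a k \<noteq> 0}" "for_all_large (\<lambda>n. f n = hsum a n)" and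
    b: "finite {k. b k \<noteq> 0}" "for_all_large (\<lambda>n. g n = hsum b n)"
    unfolding eventually_poly_def by blast
  let ?b = "\<lambda>k. b k - coeff_shift (unit_multi j) b k"
  have fin_b: "finite {k. ?b k \<noteq> 0}"
    by (rule finite_support_diff[OF b(1) finite_coeff_shift[OF b(1)]])
  have "for_all_large (\<lambda>n. f (n + unit_multi j) - g n =
      hsum (\<lambda>k. a k - ?b k) (n + unit_multi j))"
  proof (rule for_all_large_mono[OF for_all_large_conj[OF for_all_large_shift[OF a(2)] b(2)]])
    fix n assume "f (n + unit_multi j) = hsum a (n + unit_multi j) \<and> g n = hsum b n"
    then show "f (n + unit_multi j) - g n = hsum (\<lambda>k. a k - ?b k) (n + unit_multi j)"
      using hsum_diff[OF b(1), of n j]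
      hsum_diff_coeffs[OF a(1) fin_b, of "n + unit_multi j"]
      hsum_diff_coeffs[OF b(1) finite_coeff_shift[OF b(1), of "unit_multi j"], of "n + unit_multi j"]
      by linarith
  qed
  moreover have "finite {k. a k - ?b k \<noteq> 0}"
    by (rule finite_support_diff[OF a(1) fin_b])
  ultimately show ?thesis by (rule that[rotated])
qed

lemma eventually_constant:
  fixes g :: "'d::finite multi \<Rightarrow> int"
  assumes "\<And>j. for_all_large (\<lambda>n. g (n + unit_multi j) = g n)"
  shows "\<exists>c. for_all_large (\<lambda>n. g n = c)"
proof -
  have "for_all_large (\<lambda>n. \<forall>j. g (n + unit_multi j) = g n)"
    by (rule for_all_large_all) (rule assms)
  then obtain N where N: "\<forall>n. (\<forall>i. N \<le> n i) \<longrightarrow> (\<forall>j. g (n + unit_multi j) = g n)"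
    unfolding for_all_large_def by (rule exE)
  have "g (h + (\<lambda>_. N)) = g (\<lambda>_. N)" for h
  proof (induction h rule: multi_induct)
    case zero show ?case by (simp add: zero_fun_def plus_fun_def)
  next
    case (plus h j)
    have "g ((h + (\<lambda>_. N)) + unit_multi j) = g (h + (\<lambda>_. N))"
      by (rule N[rule_format]) simp
    moreover have "(h + (\<lambda>_. N)) + unit_multi j = h + unit_multi j + (\<lambda>_. N)"
      by (simp only: add_ac)
    ultimately show ?case using plus.IH by (simp only:)
  qed
  moreover have "n = (n - (\<lambda>_. N)) + (\<lambda>_. N)" if "\<forall>i. N \<le> n i" for n :: "'d multi"
    using that by (auto simp: fun_eq_iff)
  ultimately have "\<forall>n. (\<forall>i. N \<le> n i) \<longrightarrow> g n = g (\<lambda>_. N)" by metis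
  then show ?thesis unfolding for_all_large_def by blast
qed

text \<open>
  Discrete integration. The two ways of forming a mixed second difference agree, so by uniqueness of
  expansions the coefficients \<open>c j\<close> of the \<open>j\<close>-th difference satisfy
  \<open>c j (h + unit_multi i) = c i (h + unit_multi j)\<close>. Hence they are the shifts of one coefficient
  function \<open>e\<close>, and \<open>f - hsum e\<close> has vanishing differences, so it is eventually constant.
\<close>

lemma eventually_poly_from_differences:
  fixes f :: "'d::finite multi \<Rightarrow> int"
  assumes "\<And>j. \<exists>c. finite {k. c k \<noteq> 0} \<and>
     for_all_large (\<lambda>n. f (n + unit_multi j) - f n = hsum c (n + unit_multi j))"
  shows "eventually_poly f"
proof -
  have "\<exists>c. \<forall>j. finite {k. c j k \<noteq> 0} \<and>
      for_all_large (\<lambda>n. f (n + unit_multi j) - f n = hsum (c j) (n + unit_multi j))"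
    by (rule choice) (rule allI, rule assms)
  then obtain c where c': "\<forall>j. finite {k. c j k \<noteq> 0} \<and>
      for_all_large (\<lambda>n. f (n + unit_multi j) - f n = hsum (c j) (n + unit_multi j))"
    by (rule exE)
  note fin = c'[rule_format, THEN conjunct1] and c = c'[rule_format, THEN conjunct2]
  have mixed: "for_all_large (\<lambda>n. f (n + unit_multi i + unit_multi j) - f (n + unit_multi j) - f (n + unit_multi i) + f n =
     hsum (coeff_shift (unit_multi i) (c j)) (n + unit_multi i + unit_multi j))" for i j
  proof (rule for_all_large_mono[OF for_all_large_conj[OF c[of j] for_all_large_shift[OF c[of j], of "unit_multi i"]]])
    fix n
    assume "f (n + unit_multi j) - f n = hsum (c j) (n + unit_multi j) \<and>
      f (n + unit_multi i + unit_multi j) - f (n + unit_multi i) = hsum (c j) (n + unit_multi i + unit_multi j)"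
    then show "f (n + unit_multi i + unit_multi j) - f (n + unit_multi j) - f (n + unit_multi i) + f n =
      hsum (coeff_shift (unit_multi i) (c j)) (n + unit_multi i + unit_multi j)"
      using hsum_diff[OF fin[of j], of "n + unit_multi j" i] by (simp add: add_ac)
  qed
  have cocycle: "c j (h + unit_multi i) = c i (h + unit_multi j)" for i j h
  proof -
    let ?d = "\<lambda>k. coeff_shift (unit_multi i) (c j) k - coeff_shift (unit_multi j) (c i) k"
    have "for_all_large (\<lambda>n. hsum ?d (n + unit_multi i + unit_multi j) = 0)"
    proof (rule for_all_large_mono[OF for_all_large_conj[OF mixed[of i j] mixed[of j i]]])
      fix n
      let ?n = "n + unit_multi i + unit_multi j"
      have comm: "n + unit_multi j + unit_multi i = ?n" by (simp only: add_ac)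
      assume "f ?n - f (n + unit_multi j) - f (n + unit_multi i) + f n =
          hsum (coeff_shift (unit_multi i) (c j)) ?n \<and>
        f (n + unit_multi j + unit_multi i) - f (n + unit_multi i) - f (n + unit_multi j) + f n =
          hsum (coeff_shift (unit_multi j) (c i)) (n + unit_multi j + unit_multi i)"
      then have "hsum (coeff_shift (unit_multi i) (c j)) ?n = hsum (coeff_shift (unit_multi j) (c i)) ?n"
        unfolding comm by linarith
      then show "hsum ?d ?n = 0"
        unfolding hsum_diff_coeffs[OF finite_coeff_shift[OF fin] finite_coeff_shift[OF fin]]
        by linarith
    qed
    then have "for_all_large (\<lambda>n. hsum ?d (n + unit_multi j) = 0)"
      by (rule for_all_large_unshift[of "\<lambda>n. hsum ?d (n + unit_multi j) = 0" i])
    then have "for_all_large (\<lambda>n. hsum ?d n = 0)"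
      by (rule for_all_large_unshift[of "\<lambda>n. hsum ?d n = 0" j])
    moreover have "finite {k. ?d k \<noteq> 0}"
      by (rule finite_support_diff[OF finite_coeff_shift[OF fin] finite_coeff_shift[OF fin]])
    ultimately have "?d h = 0" by (rule hsum_eventually_zero[of ?d h, rotated])
    then show ?thesis by simp
  qed
  \<comment> \<open>by the cocycle condition any \<open>j\<close> with \<open>k j \<noteq> 0\<close> gives the same value\<close>
  define e where "e k = (if k = 0 then 0 else let j = (SOME j. k j \<noteq> 0) in c j (k - unit_multi j))" for k
  have e_shift: "coeff_shift (unit_multi j) e = c j" for j
  proof
    fix k
    let ?k = "k + unit_multi j"
    define i where "i = (SOME i. ?k i \<noteq> 0)"
    have "?k j \<noteq> 0" by (simp add: unit_multi_def)
    then have i: "?k i \<noteq> 0" unfolding i_def by (rule someI)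
    have nz: "?k \<noteq> 0" using \<open>?k j \<noteq> 0\<close> by (metis zero_fun_apply)
    have e: "e ?k = c i (?k - unit_multi i)"
      unfolding e_def i_def Let_def using nz by (rule if_not_P)
    have diff_unit: "?k - unit_multi j = k" by (simp add: fun_eq_iff)
    show "e ?k = c j k"
    proof (cases "i = j")
      case True
      then show ?thesis using e diff_unit by (simp only:)
    next
      case False
      with i have "k i \<noteq> 0" by (simp add: unit_multi_def)
      then have "k - unit_multi i + unit_multi i = k" by (rule multi_diff_add_unit)
      moreover have "?k - unit_multi i = (k - unit_multi i) + unit_multi j"
        using \<open>k i \<noteq> 0\<close> False by (auto simp: fun_eq_iff unit_multi_def)
      ultimately show ?thesis using e cocycle[of j "k - unit_multi i" i] by (simp only:)
    qed
  qed
  have "{k. e k \<noteq> 0} \<subseteq> (\<Union>j. (\<lambda>k. k + unit_multi j) ` {k. c j k \<noteq> 0})"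
  proof
    fix k assume "k \<in> {k. e k \<noteq> 0}"
    then have ek: "e k \<noteq> 0" "k \<noteq> 0" by (auto simp: e_def)
    then obtain j where "k j \<noteq> 0" by (auto simp: fun_eq_iff)
    then have "k = (k - unit_multi j) + unit_multi j" by (simp add: multi_diff_add_unit)
    moreover from this ek(1) have "c j (k - unit_multi j) \<noteq> 0"
      using fun_cong[OF e_shift[of j], of "k - unit_multi j"] by simp
    ultimately show "k \<in> (\<Union>j. (\<lambda>k. k + unit_multi j) ` {k. c j k \<noteq> 0})" by blast
  qed
  then have fin_e: "finite {k. e k \<noteq> 0}"
    by (rule finite_subset) (use fin in auto)
  obtain a where a: "for_all_large (\<lambda>n. f n - hsum e n = a)"
  proof -
    have "\<exists>a. for_all_large (\<lambda>n. f n - hsum e n = a)"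
    proof (rule eventually_constant)
      fix j
      show "for_all_large (\<lambda>n. f (n + unit_multi j) - hsum e (n + unit_multi j) = f n - hsum e n)"
        using c[of j]
      proof (rule for_all_large_mono)
        fix n assume "f (n + unit_multi j) - f n = hsum (c j) (n + unit_multi j)"
        then show "f (n + unit_multi j) - hsum e (n + unit_multi j) = f n - hsum e n"
          using hsum_diff[OF fin_e, of n j] by (simp add: e_shift)
      qed
    qed
    then show ?thesis using that by blast
  qed
  let ?a = "\<lambda>k. if k = 0 then - a else 0"
  have fin_a: "finite {k. ?a k \<noteq> 0}" by (rule finite_subset[of _ "{0}"]) auto
  have hs_a: "hsum ?a n = - a" for n
    by (subst hsum_superset[of "{0}"]) auto
  have "for_all_large (\<lambda>n. f n = hsum (\<lambda>k. e k - ?a k) n)"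
    using a by (rule for_all_large_mono) (simp only: hsum_diff_coeffs[OF fin_e fin_a] hs_a)
  moreover have "finite {k. e k - ?a k \<noteq> 0}"
    by (rule finite_support_diff[OF fin_e fin_a])
  ultimately show ?thesis unfolding eventually_poly_def by (intro exI conjI)
qed

section \<open>Lengths of intervals of submodules\<close>

text \<open>
  Letting the set \<open>\<Omega>\<close> of scalars vary expresses \<open>A\<close>-submodules, \<open>S\<close>-submodules and submodules over
  intermediate algebras as subgroups of one and the same \<open>M\<close>.
\<close>

definition stable_subgroup :: "('r, 'm, 'y) module_scheme \<Rightarrow> 'r set \<Rightarrow> 'm set \<Rightarrow> bool" where
  "stable_subgroup M \<Omega> N \<longleftrightarrow> additive_subgroup N M \<and> (\<forall>s\<in>\<Omega>. \<forall>m\<in>N. s \<odot>\<^bsub>M\<^esub> m \<in> N)"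

definition stable_interval :: "('r, 'm, 'y) module_scheme \<Rightarrow> 'r set \<Rightarrow> 'm set \<Rightarrow> 'm set \<Rightarrow> 'm set set" where
  "stable_interval M \<Omega> N L = {V. stable_subgroup M \<Omega> V \<and> N \<subseteq> V \<and> V \<subseteq> L}"

text \<open>
  The length of \<open>L/N\<close>, measured on the interval between \<open>N\<close> and \<open>L\<close>. Inductions that pass to
  subquotients can therefore stay inside a fixed module.
\<close>

definition rel_length :: "('r, 'm, 'y) module_scheme \<Rightarrow> 'r set \<Rightarrow> 'm set \<Rightarrow> 'm set \<Rightarrow> enat" where
  "rel_length M \<Omega> N L = (SUP r \<in> chain_lengths (stable_interval M \<Omega> N L). enat r)"

text \<open>The submodule \<open>N + xL\<close>; with \<open>x = 1\<close> this is the sum \<open>N + L\<close>.\<close>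

definition plus_multiple :: "('r, 'm, 'y) module_scheme \<Rightarrow> 'm set \<Rightarrow> 'r \<Rightarrow> 'm set \<Rightarrow> 'm set" where
  "plus_multiple M N x L = {a \<oplus>\<^bsub>M\<^esub> x \<odot>\<^bsub>M\<^esub> m | a m. a \<in> N \<and> m \<in> L}"

text \<open>The kernel of multiplication by \<open>x\<close> from \<open>L\<close> to \<open>M/N\<close>.\<close>

definition colon_in :: "('r, 'm, 'y) module_scheme \<Rightarrow> 'm set \<Rightarrow> 'r \<Rightarrow> 'm set \<Rightarrow> 'm set" where
  "colon_in M N x L = {m \<in> L. x \<odot>\<^bsub>M\<^esub> m \<in> N}"

lemma plus_multiple_mono:
  "N \<subseteq> N' \<Longrightarrow> L \<subseteq> L' \<Longrightarrow> plus_multiple M N x L \<subseteq> plus_multiple M N' x L'"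
  unfolding plus_multiple_def by blast

lemma stable_interval_mono:
  "N' \<subseteq> N \<Longrightarrow> L \<subseteq> L' \<Longrightarrow> stable_interval M \<Omega> N L \<subseteq> stable_interval M \<Omega> N' L'"
  unfolding stable_interval_def by blast

lemma chain_lengths_map:
  assumes "\<And>B. B \<in> \<C> \<Longrightarrow> f B \<in> \<D>"
    and "\<And>B Y. B \<in> \<C> \<Longrightarrow> Y \<in> \<C> \<Longrightarrow> B \<subset> Y \<Longrightarrow> f B \<subset> f Y"
  shows "chain_lengths \<C> \<subseteq> chain_lengths \<D>"
proof
  fix r assume "r \<in> chain_lengths \<C>"
  then obtain Xs where Xs: "length Xs = Suc r" "set Xs \<subseteq> \<C>" "sorted_wrt (\<subset>) Xs"
    unfolding chain_lengths_def by blast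
  have "sorted_wrt (\<lambda>B Y. f B \<subset> f Y) Xs"
  proof (rule sorted_wrt_mono_rel[OF _ Xs(3)])
    fix B Y assume "B \<in> set Xs" "Y \<in> set Xs" "B \<subset> Y"
    then show "f B \<subset> f Y" by (intro assms(2)) (use Xs(2) in blast)+
  qed
  then have "length (map f Xs) = Suc r \<and> set (map f Xs) \<subseteq> \<D> \<and> sorted_wrt (\<subset>) (map f Xs)"
    by (auto simp: sorted_wrt_map Xs(1) intro!: assms(1) set_mp[OF Xs(2)])
  then show "r \<in> chain_lengths \<D>" unfolding chain_lengths_def by blast
qed

lemma chain_lengths_downward:
  assumes "r \<in> chain_lengths \<C>" "q \<le> r"
  shows "q \<in> chain_lengths \<C>"
proof -
  obtain Xs where "length Xs = Suc r" "set Xs \<subseteq> \<C>" "sorted_wrt (\<subset>) Xs"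
    using assms(1) unfolding chain_lengths_def by blast
  then have "length (take (Suc q) Xs) = Suc q" "set (take (Suc q) Xs) \<subseteq> \<C>"
    "sorted_wrt (\<subset>) (take (Suc q) Xs)"
    using assms(2) set_take_subset[of "Suc q" Xs] by (auto simp: sorted_wrt_take)
  then show ?thesis unfolding chain_lengths_def by blast
qed

lemma zero_in_chain_lengths: "B \<in> \<C> \<Longrightarrow> 0 \<in> chain_lengths \<C>"
  unfolding chain_lengths_def by (rule CollectI, rule exI[of _ "[B]"]) simp

text \<open>For chains given by a formula, strictness of consecutive steps suffices.\<close>

lemma chain_lengths_of_fun:
  fixes V :: "nat \<Rightarrow> 'a set"
  assumes "\<And>i. i \<le> r \<Longrightarrow> V i \<in> \<C>" "\<And>i. i < r \<Longrightarrow> V i \<subset> V (Suc i)"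
  shows "r \<in> chain_lengths \<C>"
proof -
  have "V i \<subset> V j" if "i < j" "j \<le> r" for i j
    using that
  proof (induction j)
    case (Suc j)
    then show ?case using assms(2)[of j] by (cases "i = j") auto
  qed simp
  then have "sorted_wrt (\<subset>) (map V [0..<Suc r])"
    by (auto simp: sorted_wrt_iff_nth_less simp del: upt_Suc)
  moreover have "set (map V [0..<Suc r]) \<subseteq> \<C>" using assms(1) by (auto simp del: upt_Suc)
  moreover have "length (map V [0..<Suc r]) = Suc r" by simp
  ultimately show ?thesis unfolding chain_lengths_def by blast
qed

lemma enat_le_rel_length_iff:
  assumes "stable_subgroup M \<Omega> N" "N \<subseteq> L"
  shows "enat r \<le> rel_length M \<Omega> N L \<longleftrightarrow> r \<in> chain_lengths (stable_interval M \<Omega> N L)"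
    (is "_ \<longleftrightarrow> r \<in> ?C")
proof
  assume "r \<in> ?C"
  then show "enat r \<le> rel_length M \<Omega> N L" unfolding rel_length_def by (rule SUP_upper)
next
  assume le: "enat r \<le> rel_length M \<Omega> N L"
  show "r \<in> ?C"
  proof (cases r)
    case 0
    have "N \<in> stable_interval M \<Omega> N L" using assms by (simp add: stable_interval_def)
    then show ?thesis using 0 by (simp add: zero_in_chain_lengths)
  next
    case (Suc q)
    have "\<exists>r'\<in>?C. r \<le> r'"
    proof (rule ccontr)
      assume "\<not> (\<exists>r'\<in>?C. r \<le> r')"
      then have "enat r' \<le> enat q" if "r' \<in> ?C" for r'
        using that Suc by (auto simp: not_le)
      then have "rel_length M \<Omega> N L \<le> enat q" unfolding rel_length_def by (rule SUP_least)
      with le Suc show False by (metis Suc_n_not_le_n enat_ord_simps(1) order_trans)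
    qed
    then show ?thesis using chain_lengths_downward by blast
  qed
qed

lemma enat_le_by_nat:
  assumes "\<And>r. enat r \<le> x \<Longrightarrow> enat r \<le> y"
  shows "x \<le> y"
proof (cases x)
  case (enat r) then show ?thesis using assms[of r] by simp
next
  case infinity
  have "y = \<infinity>"
  proof (rule ccontr)
    assume "y \<noteq> \<infinity>"
    then obtain s where "y = enat s" by auto
    then show False using assms[of "Suc s"] infinity by simp
  qed
  then show ?thesis by simp
qed

lemma enat_le_add_split:
  assumes "enat t \<le> x + y"
  shows "\<exists>r s. t = r + s \<and> enat r \<le> x \<and> enat s \<le> y"
proof (cases "enat t \<le> x")
  case True
  then show ?thesis by (intro exI[of _ t] exI[of _ 0]) (simp add: zero_enat_def[symmetric])
next
  case False
  then obtain r where r: "x = enat r" "r < t" by (cases x) auto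
  with assms have "enat (t - r) \<le> y" by (cases y) auto
  with r show ?thesis by (intro exI[of _ r] exI[of _ "t - r"]) auto
qed

lemma rel_length_mono:
  assumes "N' \<subseteq> N" "L \<subseteq> L'"
  shows "rel_length M \<Omega> N L \<le> rel_length M \<Omega> N' L'"
  unfolding rel_length_def
  by (rule SUP_subset_mono[OF chain_lengths_map[of _ "\<lambda>B. B"]])
    (use stable_interval_mono[OF assms] in auto)

lemma rel_length_mono_map:
  assumes "\<And>B. B \<in> stable_interval M \<Omega> N L \<Longrightarrow> f B \<in> stable_interval M' \<Omega>' N' L'"
    and "\<And>B Y. B \<in> stable_interval M \<Omega> N L \<Longrightarrow> Y \<in> stable_interval M \<Omega> N L \<Longrightarrow> B \<subset> Y \<Longrightarrow> f B \<subset> f Y"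
  shows "rel_length M \<Omega> N L \<le> rel_length M' \<Omega>' N' L'"
  unfolding rel_length_def
  by (rule SUP_subset_mono[OF chain_lengths_map[OF assms]]) auto

context module
begin

lemma stable_subgroupI:
  assumes "N \<subseteq> carrier M" "\<zero>\<^bsub>M\<^esub> \<in> N"
    and "\<And>x y. x \<in> N \<Longrightarrow> y \<in> N \<Longrightarrow> x \<oplus>\<^bsub>M\<^esub> y \<in> N"
    and "\<And>x. x \<in> N \<Longrightarrow> \<ominus>\<^bsub>M\<^esub> x \<in> N"
    and "\<And>s x. s \<in> \<Omega> \<Longrightarrow> x \<in> N \<Longrightarrow> s \<odot>\<^bsub>M\<^esub> x \<in> N"
  shows "stable_subgroup M \<Omega> N"
  unfolding stable_subgroup_def
  using assms by (auto intro!: additive_subgroup.intro subgroup.intro simp: a_inv_def)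

lemma stable_subgroupD:
  assumes "stable_subgroup M \<Omega> N"
  shows "N \<subseteq> carrier M" "\<zero>\<^bsub>M\<^esub> \<in> N"
    "\<And>x y. x \<in> N \<Longrightarrow> y \<in> N \<Longrightarrow> x \<oplus>\<^bsub>M\<^esub> y \<in> N"
    "\<And>x. x \<in> N \<Longrightarrow> \<ominus>\<^bsub>M\<^esub> x \<in> N"
    "\<And>x y. x \<in> N \<Longrightarrow> y \<in> N \<Longrightarrow> x \<ominus>\<^bsub>M\<^esub> y \<in> N"
    "\<And>s x. s \<in> \<Omega> \<Longrightarrow> x \<in> N \<Longrightarrow> s \<odot>\<^bsub>M\<^esub> x \<in> N"
proof -
  from assms have N: "additive_subgroup N M" unfolding stable_subgroup_def by blast
  show "N \<subseteq> carrier M" "\<zero>\<^bsub>M\<^esub> \<in> N"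
    "\<And>x y. x \<in> N \<Longrightarrow> y \<in> N \<Longrightarrow> x \<oplus>\<^bsub>M\<^esub> y \<in> N"
    "\<And>x. x \<in> N \<Longrightarrow> \<ominus>\<^bsub>M\<^esub> x \<in> N"
    using additive_subgroup.a_subset[OF N] additive_subgroup.zero_closed[OF N]
      additive_subgroup.a_closed[OF N] additive_subgroup.a_inv_closed[OF N] by auto
  then show "\<And>x y. x \<in> N \<Longrightarrow> y \<in> N \<Longrightarrow> x \<ominus>\<^bsub>M\<^esub> y \<in> N" by (simp add: a_minus_def)
  show "\<And>s x. s \<in> \<Omega> \<Longrightarrow> x \<in> N \<Longrightarrow> s \<odot>\<^bsub>M\<^esub> x \<in> N"
    using assms unfolding stable_subgroup_def by blast
qed

lemma stable_subgroup_mem: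
  "stable_subgroup M \<Omega> N \<Longrightarrow> x \<in> N \<Longrightarrow> x \<in> carrier M"
  using stable_subgroupD(1) by blast

lemma stable_subgroup_zero:
  "\<Omega> \<subseteq> carrier R \<Longrightarrow> stable_subgroup M \<Omega> {\<zero>\<^bsub>M\<^esub>}"
  by (rule stable_subgroupI) auto

lemma stable_subgroup_carrier:
  "\<Omega> \<subseteq> carrier R \<Longrightarrow> stable_subgroup M \<Omega> (carrier M)"
  by (rule stable_subgroupI) auto

lemma stable_subgroup_inter:
  "stable_subgroup M \<Omega> N \<Longrightarrow> stable_subgroup M \<Omega> L \<Longrightarrow> stable_subgroup M \<Omega> (N \<inter> L)"
  by (rule stable_subgroupI) (auto dest: stable_subgroupD)

lemma stable_subgroup_Inter:
  assumes "\<N> \<noteq> {}" "\<And>N. N \<in> \<N> \<Longrightarrow> stable_subgroup M \<Omega> N"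
  shows "stable_subgroup M \<Omega> (\<Inter>\<N>)"
proof (rule stable_subgroupI)
  obtain N where "N \<in> \<N>" using assms(1) by blast
  then show "\<Inter>\<N> \<subseteq> carrier M" using assms(2) stable_subgroupD(1) by blast
qed (auto intro: stable_subgroupD(2-4,6)[OF assms(2)])

lemma smult_comm:
  "s \<in> carrier R \<Longrightarrow> t \<in> carrier R \<Longrightarrow> m \<in> carrier M \<Longrightarrow>
    s \<odot>\<^bsub>M\<^esub> (t \<odot>\<^bsub>M\<^esub> m) = t \<odot>\<^bsub>M\<^esub> (s \<odot>\<^bsub>M\<^esub> m)"
  by (metis R.m_comm smult_assoc1)

lemma plus_multipleI:
  "a \<in> N \<Longrightarrow> m \<in> L \<Longrightarrow> a \<oplus>\<^bsub>M\<^esub> x \<odot>\<^bsub>M\<^esub> m \<in> plus_multiple M N x L"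
  unfolding plus_multiple_def by blast

lemma plus_multipleE:
  assumes "y \<in> plus_multiple M N x L"
  obtains a m where "a \<in> N" "m \<in> L" "y = a \<oplus>\<^bsub>M\<^esub> x \<odot>\<^bsub>M\<^esub> m"
  using assms unfolding plus_multiple_def by blast

lemma stable_subgroup_plus_multiple:
  assumes N: "stable_subgroup M \<Omega> N" and L: "stable_subgroup M \<Omega> L"
    and x: "x \<in> carrier R" and \<Omega>: "\<Omega> \<subseteq> carrier R"
  shows "stable_subgroup M \<Omega> (plus_multiple M N x L)"
proof (rule stable_subgroupI)
  note mem = stable_subgroup_mem[OF N] stable_subgroup_mem[OF L]
  show "plus_multiple M N x L \<subseteq> carrier M"
    by (auto elim!: plus_multipleE simp: mem x)
  show "\<zero>\<^bsub>M\<^esub> \<in> plus_multiple M N x L"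
    using plus_multipleI[OF stable_subgroupD(2)[OF N] stable_subgroupD(2)[OF L], of x] x by simp
  show "y \<oplus>\<^bsub>M\<^esub> z \<in> plus_multiple M N x L"
    if yz: "y \<in> plus_multiple M N x L" "z \<in> plus_multiple M N x L" for y z
  proof -
    from yz obtain a m b n where *: "a \<in> N" "m \<in> L" "y = a \<oplus>\<^bsub>M\<^esub> x \<odot>\<^bsub>M\<^esub> m"
        "b \<in> N" "n \<in> L" "z = b \<oplus>\<^bsub>M\<^esub> x \<odot>\<^bsub>M\<^esub> n"
      by (elim plus_multipleE)
    then have "y \<oplus>\<^bsub>M\<^esub> z = (a \<oplus>\<^bsub>M\<^esub> b) \<oplus>\<^bsub>M\<^esub> x \<odot>\<^bsub>M\<^esub> (m \<oplus>\<^bsub>M\<^esub> n)"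
      by (simp add: mem x smult_r_distr M.add.m_ac)
    then show ?thesis using * N L by (auto intro: plus_multipleI stable_subgroupD)
  qed
  show "\<ominus>\<^bsub>M\<^esub> y \<in> plus_multiple M N x L" if "y \<in> plus_multiple M N x L" for y
  proof -
    from that obtain a m where *: "a \<in> N" "m \<in> L" "y = a \<oplus>\<^bsub>M\<^esub> x \<odot>\<^bsub>M\<^esub> m" by (rule plus_multipleE)
    then have "\<ominus>\<^bsub>M\<^esub> y = \<ominus>\<^bsub>M\<^esub> a \<oplus>\<^bsub>M\<^esub> x \<odot>\<^bsub>M\<^esub> (\<ominus>\<^bsub>M\<^esub> m)"
      by (simp add: mem x smult_r_minus M.minus_add)
    then show ?thesis using * N L by (auto intro: plus_multipleI stable_subgroupD)
  qed
  show "s \<odot>\<^bsub>M\<^esub> y \<in> plus_multiple M N x L" if "s \<in> \<Omega>" "y \<in> plus_multiple M N x L" for s y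
  proof -
    from that(2) obtain a m where *: "a \<in> N" "m \<in> L" "y = a \<oplus>\<^bsub>M\<^esub> x \<odot>\<^bsub>M\<^esub> m" by (rule plus_multipleE)
    then have "s \<odot>\<^bsub>M\<^esub> y = s \<odot>\<^bsub>M\<^esub> a \<oplus>\<^bsub>M\<^esub> x \<odot>\<^bsub>M\<^esub> (s \<odot>\<^bsub>M\<^esub> m)"
      using that(1) \<Omega> by (auto simp add: mem x smult_r_distr smult_comm[of s x])
    then show ?thesis using * N L that(1) by (auto intro: plus_multipleI stable_subgroupD)
  qed
qed

lemma subset_plus_multiple:
  assumes "stable_subgroup M \<Omega> N" "stable_subgroup M \<Omega> L" "x \<in> carrier R"
  shows "N \<subseteq> plus_multiple M N x L"
proof
  fix a assume "a \<in> N"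
  from plus_multipleI[OF this stable_subgroupD(2)[OF assms(2)], of x]
  show "a \<in> plus_multiple M N x L"
    using assms stable_subgroup_mem[OF assms(1) \<open>a \<in> N\<close>] by simp
qed

lemma smult_mem_plus_multiple:
  assumes "stable_subgroup M \<Omega> N" "stable_subgroup M \<Omega> L" "x \<in> carrier R" "m \<in> L"
  shows "x \<odot>\<^bsub>M\<^esub> m \<in> plus_multiple M N x L"
  using plus_multipleI[OF stable_subgroupD(2)[OF assms(1)] assms(4), of x] assms
    stable_subgroup_mem[OF assms(2) assms(4)] by simp

lemma plus_multiple_subset:
  assumes "stable_subgroup M \<Omega> V" "N \<subseteq> V" "\<And>m. m \<in> L \<Longrightarrow> x \<odot>\<^bsub>M\<^esub> m \<in> V"
  shows "plus_multiple M N x L \<subseteq> V"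
  using assms stable_subgroupD(3)[OF assms(1)] by (auto elim!: plus_multipleE)

lemma stable_subgroup_colon_in:
  assumes N: "stable_subgroup M \<Omega> N" and L: "stable_subgroup M \<Omega> L"
    and x: "x \<in> carrier R" and \<Omega>: "\<Omega> \<subseteq> carrier R"
  shows "stable_subgroup M \<Omega> (colon_in M N x L)"
proof (rule stable_subgroupI)
  note mem = stable_subgroup_mem[OF L]
  show "colon_in M N x L \<subseteq> carrier M" by (auto simp: mem colon_in_def)
  show "\<zero>\<^bsub>M\<^esub> \<in> colon_in M N x L"
    using x stable_subgroupD(2)[OF N] stable_subgroupD(2)[OF L] by (simp add: colon_in_def)
  show "s \<odot>\<^bsub>M\<^esub> y \<in> colon_in M N x L" if "s \<in> \<Omega>" "y \<in> colon_in M N x L" for s y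
    using that x \<Omega> stable_subgroupD[OF N] stable_subgroupD[OF L] smult_comm[of x s y]
    by (auto simp: colon_in_def mem)
qed (auto simp: colon_in_def smult_r_distr smult_r_minus x stable_subgroup_mem[OF L]
    intro: stable_subgroupD(3,4)[OF N] stable_subgroupD(3,4)[OF L])

lemma diff_add_cancel_right:
  "x \<in> carrier M \<Longrightarrow> y \<in> carrier M \<Longrightarrow> y \<oplus>\<^bsub>M\<^esub> (x \<ominus>\<^bsub>M\<^esub> y) = x"
  by (simp add: a_minus_def M.add.m_ac M.r_neg)

lemma add_diff_cancel_left:
  "a \<in> carrier M \<Longrightarrow> m \<in> carrier M \<Longrightarrow> (a \<oplus>\<^bsub>M\<^esub> m) \<ominus>\<^bsub>M\<^esub> a = m"
  by (simp add: a_minus_def M.a_comm[of a m] M.a_assoc M.r_neg)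

text \<open>
  The modular law, in the form that a strict step \<open>B \<subset> B'\<close> remains strict after intersecting with \<open>b\<close>
  or after adding \<open>b\<close>.
\<close>

lemma modular_cancel:
  assumes B: "stable_subgroup M \<Omega> B" and B': "stable_subgroup M \<Omega> B'" and b: "stable_subgroup M \<Omega> b"
    and "B \<subseteq> B'" "B' \<inter> b \<subseteq> B \<inter> b" "plus_multiple M B' \<one> b \<subseteq> plus_multiple M B \<one> b"
  shows "B' = B"
proof (rule antisym[OF _ \<open>B \<subseteq> B'\<close>], rule subsetI)
  note mem = stable_subgroup_mem[OF B] stable_subgroup_mem[OF B'] stable_subgroup_mem[OF b]
  fix y assume y: "y \<in> B'"
  then have "y \<in> plus_multiple M B \<one> b"
    using subset_plus_multiple[OF B' b] assms(6) by auto
  then obtain a m where am: "a \<in> B" "m \<in> b" "y = a \<oplus>\<^bsub>M\<^esub> \<one> \<odot>\<^bsub>M\<^esub> m" by (rule plus_multipleE)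
  then have "m = y \<ominus>\<^bsub>M\<^esub> a" using mem add_diff_cancel_left[of a m] by simp
  moreover have "y \<ominus>\<^bsub>M\<^esub> a \<in> B'" using y am assms(4) stable_subgroupD(5)[OF B'] by blast
  ultimately have "m \<in> B" using am assms(5) by auto
  then show "y \<in> B" using am stable_subgroupD(3)[OF B] mem by simp
qed

lemma rel_length_superadditive:
  assumes a: "stable_subgroup M \<Omega> a" and b: "stable_subgroup M \<Omega> b" and c: "stable_subgroup M \<Omega> c"
    and "a \<subseteq> b" "b \<subseteq> c"
  shows "rel_length M \<Omega> a b + rel_length M \<Omega> b c \<le> rel_length M \<Omega> a c"
proof (rule enat_le_by_nat)
  fix t assume t: "enat t \<le> rel_length M \<Omega> a b + rel_length M \<Omega> b c"
  then have "\<exists>r s. t = r + s \<and> enat r \<le> rel_length M \<Omega> a b \<and> enat s \<le> rel_length M \<Omega> b c"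
    by (rule enat_le_add_split)
  then obtain r s where rs: "t = r + s" "enat r \<le> rel_length M \<Omega> a b" "enat s \<le> rel_length M \<Omega> b c"
    by blast
  obtain Xs where Xs: "length Xs = Suc r" "set Xs \<subseteq> stable_interval M \<Omega> a b" "sorted_wrt (\<subset>) Xs"
    using rs(2) enat_le_rel_length_iff[OF a \<open>a \<subseteq> b\<close>] unfolding chain_lengths_def by blast
  obtain Ys where Ys: "length Ys = Suc s" "set Ys \<subseteq> stable_interval M \<Omega> b c" "sorted_wrt (\<subset>) Ys"
    using rs(3) enat_le_rel_length_iff[OF b \<open>b \<subseteq> c\<close>] unfolding chain_lengths_def by blast
  obtain Y Ys' where Ys': "Ys = Y # Ys'" using Ys(1) by (cases Ys) auto
  have "B \<subset> Z" if "B \<in> set Xs" "Z \<in> set Ys'" for B Z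
  proof -
    have "B \<subseteq> b" "b \<subseteq> Y" using that(1) Xs(2) Ys(2) Ys' by (auto simp: stable_interval_def)
    moreover have "Y \<subset> Z" using Ys(3) Ys' that(2) by auto
    ultimately show ?thesis by blast
  qed
  then have "sorted_wrt (\<subset>) (Xs @ Ys')" using Xs(3) Ys(3) Ys' by (simp add: sorted_wrt_append)
  moreover have "set (Xs @ Ys') \<subseteq> stable_interval M \<Omega> a c"
    using Xs(2) Ys(2) Ys' stable_interval_mono[OF order_refl \<open>b \<subseteq> c\<close>, of M \<Omega> a]
      stable_interval_mono[OF \<open>a \<subseteq> b\<close> order_refl, of M \<Omega> c] by auto
  moreover have "length (Xs @ Ys') = Suc t" using Xs(1) Ys(1) Ys' rs(1) by simp
  ultimately have "t \<in> chain_lengths (stable_interval M \<Omega> a c)" unfolding chain_lengths_def by blast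
  then show "enat t \<le> rel_length M \<Omega> a c"
    using enat_le_rel_length_iff[OF a order_trans[OF assms(4,5)]] by blast
qed

lemma rel_length_pos:
  assumes "stable_subgroup M \<Omega> a" "stable_subgroup M \<Omega> b" "a \<subset> b"
  shows "1 \<le> rel_length M \<Omega> a b"
proof -
  have "1 \<in> chain_lengths (stable_interval M \<Omega> a b)"
    unfolding chain_lengths_def
    by (rule CollectI, rule exI[of _ "[a, b]"]) (use assms in \<open>auto simp: stable_interval_def\<close>)
  then have "enat 1 \<le> rel_length M \<Omega> a b" using enat_le_rel_length_iff assms by blast
  then show ?thesis by (simp add: one_enat_def)
qed

lemma rel_length_self [simp]:
  assumes "stable_subgroup M \<Omega> a"
  shows "rel_length M \<Omega> a a = 0"
proof (rule ccontr)
  assume "rel_length M \<Omega> a a \<noteq> 0"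
  then have "enat 1 \<le> rel_length M \<Omega> a a" by (cases "rel_length M \<Omega> a a") (auto simp: zero_enat_def)
  then have "1 \<in> chain_lengths (stable_interval M \<Omega> a a)"
    using enat_le_rel_length_iff[OF assms] by blast
  then obtain Xs where Xs: "length Xs = Suc 1" "set Xs \<subseteq> stable_interval M \<Omega> a a" "sorted_wrt (\<subset>) Xs"
    unfolding chain_lengths_def by blast
  then obtain B Y where "Xs = [B, Y]" by (auto simp: length_Suc_conv)
  with Xs show False by (auto simp: stable_interval_def)
qed

text \<open>
  Given a chain from \<open>a\<close> to \<open>c\<close>, intersect its members with \<open>b\<close> and add \<open>b\<close> to them. By the modular
  law every step remains strict in at least one of the two resulting chains, so the length of the
  chain is at most the sum of the two lengths. Splicing chains gives the converse.
\<close>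

lemma rel_length_add:
  assumes a: "stable_subgroup M \<Omega> a" and b: "stable_subgroup M \<Omega> b" and c: "stable_subgroup M \<Omega> c"
    and ab: "a \<subseteq> b" and bc: "b \<subseteq> c" and \<Omega>: "\<Omega> \<subseteq> carrier R"
  shows "rel_length M \<Omega> a c = rel_length M \<Omega> a b + rel_length M \<Omega> b c"
proof (rule antisym[OF _ rel_length_superadditive[OF a b c ab bc]], rule enat_le_by_nat)
  let ?l = "rel_length M \<Omega>" and ?p = "\<lambda>B. plus_multiple M B \<one> b"
  have p: "stable_subgroup M \<Omega> (?p B)" "b \<subseteq> ?p B" "B \<subseteq> ?p B" if B: "stable_subgroup M \<Omega> B" for B
  proof -
    show "stable_subgroup M \<Omega> (?p B)" by (rule stable_subgroup_plus_multiple[OF B b _ \<Omega>]) simp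
    show "B \<subseteq> ?p B" by (rule subset_plus_multiple[OF B b]) simp
    show "b \<subseteq> ?p B"
      using smult_mem_plus_multiple[OF B b R.one_closed] stable_subgroup_mem[OF b] by auto
  qed
  have p_mono: "?p B \<subseteq> ?p Y" if "B \<subseteq> Y" for B Y
    using that by (rule plus_multiple_mono) simp
  have bound: "enat (length Xs) \<le> ?l a (last (a # Xs) \<inter> b) + ?l b (?p (last (a # Xs)))"
    if "set Xs \<subseteq> stable_interval M \<Omega> a c" "sorted_wrt (\<subset>) (a # Xs)" for Xs
    using that
  proof (induction Xs rule: rev_induct)
    case Nil
    show ?case by (simp add: zero_enat_def[symmetric])
  next
    case (snoc B' Xs)
    define B where "B = last (a # Xs)"
    have "B \<in> insert a (set Xs)" unfolding B_def using last_in_set[of "a # Xs"] by simp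
    then have B: "stable_subgroup M \<Omega> B" "a \<subseteq> B"
      using snoc.prems(1) a by (auto simp: stable_interval_def)
    have B': "stable_subgroup M \<Omega> B'" "a \<subseteq> B'" using snoc.prems(1) by (auto simp: stable_interval_def)
    have sub: "B \<subset> B'"
      using snoc.prems(2) \<open>B \<in> insert a (set Xs)\<close> by (auto simp: sorted_wrt_append)
    have IH: "enat (length Xs) \<le> ?l a (B \<inter> b) + ?l b (?p B)"
      using snoc unfolding B_def by (auto simp: sorted_wrt_append)
    have aXb: "a \<subseteq> B \<inter> b" using B(2) ab by blast
    have 1: "?l a (B' \<inter> b) \<ge> ?l a (B \<inter> b) + ?l (B \<inter> b) (B' \<inter> b)"
      by (rule rel_length_superadditive[OF a stable_subgroup_inter[OF B(1) b]
            stable_subgroup_inter[OF B'(1) b] aXb]) (use sub in blast)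
    have 2: "?l b (?p B') \<ge> ?l b (?p B) + ?l (?p B) (?p B')"
      by (rule rel_length_superadditive[OF b p(1)[OF B(1)] p(1)[OF B'(1)] p(2)[OF B(1)]])
        (use sub p_mono in blast)
    have "B \<inter> b \<subset> B' \<inter> b \<or> ?p B \<subset> ?p B'"
      using modular_cancel[OF B(1) B'(1) b] sub p_mono[of B B'] by blast
    then have "1 \<le> ?l (B \<inter> b) (B' \<inter> b) + ?l (?p B) (?p B')"
    proof
      assume "B \<inter> b \<subset> B' \<inter> b"
      from rel_length_pos[OF stable_subgroup_inter[OF B(1) b] stable_subgroup_inter[OF B'(1) b] this]
      show ?thesis by (rule add_increasing2[OF zero_le])
    next
      assume "?p B \<subset> ?p B'"
      from rel_length_pos[OF p(1)[OF B(1)] p(1)[OF B'(1)] this]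
      show ?thesis by (rule add_increasing[OF zero_le])
    qed
    then have "enat (length Xs) + 1 \<le> (?l a (B \<inter> b) + ?l b (?p B)) + (?l (B \<inter> b) (B' \<inter> b) + ?l (?p B) (?p B'))"
      using IH by (rule add_mono[rotated])
    also have "\<dots> = (?l a (B \<inter> b) + ?l (B \<inter> b) (B' \<inter> b)) + (?l b (?p B) + ?l (?p B) (?p B'))"
      by (simp add: add_ac)
    also have "\<dots> \<le> ?l a (B' \<inter> b) + ?l b (?p B')" using 1 2 by (rule add_mono)
    finally show ?case by (simp add: one_enat_def)
  qed
  fix r assume "enat r \<le> ?l a c"
  then obtain Xs where Xs: "length Xs = Suc r" "set Xs \<subseteq> stable_interval M \<Omega> a c" "sorted_wrt (\<subset>) Xs"
    using enat_le_rel_length_iff[OF a, of c r] ab bc unfolding chain_lengths_def by blast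
  obtain B Ys where Ys: "Xs = B # Ys" using Xs(1) by (cases Xs) auto
  have "a \<subseteq> B" using Xs Ys by (auto simp: stable_interval_def)
  then have "sorted_wrt (\<subset>) (a # Ys)" using Xs(3) Ys by auto
  moreover have "set Ys \<subseteq> stable_interval M \<Omega> a c" using Xs Ys by auto
  ultimately have le: "enat r \<le> ?l a (last (a # Ys) \<inter> b) + ?l b (?p (last (a # Ys)))"
    using bound[of Ys] Xs(1) Ys by simp
  define Z where "Z = last (a # Ys)"
  have Z: "stable_subgroup M \<Omega> Z" "a \<subseteq> Z" "Z \<subseteq> c"
    using last_in_set[of "a # Ys"] Xs Ys a ab bc unfolding Z_def[symmetric]
    by (auto simp: stable_interval_def)
  have "?l a (Z \<inter> b) \<le> ?l a b"
    by (rule rel_length_mono) auto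
  moreover have "?p Z \<subseteq> c"
    by (rule plus_multiple_subset[OF c Z(3)]) (use bc stable_subgroup_mem[OF b] in auto)
  then have "?l b (?p Z) \<le> ?l b c"
    by (intro rel_length_mono) auto
  ultimately have "?l a (Z \<inter> b) + ?l b (?p Z) \<le> ?l a b + ?l b c" by (rule add_mono)
  with le show "enat r \<le> ?l a b + ?l b c" unfolding Z_def by (rule order_trans)
qed

lemma rel_length_eq_0_iff:
  assumes "stable_subgroup M \<Omega> a" "stable_subgroup M \<Omega> b" "a \<subseteq> b"
  shows "rel_length M \<Omega> a b = 0 \<longleftrightarrow> a = b"
  using rel_length_pos[OF assms(1,2)] rel_length_self[OF assms(1)] assms(3)
  by (metis not_one_le_zero psubsetI)

text \<open>
  Multiplication by \<open>x\<close> induces an isomorphism \<open>L/(N : x) \<cong> (N + xL)/N\<close>. On the level of intervals it is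
  \<open>V \<mapsto> N + xV\<close> with inverse \<open>W \<mapsto> (W : x)\<close>, and strict monotonicity of both maps gives the two
  inequalities.
\<close>

lemma rel_length_colon_in:
  assumes N: "stable_subgroup M \<Omega> N" and L: "stable_subgroup M \<Omega> L"
    and x: "x \<in> carrier R" and \<Omega>: "\<Omega> \<subseteq> carrier R"
  shows "rel_length M \<Omega> (colon_in M N x L) L = rel_length M \<Omega> N (plus_multiple M N x L)"
proof (rule antisym)
  note memN = stable_subgroup_mem[OF N] and memL = stable_subgroup_mem[OF L]
  show "rel_length M \<Omega> (colon_in M N x L) L \<le> rel_length M \<Omega> N (plus_multiple M N x L)"
  proof (rule rel_length_mono_map[where f = "\<lambda>V. plus_multiple M N x V"])
    fix V assume V: "V \<in> stable_interval M \<Omega> (colon_in M N x L) L"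
    then show "plus_multiple M N x V \<in> stable_interval M \<Omega> N (plus_multiple M N x L)"
      using stable_subgroup_plus_multiple[OF N _ x \<Omega>] subset_plus_multiple[OF N _ x]
        plus_multiple_mono[of N N V L M x] by (auto simp: stable_interval_def)
    fix W assume W: "W \<in> stable_interval M \<Omega> (colon_in M N x L) L" and VW: "V \<subset> W"
    show "plus_multiple M N x V \<subset> plus_multiple M N x W"
    proof
      show "plus_multiple M N x V \<subseteq> plus_multiple M N x W"
        using VW by (intro plus_multiple_mono) auto
      show "plus_multiple M N x V \<noteq> plus_multiple M N x W"
      proof
        assume eq: "plus_multiple M N x V = plus_multiple M N x W"
        obtain w where w: "w \<in> W" "w \<notin> V" using VW by blast
        have sV: "stable_subgroup M \<Omega> V" and sW: "stable_subgroup M \<Omega> W"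
          and sub: "V \<subseteq> L" "W \<subseteq> L" "colon_in M N x L \<subseteq> V"
          using V W by (auto simp: stable_interval_def)
        have "x \<odot>\<^bsub>M\<^esub> w \<in> plus_multiple M N x V"
          unfolding eq by (rule smult_mem_plus_multiple[OF N sW x w(1)])
        then obtain a v where av: "a \<in> N" "v \<in> V" "x \<odot>\<^bsub>M\<^esub> w = a \<oplus>\<^bsub>M\<^esub> x \<odot>\<^bsub>M\<^esub> v"
          by (rule plus_multipleE)
        have c: "w \<in> carrier M" "v \<in> carrier M" "a \<in> carrier M" using w av sub memL memN by auto
        have "x \<odot>\<^bsub>M\<^esub> (w \<ominus>\<^bsub>M\<^esub> v) = x \<odot>\<^bsub>M\<^esub> w \<ominus>\<^bsub>M\<^esub> x \<odot>\<^bsub>M\<^esub> v"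
          using c x by (simp add: a_minus_def smult_r_distr smult_r_minus)
        also have "\<dots> = a" using av(3) c x by (simp add: a_minus_def M.add.m_assoc M.r_neg)
        finally have "w \<ominus>\<^bsub>M\<^esub> v \<in> colon_in M N x L"
          using av(1) stable_subgroupD(5)[OF L, of w v] w(1) av(2) sub(1,2)
          unfolding colon_in_def by blast
        then have "v \<oplus>\<^bsub>M\<^esub> (w \<ominus>\<^bsub>M\<^esub> v) \<in> V" using sub av(2) stable_subgroupD(3)[OF sV] by blast
        then show False using w(2) diff_add_cancel_right[OF c(1,2)] by simp
      qed
    qed
  qed
  show "rel_length M \<Omega> N (plus_multiple M N x L) \<le> rel_length M \<Omega> (colon_in M N x L) L"
  proof (rule rel_length_mono_map[where f = "\<lambda>V. colon_in M V x L"])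
    fix V assume V: "V \<in> stable_interval M \<Omega> N (plus_multiple M N x L)"
    then show "colon_in M V x L \<in> stable_interval M \<Omega> (colon_in M N x L) L"
      using stable_subgroup_colon_in[OF _ L x \<Omega>] by (auto simp: stable_interval_def colon_in_def)
    fix W assume W: "W \<in> stable_interval M \<Omega> N (plus_multiple M N x L)" and VW: "V \<subset> W"
    show "colon_in M V x L \<subset> colon_in M W x L"
    proof
      show "colon_in M V x L \<subseteq> colon_in M W x L" using VW by (auto simp: colon_in_def)
      show "colon_in M V x L \<noteq> colon_in M W x L"
      proof
        assume eq: "colon_in M V x L = colon_in M W x L"
        obtain w where w: "w \<in> W" "w \<notin> V" using VW by blast
        have sV: "stable_subgroup M \<Omega> V" and sW: "stable_subgroup M \<Omega> W"
          and sub: "N \<subseteq> V" "N \<subseteq> W" "W \<subseteq> plus_multiple M N x L"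
          using V W by (auto simp: stable_interval_def)
        obtain a m where am: "a \<in> N" "m \<in> L" "w = a \<oplus>\<^bsub>M\<^esub> x \<odot>\<^bsub>M\<^esub> m"
          using w(1) sub(3) by (blast elim: plus_multipleE)
        have c: "a \<in> carrier M" "m \<in> carrier M" using am memL memN by auto
        have "x \<odot>\<^bsub>M\<^esub> m = w \<ominus>\<^bsub>M\<^esub> a"
          using am(3) c x add_diff_cancel_left[of a "x \<odot>\<^bsub>M\<^esub> m"] by simp
        also have "\<dots> \<in> W" using w(1) am(1) sub stable_subgroupD(5)[OF sW] by blast
        finally have "m \<in> colon_in M V x L" unfolding eq using am(2) by (simp add: colon_in_def)
        then show False using w(2) am sub(1) stable_subgroupD(3)[OF sV] by (auto simp: colon_in_def)
      qed
    qed
  qed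
qed

end

section \<open>Finite length over an Artinian local ring\<close>

definition stable_acc :: "('r, 'm, 'y) module_scheme \<Rightarrow> 'r set \<Rightarrow> 'm set \<Rightarrow> 'm set \<Rightarrow> bool" where
  "stable_acc M \<Omega> N L \<longleftrightarrow>
     (\<forall>F::nat \<Rightarrow> 'm set. (\<forall>i. F i \<in> stable_interval M \<Omega> N L) \<longrightarrow> (\<forall>i. F i \<subseteq> F (Suc i)) \<longrightarrow>
        (\<exists>k. \<forall>i\<ge>k. F i = F k))"

lemma stable_accD:
  assumes "stable_acc M \<Omega> N L" "\<And>i. F i \<in> stable_interval M \<Omega> N L" "\<And>i. F i \<subseteq> F (Suc i)"
  shows "\<exists>k. \<forall>i\<ge>k. F i = F k"
proof -
  have "\<forall>i. F i \<in> stable_interval M \<Omega> N L" "\<forall>i. F i \<subseteq> F (Suc i)" using assms(2,3) by simp_all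
  with assms(1)[unfolded stable_acc_def, THEN spec, of F] show ?thesis by (simp only: simp_thms)
qed

lemma maximal_from_ascending_chains:
  fixes \<C> :: "'a::order set"
  assumes "b \<in> \<C>" and acc: "\<And>F::nat \<Rightarrow> 'a. (\<And>i. F i \<in> \<C>) \<Longrightarrow> (\<And>i. F i < F (Suc i)) \<Longrightarrow> False"
  obtains c where "c \<in> \<C>" "\<And>d. d \<in> \<C> \<Longrightarrow> \<not> c < d"
proof -
  let ?r = "{(y, x). x \<in> \<C> \<and> y \<in> \<C> \<and> x < y}"
  have "wf ?r" unfolding wf_iff_no_infinite_down_chain using acc by blast
  from this assms(1) show thesis
  proof (rule wfE_min)
    fix c assume c: "c \<in> \<C>" "\<And>d. (d, c) \<in> ?r \<Longrightarrow> d \<notin> \<C>"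
    show thesis
    proof (rule that[OF c(1)], rule notI)
      fix d assume d: "d \<in> \<C>" "c < d"
      then have "(d, c) \<in> ?r" using c(1) by simp
      from c(2)[OF this] d(1) show False by simp
    qed
  qed
qed

lemma minimal_from_descending_chains:
  fixes \<C> :: "'a::order set"
  assumes "b \<in> \<C>" and dcc: "\<And>F::nat \<Rightarrow> 'a. (\<And>i. F i \<in> \<C>) \<Longrightarrow> (\<And>i. F (Suc i) < F i) \<Longrightarrow> False"
  obtains c where "c \<in> \<C>" "\<And>d. d \<in> \<C> \<Longrightarrow> \<not> d < c"
proof -
  let ?r = "{(y, x). x \<in> \<C> \<and> y \<in> \<C> \<and> y < x}"
  have "wf ?r" unfolding wf_iff_no_infinite_down_chain using dcc by blast
  from this assms(1) show thesis
  proof (rule wfE_min)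
    fix c assume c: "c \<in> \<C>" "\<And>d. (d, c) \<in> ?r \<Longrightarrow> d \<notin> \<C>"
    show thesis
    proof (rule that[OF c(1)], rule notI)
      fix d assume d: "d \<in> \<C>" "d < c"
      then have "(d, c) \<in> ?r" using c(1) by simp
      from c(2)[OF this] d(1) show False by simp
    qed
  qed
qed

lemma stable_acc_maximal:
  assumes "stable_acc M \<Omega> N L" "\<C> \<subseteq> stable_interval M \<Omega> N L" "b \<in> \<C>"
  obtains c where "c \<in> \<C>" "\<And>d. d \<in> \<C> \<Longrightarrow> c \<subseteq> d \<Longrightarrow> d = c"
proof (rule maximal_from_ascending_chains[OF assms(3)])
  fix F :: "nat \<Rightarrow> 'a set"
  assume F: "\<And>i. F i \<in> \<C>" "\<And>i. F i \<subset> F (Suc i)"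
  have "\<exists>k. \<forall>i\<ge>k. F i = F k"
    by (rule stable_accD[OF assms(1), of F]) (rule subsetD[OF assms(2) F(1)] psubset_imp_subset[OF F(2)])+
  then obtain k where k: "\<forall>i\<ge>k. F i = F k" by (rule exE)
  from k[rule_format, OF le_SucI[OF order_refl]] F(2)[of k] show False by simp
next
  fix c assume c: "c \<in> \<C>" and max: "\<And>d. d \<in> \<C> \<Longrightarrow> \<not> c \<subset> d"
  show thesis
  proof (rule that[OF c])
    show "d = c" if "d \<in> \<C>" "c \<subseteq> d" for d using max[OF that(1)] that(2) by blast
  qed
qed

lemma finite_interval_length:
  assumes "finite (stable_interval M \<Omega> N L)"
  shows "rel_length M \<Omega> N L \<noteq> \<infinity>"
proof -
  have "enat r \<le> enat (card (stable_interval M \<Omega> N L))"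
    if "r \<in> chain_lengths (stable_interval M \<Omega> N L)" for r
  proof -
    from that obtain Xs where Xs: "length Xs = Suc r" "set Xs \<subseteq> stable_interval M \<Omega> N L" "sorted_wrt (\<subset>) Xs"
      unfolding chain_lengths_def by blast
    have "distinct Xs"
      using Xs(3) by (induction Xs) auto
    then show ?thesis
      using card_mono[OF assms Xs(2)] Xs(1) by (simp add: distinct_card)
  qed
  then have "rel_length M \<Omega> N L \<le> enat (card (stable_interval M \<Omega> N L))"
    unfolding rel_length_def by (rule SUP_least)
  then show ?thesis using enat_ile by fastforce
qed

context module
begin

text \<open>
  The lengths of the members of an ascending chain are bounded; once the largest one is attained,
  additivity leaves no room for a further strict step.
\<close>

lemma finite_length_acc:
  assumes N: "stable_subgroup M \<Omega> N" and "rel_length M \<Omega> N L \<noteq> \<infinity>" and \<Omega>: "\<Omega> \<subseteq> carrier R"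
  shows "stable_acc M \<Omega> N L"
  unfolding stable_acc_def
proof (intro allI impI)
  fix F :: "nat \<Rightarrow> 'c set"
  assume F: "\<forall>i. F i \<in> stable_interval M \<Omega> N L" and inc: "\<forall>i. F i \<subseteq> F (Suc i)"
  have mono: "F i \<subseteq> F j" if "i \<le> j" for i j using lift_Suc_mono_le[of F, OF _ that] inc by blast
  have F': "stable_subgroup M \<Omega> (F i)" "N \<subseteq> F i" "F i \<subseteq> L" for i
    using F by (auto simp: stable_interval_def)
  obtain l where l: "rel_length M \<Omega> N L = enat l" using assms(2) by auto
  have le: "rel_length M \<Omega> N (F i) \<le> enat l" for i
    unfolding l[symmetric] by (rule rel_length_mono) (use F' in auto)
  define g where "g i = the_enat (rel_length M \<Omega> N (F i))" for i
  have g: "rel_length M \<Omega> N (F i) = enat (g i)" "g i \<le> l" for i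
    using le[of i] unfolding g_def by (cases "rel_length M \<Omega> N (F i)"; simp)+
  obtain k where k: "\<And>i. g i \<le> g k"
    using ex_has_greatest_nat[of "\<lambda>_. True" 0 g "Suc l"] g(2) by (auto simp: less_Suc_eq_le)
  have "F i = F k" if "i \<ge> k" for i
  proof -
    have "enat (g i) = enat (g k) + rel_length M \<Omega> (F k) (F i)"
      unfolding g(1)[symmetric] by (rule rel_length_add[OF N F'(1) F'(1) F'(2) mono[OF that] \<Omega>])
    then have "rel_length M \<Omega> (F k) (F i) = 0"
      using k[of i] by (cases "rel_length M \<Omega> (F k) (F i)") (auto simp: zero_enat_def)
    then show ?thesis using rel_length_eq_0_iff[OF F'(1) F'(1) mono[OF that]] by simp
  qed
  then show "\<exists>k. \<forall>i\<ge>k. F i = F k" by (intro exI allI impI)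
qed

lemma stable_subgroup_Union_directed:
  assumes "\<C> \<noteq> {}" and st: "\<And>B. B \<in> \<C> \<Longrightarrow> stable_subgroup M \<Omega> B"
    and dir: "\<And>B C. B \<in> \<C> \<Longrightarrow> C \<in> \<C> \<Longrightarrow> B \<subseteq> C \<or> C \<subseteq> B"
  shows "stable_subgroup M \<Omega> (\<Union>\<C>)"
proof (rule stable_subgroupI)
  show "\<Union>\<C> \<subseteq> carrier M" using st stable_subgroup_mem by blast
  show "\<zero>\<^bsub>M\<^esub> \<in> \<Union>\<C>" using assms(1) stable_subgroupD(2)[OF st] by blast
  fix x assume "x \<in> \<Union>\<C>"
  then obtain B where B: "B \<in> \<C>" "x \<in> B" by blast
  then show "\<ominus>\<^bsub>M\<^esub> x \<in> \<Union>\<C>" using stable_subgroupD(4)[OF st] by blast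
  show "s \<odot>\<^bsub>M\<^esub> x \<in> \<Union>\<C>" if "s \<in> \<Omega>" for s using stable_subgroupD(6)[OF st that] B by blast
  fix y assume "y \<in> \<Union>\<C>"
  then obtain C where C: "C \<in> \<C>" "y \<in> C" by blast
  from dir[OF B(1) C(1)] show "x \<oplus>\<^bsub>M\<^esub> y \<in> \<Union>\<C>"
  proof
    assume "B \<subseteq> C"
    then show ?thesis using stable_subgroupD(3)[OF st[OF C(1)], of x y] B C by blast
  next
    assume "C \<subseteq> B"
    then show ?thesis using stable_subgroupD(3)[OF st[OF B(1)], of x y] B C by blast
  qed
qed

lemma rel_length_sum_finite:
  assumes N: "stable_subgroup M \<Omega> N" and L: "stable_subgroup M \<Omega> L" and \<Omega>: "\<Omega> \<subseteq> carrier R"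
    and "rel_length M \<Omega> {\<zero>\<^bsub>M\<^esub>} N \<noteq> \<infinity>" "rel_length M \<Omega> {\<zero>\<^bsub>M\<^esub>} L \<noteq> \<infinity>"
  shows "rel_length M \<Omega> {\<zero>\<^bsub>M\<^esub>} (plus_multiple M N \<one> L) \<noteq> \<infinity>"
proof -
  have "rel_length M \<Omega> (colon_in M N \<one> L) L \<le> rel_length M \<Omega> {\<zero>\<^bsub>M\<^esub>} L"
    by (rule rel_length_mono)
      (use stable_subgroupD(2)[OF stable_subgroup_colon_in[OF N L R.one_closed \<Omega>]] in auto)
  then have "rel_length M \<Omega> N (plus_multiple M N \<one> L) \<noteq> \<infinity>"
    using assms(5) rel_length_colon_in[OF N L R.one_closed \<Omega>] by (metis enat_ord_simps(5))
  moreover have "rel_length M \<Omega> {\<zero>\<^bsub>M\<^esub>} (plus_multiple M N \<one> L) =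
      rel_length M \<Omega> {\<zero>\<^bsub>M\<^esub>} N + rel_length M \<Omega> N (plus_multiple M N \<one> L)"
    by (rule rel_length_add[OF stable_subgroup_zero[OF \<Omega>] N
          stable_subgroup_plus_multiple[OF N L R.one_closed \<Omega>] _ subset_plus_multiple[OF N L R.one_closed] \<Omega>])
      (use stable_subgroupD(2)[OF N] in auto)
  ultimately show ?thesis
    using assms(4) by (simp add: plus_eq_infty_iff_enat del: not_infinity_eq)
qed

definition cyc :: "'c \<Rightarrow> 'c set" where
  "cyc y = {a \<odot>\<^bsub>M\<^esub> y | a. a \<in> carrier R}"

lemma stable_subgroup_cyc:
  assumes "y \<in> carrier M"
  shows "stable_subgroup M (carrier R) (cyc y)"
proof (rule stable_subgroupI)
  show "cyc y \<subseteq> carrier M" using assms by (auto simp: cyc_def)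
  show "\<zero>\<^bsub>M\<^esub> \<in> cyc y" unfolding cyc_def by (rule CollectI, rule exI[of _ \<zero>]) (simp add: assms)
  fix u assume "u \<in> cyc y"
  then obtain a where a: "a \<in> carrier R" "u = a \<odot>\<^bsub>M\<^esub> y" by (auto simp: cyc_def)
  show "\<ominus>\<^bsub>M\<^esub> u \<in> cyc y"
    unfolding cyc_def by (rule CollectI, rule exI[of _ "\<ominus> a"]) (simp add: assms a smult_l_minus)
  show "s \<odot>\<^bsub>M\<^esub> u \<in> cyc y" if "s \<in> carrier R" for s
    unfolding cyc_def by (rule CollectI, rule exI[of _ "s \<otimes> a"]) (simp add: assms a that smult_assoc1)
  fix v assume "v \<in> cyc y"
  then obtain b where b: "b \<in> carrier R" "v = b \<odot>\<^bsub>M\<^esub> y" by (auto simp: cyc_def)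
  show "u \<oplus>\<^bsub>M\<^esub> v \<in> cyc y"
    unfolding cyc_def by (rule CollectI, rule exI[of _ "a \<oplus> b"]) (simp add: assms a b smult_l_distr)
qed

lemma cyc_self: "y \<in> carrier M \<Longrightarrow> y \<in> cyc y"
  unfolding cyc_def by (rule CollectI, rule exI[of _ \<one>]) simp

end

context artinian_local_ring
begin

text \<open>
  Otherwise Zorn's lemma would place the ideal generated by \<open>a\<close> inside a maximal ideal, which can only
  be \<open>\<mm>\<close>.
\<close>

lemma nonmaximal_unit:
  assumes a: "a \<in> carrier A" "a \<notin> \<mm>"
  obtains b where "b \<in> carrier A" "b \<otimes> a = \<one>"
proof -
  have "\<one> \<in> PIdl a"
  proof (rule ccontr)
    assume no1: "\<one> \<notin> PIdl a"
    let ?\<I> = "{I. ideal I A \<and> a \<in> I \<and> \<one> \<notin> I}"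
    have "\<exists>J\<in>?\<I>. \<forall>I\<in>?\<I>. J \<subseteq> I \<longrightarrow> I = J"
    proof (rule subset_Zorn_nonempty)
      show "?\<I> \<noteq> {}" using cgenideal_ideal[OF a(1)] cgenideal_self[OF a(1)] no1 by blast
      fix \<C> assume C: "\<C> \<noteq> {}" "subset.chain ?\<I> \<C>"
      then have "subset.chain {I. ideal I A} \<C>" unfolding pred_on.chain_def by blast
      from chain_Union_is_ideal[OF this] C(1) have "ideal (\<Union>\<C>) A" by simp
      moreover have "\<C> \<subseteq> ?\<I>" using C(2) unfolding pred_on.chain_def by blast
      ultimately show "\<Union>\<C> \<in> ?\<I>" using C(1) by blast
    qed
    then obtain J where J: "ideal J A" "a \<in> J" "\<one> \<notin> J"
      and max: "\<And>I. ideal I A \<Longrightarrow> a \<in> I \<Longrightarrow> \<one> \<notin> I \<Longrightarrow> J \<subseteq> I \<Longrightarrow> I = J" by blast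
    have "maximalideal J A"
    proof (rule maximalidealI[OF J(1)])
      show "carrier A \<noteq> J" using J(3) by auto
      fix I assume I: "ideal I A" "J \<subseteq> I" "I \<subseteq> carrier A"
      show "I = J \<or> I = carrier A"
        using max[OF I(1) _ _ I(2)] J(2) I(2) ideal.one_imp_carrier[OF I(1)] by blast
    qed
    from unique_maximal[OF this] J(2) a(2) show False by simp
  qed
  then obtain b where "b \<in> carrier A" "b \<otimes> a = \<one>" unfolding cgenideal_def by auto
  then show thesis by (rule that)
qed

text \<open>
  The ideals generated by the powers of \<open>r\<close> become stationary, so \<open>r\<^sup>N = s r\<^sup>N\<^sup>+\<^sup>1\<close>, and \<open>1 - s r\<close> is a
  unit.
\<close>

lemma maximal_ideal_nilpotent:
  assumes r: "r \<in> \<mm>"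
  obtains n :: nat where "r [^] n = \<zero>"
proof -
  have rc: "r \<in> carrier A" using r a_subset by blast
  have "\<exists>N. \<forall>i\<ge>N. PIdl (r [^] (i::nat)) = PIdl (r [^] N)"
  proof (rule descending_chain)
    show "ideal (PIdl (r [^] (i::nat))) A" for i using rc by (simp add: cgenideal_ideal)
    show "PIdl (r [^] Suc i) \<subseteq> PIdl (r [^] i)" for i
    proof (rule cgenideal_minimal[OF cgenideal_ideal])
      show "r [^] i \<in> carrier A" using rc by simp
      show "r [^] Suc i \<in> PIdl (r [^] i)"
        unfolding cgenideal_def by (rule CollectI, rule exI[of _ r]) (simp add: rc m_comm)
    qed
  qed
  then obtain N where "PIdl (r [^] Suc N) = PIdl (r [^] N)" by (meson le_Suc_eq order_refl)
  then have "r [^] N \<in> PIdl (r [^] Suc N)" using cgenideal_self[of "r [^] N"] rc by simp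
  then obtain s where s: "s \<in> carrier A" "r [^] N = s \<otimes> r [^] Suc N" unfolding cgenideal_def by blast
  have sr: "s \<otimes> r \<in> \<mm>" using I_l_closed[OF r s(1)] .
  have "\<one> \<ominus> s \<otimes> r \<notin> \<mm>"
  proof
    assume "\<one> \<ominus> s \<otimes> r \<in> \<mm>"
    then have "(\<one> \<ominus> s \<otimes> r) \<oplus> s \<otimes> r \<in> \<mm>" using sr by simp
    moreover have "(\<one> \<ominus> s \<otimes> r) \<oplus> s \<otimes> r = \<one>" using s(1) rc by (simp add: a_minus_def a_assoc l_neg)
    ultimately have "\<one> \<in> \<mm>" by simp
    then show False using one_imp_carrier I_notcarr by simp
  qed
  then obtain b where b: "b \<in> carrier A" "b \<otimes> (\<one> \<ominus> s \<otimes> r) = \<one>"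
    using nonmaximal_unit[of "\<one> \<ominus> s \<otimes> r"] s(1) rc by auto
  have "(\<one> \<ominus> s \<otimes> r) \<otimes> r [^] N = r [^] N \<ominus> s \<otimes> r [^] Suc N"
    using s(1) rc by (simp add: a_minus_def l_distr l_minus m_assoc m_comm[of r])
  also have "\<dots> = \<zero>" using s rc by (simp add: a_minus_def r_neg)
  finally have "b \<otimes> ((\<one> \<ominus> s \<otimes> r) \<otimes> r [^] N) = \<zero>" using b(1) by simp
  then have "r [^] N = \<zero>" using b s(1) rc by (simp add: m_assoc[symmetric])
  then show thesis by (rule that)
qed

end

locale module_over_artinian = artinian_local_ring A \<mm> + module A V for A (structure) and \<mm> and V (structure)
begin

abbreviation alen where "alen \<equiv> rel_length V (carrier A) {\<zero>\<^bsub>V\<^esub>}"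
abbreviation astable where "astable \<equiv> stable_subgroup V (carrier A)"

text \<open>
  Submodules of \<open>A y\<close> are determined by the ideals \<open>{a. a y \<in> F i}\<close>, to which the descending chain
  condition of \<open>A\<close> applies.
\<close>

lemma cyc_descending:
  assumes y: "y \<in> carrier V" and F: "\<And>i::nat. astable (F i)" "\<And>i. F i \<subseteq> cyc y" "\<And>i. F (Suc i) \<subset> F i"
  shows False
proof -
  define I where "I i = {a \<in> carrier A. a \<odot>\<^bsub>V\<^esub> y \<in> F i}" for i
  have "\<exists>N. \<forall>i\<ge>N. I i = I N"
  proof (rule descending_chain)
    show "I (Suc i) \<subseteq> I i" for i using F(3)[of i] by (auto simp: I_def)
    show "ideal (I i) A" for i
    proof (rule idealI)
      show "ring A" by (rule ring_axioms)
      show "subgroup (I i) (add_monoid A)"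
      proof
        show "I i \<subseteq> carrier (add_monoid A)" by (auto simp: I_def)
        show "\<one>\<^bsub>add_monoid A\<^esub> \<in> I i" using stable_subgroupD(2)[OF F(1)] y by (simp add: I_def)
        show "x \<otimes>\<^bsub>add_monoid A\<^esub> z \<in> I i" if "x \<in> I i" "z \<in> I i" for x z
          using that stable_subgroupD(3)[OF F(1)] y by (simp add: I_def smult_l_distr)
        show "inv\<^bsub>add_monoid A\<^esub> x \<in> I i" if "x \<in> I i" for x
          using that stable_subgroupD(4)[OF F(1)] y
          by (simp add: I_def smult_l_minus a_inv_def[symmetric])
      qed
      show "x \<otimes> a \<in> I i" "a \<otimes> x \<in> I i" if "a \<in> I i" "x \<in> carrier A" for a x
        using that stable_subgroupD(6)[OF F(1), of x _ i] y
        by (auto simp: I_def smult_assoc1 m_comm[of a x])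
    qed
  qed
  then obtain N where "I (Suc N) = I N" by (meson le_Suc_eq order_refl)
  moreover have "F i = {a \<odot>\<^bsub>V\<^esub> y | a. a \<in> I i}" for i
    using F(2)[of i] by (auto simp: I_def cyc_def)
  ultimately have "F (Suc N) = F N" by simp
  with F(3)[of N] show False by simp
qed

lemma smult_image:
  assumes "astable c" "r \<in> carrier A"
  shows "plus_multiple V {\<zero>\<^bsub>V\<^esub>} r c = (\<lambda>m. r \<odot>\<^bsub>V\<^esub> m) ` c"
proof -
  have "\<zero>\<^bsub>V\<^esub> \<oplus>\<^bsub>V\<^esub> r \<odot>\<^bsub>V\<^esub> m = r \<odot>\<^bsub>V\<^esub> m" if "m \<in> c" for m
    using stable_subgroup_mem[OF assms(1) that] assms(2) by simp
  then show ?thesis unfolding plus_multiple_def by force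
qed

text \<open>
  Here \<open>c\<close> is a vector space over the residue field. For \<open>0 \<noteq> y \<in> c\<close>, Zorn's lemma provides a
  submodule \<open>H\<close> maximal among those avoiding \<open>y\<close>; it is a hyperplane, so nothing lies strictly between
  \<open>H\<close> and \<open>c\<close>.
\<close>

lemma finite_length_of_killed:
  assumes c: "astable c" and kill: "\<And>r m. r \<in> \<mm> \<Longrightarrow> m \<in> c \<Longrightarrow> r \<odot>\<^bsub>V\<^esub> m = \<zero>\<^bsub>V\<^esub>"
    and proper: "\<And>d. astable d \<Longrightarrow> d \<subset> c \<Longrightarrow> alen d \<noteq> \<infinity>"
  shows "alen c \<noteq> \<infinity>"
proof (cases "c = {\<zero>\<^bsub>V\<^esub>}")
  case True
  then show ?thesis using rel_length_self[OF c] by simp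
next
  case False
  then obtain y where y: "y \<in> c" "y \<noteq> \<zero>\<^bsub>V\<^esub>" using stable_subgroupD(2)[OF c] by blast
  let ?\<H> = "{H. astable H \<and> H \<subseteq> c \<and> y \<notin> H}"
  have "\<exists>H\<in>?\<H>. \<forall>K\<in>?\<H>. H \<subseteq> K \<longrightarrow> K = H"
  proof (rule subset_Zorn_nonempty)
    show "?\<H> \<noteq> {}"
      using stable_subgroup_zero[OF order_refl] stable_subgroupD(2)[OF c] y by blast
    fix \<C> assume C: "\<C> \<noteq> {}" "subset.chain ?\<H> \<C>"
    then have sub: "\<C> \<subseteq> ?\<H>" and dir: "\<And>B C. B \<in> \<C> \<Longrightarrow> C \<in> \<C> \<Longrightarrow> B \<subseteq> C \<or> C \<subseteq> B"
      unfolding pred_on.chain_def by blast+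
    have "astable (\<Union>\<C>)" by (rule stable_subgroup_Union_directed[OF C(1) _ dir]) (use sub in auto)
    then show "\<Union>\<C> \<in> ?\<H>" using sub by blast
  qed
  then obtain H where H': "H \<in> ?\<H>" and max': "\<forall>K\<in>?\<H>. H \<subseteq> K \<longrightarrow> K = H"
    by (rule bexE)
  from H' have H: "astable H" "H \<subseteq> c" "y \<notin> H" by auto
  have max: "K = H" if "astable K" "K \<subseteq> c" "y \<notin> K" "H \<subseteq> K" for K
    using max'[rule_format, of K] that by simp
  have "B = H \<or> B = c" if "B \<in> stable_interval V (carrier A) H c" for B
  proof (rule disjCI)
    assume "B \<noteq> c"
    have B: "astable B" "H \<subseteq> B" "B \<subseteq> c" using that by (auto simp: stable_interval_def)
    have "y \<notin> B"
    proof
      assume yB: "y \<in> B"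
      have "c \<subseteq> B"
      proof
        fix z assume z: "z \<in> c"
        note mem = stable_subgroup_mem[OF c] 
        have zc: "z \<in> carrier V" using mem z by blast
        show "z \<in> B"
        proof (cases "z \<in> H")
          case True then show ?thesis using B by blast
        next
          case False
          let ?K = "plus_multiple V H \<one> (cyc z)"
          have K: "astable ?K" "H \<subseteq> ?K" "z \<in> ?K"
            using stable_subgroup_plus_multiple[OF H(1) stable_subgroup_cyc[OF zc] one_closed]
              subset_plus_multiple[OF H(1) stable_subgroup_cyc[OF zc] one_closed]
              smult_mem_plus_multiple[OF H(1) stable_subgroup_cyc[OF zc] one_closed cyc_self[OF zc]] zc
            by auto
          have "?K \<subseteq> c"
            by (rule plus_multiple_subset[OF c H(2)])
              (use stable_subgroupD(6)[OF c _ z] mem in \<open>auto simp: cyc_def\<close>)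
          then have "y \<in> ?K" using max[OF K(1) _ _ K(2)] False K(3) by blast
          then obtain h r where hr: "h \<in> H" "r \<in> carrier A" "y = h \<oplus>\<^bsub>V\<^esub> r \<odot>\<^bsub>V\<^esub> z"
            using zc by (auto elim!: plus_multipleE simp: cyc_def)
          have hc: "h \<in> carrier V" using hr(1) H(2) mem by blast
          have "r \<notin> \<mm>"
          proof
            assume "r \<in> \<mm>"
            then have "y = h" using kill[OF _ z] hr(3) hc by simp
            then show False using hr(1) H(3) by simp
          qed
          then obtain b where b: "b \<in> carrier A" "b \<otimes> r = \<one>" using nonmaximal_unit[OF hr(2)] by blast
          have "b \<odot>\<^bsub>V\<^esub> (y \<ominus>\<^bsub>V\<^esub> h) = b \<odot>\<^bsub>V\<^esub> (r \<odot>\<^bsub>V\<^esub> z)"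
            using hr zc hc add_diff_cancel_left[of h "r \<odot>\<^bsub>V\<^esub> z"] by simp
          also have "\<dots> = z" using b hr(2) zc by (simp add: smult_assoc1[symmetric])
          finally have "z = b \<odot>\<^bsub>V\<^esub> (y \<ominus>\<^bsub>V\<^esub> h)" by simp
          moreover have "b \<odot>\<^bsub>V\<^esub> (y \<ominus>\<^bsub>V\<^esub> h) \<in> B"
            using stable_subgroupD(6)[OF B(1) b(1)] stable_subgroupD(5)[OF B(1) yB] hr(1) B(2) by blast
          ultimately show ?thesis by simp
        qed
      qed
      with B(3) \<open>B \<noteq> c\<close> show False by blast
    qed
    then show "B = H" using max[OF B(1,3)] B(2) by blast
  qed
  then have "stable_interval V (carrier A) H c \<subseteq> {H, c}" by blast
  then have "finite (stable_interval V (carrier A) H c)" by (rule finite_subset) simp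
  then have "rel_length V (carrier A) H c \<noteq> \<infinity>" by (rule finite_interval_length)
  moreover have "alen H \<noteq> \<infinity>" by (rule proper[OF H(1)]) (use H(2,3) y in blast)
  moreover have "alen c = alen H + rel_length V (carrier A) H c"
    by (rule rel_length_add[OF stable_subgroup_zero H(1) c _ H(2)])
      (use stable_subgroupD(2)[OF H(1)] in auto)
  ultimately show ?thesis by (simp add: plus_eq_infty_iff_enat del: not_infinity_eq)
qed

text \<open>
  If the length were infinite, the descending chain condition would give a submodule \<open>c\<close> minimal among
  those of infinite length. For a scalar \<open>r\<close> with \<open>r c \<noteq> c\<close> the image \<open>r c\<close> has finite length, hence the
  kernel of \<open>r\<close> on \<open>c\<close> has infinite length and is all of \<open>c\<close>. For \<open>r \<in> \<mm>\<close> the alternative \<open>r c = c\<close>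
  forces \<open>c = 0\<close> by nilpotency. So \<open>\<mm> c = 0\<close> in any case, and then \<open>c\<close> has finite length.
\<close>

lemma finite_length_cyc:
  assumes y: "y \<in> carrier V"
  shows "alen (cyc y) \<noteq> \<infinity>"
proof
  assume inf: "alen (cyc y) = \<infinity>"
  let ?\<C> = "{c. astable c \<and> c \<subseteq> cyc y \<and> alen c = \<infinity>}"
  obtain c where "c \<in> ?\<C>" and min': "\<And>d. d \<in> ?\<C> \<Longrightarrow> \<not> d \<subset> c"
  proof (rule minimal_from_descending_chains[of "cyc y" ?\<C>])
    show "cyc y \<in> ?\<C>" using stable_subgroup_cyc[OF y] inf by blast
    fix F :: "nat \<Rightarrow> _" assume "\<And>i. F i \<in> ?\<C>" "\<And>i. F (Suc i) \<subset> F i"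
    then show False by (intro cyc_descending[OF y, of F]) auto
  qed (rule that)
  then have c: "astable c" "c \<subseteq> cyc y" "alen c = \<infinity>" by auto
  have proper: "alen d \<noteq> \<infinity>" if "astable d" "d \<subset> c" for d
  proof
    assume "alen d = \<infinity>"
    then have "d \<in> ?\<C>" using that c(2) by simp
    from min'[OF this] that(2) show False by simp
  qed
  have "alen c \<noteq> \<infinity>"
  proof (rule finite_length_of_killed[OF c(1) _ proper])
    fix r m assume r: "r \<in> \<mm>" and m: "m \<in> c"
    have rc: "r \<in> carrier A" using r a_subset by blast
    let ?rc = "plus_multiple V {\<zero>\<^bsub>V\<^esub>} r c" and ?k = "colon_in V {\<zero>\<^bsub>V\<^esub>} r c"
    note z = stable_subgroup_zero[OF order_refl]
    have st: "astable ?rc" "astable ?k"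
      using stable_subgroup_plus_multiple[OF z c(1) rc order_refl]
        stable_subgroup_colon_in[OF z c(1) rc order_refl] by auto
    have sub: "?rc \<subseteq> c"
      by (rule plus_multiple_subset[OF c(1)]) (use stable_subgroupD[OF c(1)] rc in auto)
    show "r \<odot>\<^bsub>V\<^esub> m = \<zero>\<^bsub>V\<^esub>"
    proof (cases "?rc = c")
      case True
      then have im: "(\<lambda>m. r \<odot>\<^bsub>V\<^esub> m) ` c = c" using smult_image[OF c(1) rc] by simp
      have pow: "\<exists>m'\<in>c. m = r [^] n \<odot>\<^bsub>V\<^esub> m'" for n :: nat
      proof (induction n)
        case 0
        show ?case using m stable_subgroup_mem[OF c(1) m] by (intro bexI[of _ m]) simp_all
      next
        case (Suc n)
        then obtain m' where m': "m' \<in> c" "m = r [^] n \<odot>\<^bsub>V\<^esub> m'" by blast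
        then obtain m'' where m'': "m'' \<in> c" "m' = r \<odot>\<^bsub>V\<^esub> m''" using im by blast
        then have "m = r [^] Suc n \<odot>\<^bsub>V\<^esub> m''"
          using m'(2) rc stable_subgroup_mem[OF c(1) m''(1)] by (simp add: smult_assoc1)
        then show ?case using m''(1) by blast
      qed
      obtain n :: nat where "r [^] n = \<zero>" using maximal_ideal_nilpotent[OF r] .
      with pow[of n] stable_subgroup_mem[OF c(1)] have "m = \<zero>\<^bsub>V\<^esub>" by auto
      then show ?thesis using rc by simp
    next
      case False
      then have "alen ?rc \<noteq> \<infinity>" using proper[OF st(1)] sub by blast
      then have "rel_length V (carrier A) ?k c \<noteq> \<infinity>"
        using rel_length_colon_in[OF z c(1) rc order_refl] by simp
      moreover have "alen c = alen ?k + rel_length V (carrier A) ?k c"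
        by (rule rel_length_add[OF z st(2) c(1)]) (use stable_subgroupD(2)[OF st(2)] in \<open>auto simp: colon_in_def\<close>)
      ultimately have "alen ?k = \<infinity>" using c(3)
        by (metis plus_eq_infty_iff_enat)
      moreover have "?k \<subseteq> c" by (auto simp: colon_in_def)
      ultimately have "?k = c" using proper[OF st(2)] by blast
      then have "m \<in> ?k" using m by simp
      then show ?thesis by (simp add: colon_in_def)
    qed
  qed
  with c(3) show False by simp
qed

lemma finite_length_cover:
  assumes "finite Y" "Y \<subseteq> carrier V"
  obtains W where "astable W" "Y \<subseteq> W" "alen W \<noteq> \<infinity>"
proof -
  have "\<exists>W. astable W \<and> Y \<subseteq> W \<and> alen W \<noteq> \<infinity>"
    using assms
  proof (induction Y rule: finite_induct)
    case empty
    show ?case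
      using stable_subgroup_zero[OF order_refl] rel_length_self[OF stable_subgroup_zero[OF order_refl]]
      by (intro exI[of _ "{\<zero>\<^bsub>V\<^esub>}"]) simp
  next
    case (insert y Y)
    then obtain W where W: "astable W" "Y \<subseteq> W" "alen W \<noteq> \<infinity>" by auto
    have y: "y \<in> carrier V" using insert.prems by simp
    note cy = stable_subgroup_cyc[OF y]
    show ?case
    proof (intro exI conjI)
      show "astable (plus_multiple V W \<one> (cyc y))"
        by (rule stable_subgroup_plus_multiple[OF W(1) cy one_closed order_refl])
      show "insert y Y \<subseteq> plus_multiple V W \<one> (cyc y)"
        using subset_plus_multiple[OF W(1) cy one_closed] W(2)
          smult_mem_plus_multiple[OF W(1) cy one_closed cyc_self[OF y]] y by auto
      show "alen (plus_multiple V W \<one> (cyc y)) \<noteq> \<infinity>"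
        by (rule rel_length_sum_finite[OF W(1) cy order_refl W(3) finite_length_cyc[OF y]])
    qed
  qed
  then show thesis using that by blast
qed

text \<open>A maximal submodule of finite length absorbs every cyclic submodule.\<close>

lemma acc_finite_length:
  assumes W: "astable W" and acc: "stable_acc V (carrier A) {\<zero>\<^bsub>V\<^esub>} W"
  shows "alen W \<noteq> \<infinity>"
proof -
  let ?\<C> = "{N \<in> stable_interval V (carrier A) {\<zero>\<^bsub>V\<^esub>} W. alen N \<noteq> \<infinity>}"
  note z = stable_subgroup_zero[OF order_refl]
  have "{\<zero>\<^bsub>V\<^esub>} \<in> ?\<C>"
    using z stable_subgroupD(2)[OF W] rel_length_self[OF z]
    by (simp add: stable_interval_def del: not_infinity_eq)
  then obtain N where "N \<in> ?\<C>" and max: "\<And>N'. N' \<in> ?\<C> \<Longrightarrow> N \<subseteq> N' \<Longrightarrow> N' = N"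
    by (rule stable_acc_maximal[OF acc, of ?\<C>, rotated]) auto
  then have N: "astable N" "N \<subseteq> W" "alen N \<noteq> \<infinity>" by (auto simp: stable_interval_def)
  have "W \<subseteq> N"
  proof
    fix y assume y: "y \<in> W"
    have yc: "y \<in> carrier V" by (rule stable_subgroup_mem[OF W y])
    note cy = stable_subgroup_cyc[OF yc]
    let ?K = "plus_multiple V N \<one> (cyc y)"
    have "?K \<subseteq> W"
      by (rule plus_multiple_subset[OF W N(2)])
        (use stable_subgroupD(6)[OF W _ y] stable_subgroup_mem[OF W] in \<open>auto simp: cyc_def\<close>)
    moreover have "alen ?K \<noteq> \<infinity>"
      by (rule rel_length_sum_finite[OF N(1) cy order_refl N(3) finite_length_cyc[OF yc]])
    moreover have K: "astable ?K" by (rule stable_subgroup_plus_multiple[OF N(1) cy one_closed order_refl])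
    ultimately have "?K = N"
      using max[of ?K] subset_plus_multiple[OF N(1) cy one_closed] stable_subgroupD(2)[OF K]
      by (auto simp: stable_interval_def)
    then show "y \<in> N"
      using smult_mem_plus_multiple[OF N(1) cy one_closed cyc_self[OF yc]] yc by simp
  qed
  with N show ?thesis by (metis antisym)
qed

end

section \<open>Hilbert's basis theorem\<close>

context module
begin

lemma stable_subgroup_insert:
  assumes "stable_subgroup M \<Omega> N" "\<And>m. m \<in> N \<Longrightarrow> x \<odot>\<^bsub>M\<^esub> m \<in> N"
  shows "stable_subgroup M (insert x \<Omega>) N"
  using assms by (simp add: stable_subgroup_def)

lemma stable_subgroup_subset:
  "stable_subgroup M \<Omega> N \<Longrightarrow> \<Omega>' \<subseteq> \<Omega> \<Longrightarrow> stable_subgroup M \<Omega>' N"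
  unfolding stable_subgroup_def by blast

context
  fixes \<Omega> :: "'a set" and W :: "'c set" and x :: 'a
  assumes \<Omega>: "\<Omega> \<subseteq> carrier R" and W: "stable_subgroup M \<Omega> W" and x: "x \<in> carrier R"
begin

primrec poly_part :: "nat \<Rightarrow> 'c set" where
  "poly_part 0 = {\<zero>\<^bsub>M\<^esub>}"
| "poly_part (Suc i) = plus_multiple M (poly_part i) (x [^] i) W"

text \<open>
  The coefficients of \<open>x\<^sup>i\<close> in those elements of \<open>N\<close> that can be written as polynomials of degree at
  most \<open>i\<close> in \<open>x\<close> with coefficients in \<open>W\<close>. Such expressions are not unique in general, so all of them
  are admitted.
\<close>

definition lead_part :: "nat \<Rightarrow> 'c set \<Rightarrow> 'c set" where
  "lead_part i N = {w \<in> W. \<exists>p\<in>poly_part i. p \<oplus>\<^bsub>M\<^esub> (x [^] i) \<odot>\<^bsub>M\<^esub> w \<in> N}"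

lemma lead_partI:
  "w \<in> W \<Longrightarrow> p \<in> poly_part i \<Longrightarrow> p \<oplus>\<^bsub>M\<^esub> (x [^] i) \<odot>\<^bsub>M\<^esub> w \<in> N \<Longrightarrow> w \<in> lead_part i N"
  unfolding lead_part_def by blast

lemma stable_poly_part: "stable_subgroup M \<Omega> (poly_part i)"
proof (induction i)
  case 0 show ?case using stable_subgroup_zero[OF \<Omega>] by simp
next
  case (Suc i)
  then show ?case using stable_subgroup_plus_multiple[OF Suc W _ \<Omega>] x by simp
qed

lemma poly_part_mono: "i \<le> j \<Longrightarrow> poly_part i \<subseteq> poly_part j"
proof (rule lift_Suc_mono_le[of poly_part])
  show "poly_part n \<subseteq> poly_part (Suc n)" for n
    using subset_plus_multiple[OF stable_poly_part W, of "x [^] n"] x by simp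
qed

lemma smult_poly_part: "p \<in> poly_part i \<Longrightarrow> x \<odot>\<^bsub>M\<^esub> p \<in> poly_part (Suc i)"
proof (induction i arbitrary: p)
  case 0
  then show ?case using stable_subgroupD(2)[OF stable_poly_part[of 1]] x by simp
next
  case (Suc i)
  then obtain q w where qw: "q \<in> poly_part i" "w \<in> W" "p = q \<oplus>\<^bsub>M\<^esub> (x [^] i) \<odot>\<^bsub>M\<^esub> w"
    by (auto elim: plus_multipleE)
  have c: "q \<in> carrier M" "w \<in> carrier M"
    using stable_subgroup_mem[OF stable_poly_part qw(1)] stable_subgroup_mem[OF W qw(2)] by auto
  have "x \<odot>\<^bsub>M\<^esub> p = x \<odot>\<^bsub>M\<^esub> q \<oplus>\<^bsub>M\<^esub> (x [^] Suc i) \<odot>\<^bsub>M\<^esub> w"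
    using qw(3) c x by (simp add: smult_r_distr smult_assoc1[symmetric] R.m_comm)
  moreover have "x \<odot>\<^bsub>M\<^esub> q \<in> poly_part (Suc i)" by (rule Suc.IH[OF qw(1)])
  ultimately show ?case using plus_multipleI[OF _ qw(2), of _ "poly_part (Suc i)" "x [^] Suc i"]
    by (simp only: poly_part.simps(2)[of "Suc i"])
qed

definition poly_closure :: "'c set" where
  "poly_closure = (\<Union>i. poly_part i)"

lemma stable_poly_closure: "stable_subgroup M (insert x \<Omega>) poly_closure"
proof (rule stable_subgroup_insert)
  show "stable_subgroup M \<Omega> poly_closure"
    unfolding poly_closure_def
  proof (rule stable_subgroup_Union_directed)
    fix B C assume "B \<in> range poly_part" "C \<in> range poly_part"
    then obtain i j where "B = poly_part i" "C = poly_part j" by blast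
    then show "B \<subseteq> C \<or> C \<subseteq> B" using poly_part_mono[of i j] poly_part_mono[of j i] nat_le_linear[of i j] by auto
  qed (use stable_poly_part in auto)
  show "x \<odot>\<^bsub>M\<^esub> m \<in> poly_closure" if "m \<in> poly_closure" for m
    using that smult_poly_part unfolding poly_closure_def by blast
qed

lemma subset_poly_closure: "W \<subseteq> poly_closure"
proof -
  have "poly_part 1 \<subseteq> poly_closure" unfolding poly_closure_def by blast
  moreover have "W \<subseteq> poly_part 1"
  proof
    fix w assume w: "w \<in> W"
    then have "\<zero>\<^bsub>M\<^esub> \<oplus>\<^bsub>M\<^esub> (x [^] (0::nat)) \<odot>\<^bsub>M\<^esub> w \<in> poly_part 1"
      by (simp add: plus_multipleI del: nat_pow_0)
    then show "w \<in> poly_part 1" using stable_subgroup_mem[OF W w] by simp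
  qed
  ultimately show ?thesis by blast
qed

lemma stable_lead_part:
  assumes N: "stable_subgroup M (insert x \<Omega>) N"
  shows "stable_subgroup M \<Omega> (lead_part i N)"
proof (rule stable_subgroupI)
  note memW = stable_subgroup_mem[OF W] and memP = stable_subgroup_mem[OF stable_poly_part]
  note P = stable_subgroupD[OF stable_poly_part[of i]]
  show "lead_part i N \<subseteq> carrier M" using memW by (auto simp: lead_part_def)
  show "\<zero>\<^bsub>M\<^esub> \<in> lead_part i N"
    unfolding lead_part_def using P(2) stable_subgroupD(2)[OF W] stable_subgroupD(2)[OF N] x
    by (auto intro!: bexI[of _ "\<zero>\<^bsub>M\<^esub>"])
  fix v assume "v \<in> lead_part i N"
  then obtain p where v: "v \<in> W" "p \<in> poly_part i" "p \<oplus>\<^bsub>M\<^esub> (x [^] i) \<odot>\<^bsub>M\<^esub> v \<in> N"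
    unfolding lead_part_def by blast
  have vc: "v \<in> carrier M" "p \<in> carrier M" using v memW memP by auto
  show "\<ominus>\<^bsub>M\<^esub> v \<in> lead_part i N"
  proof -
    have "\<ominus>\<^bsub>M\<^esub> p \<oplus>\<^bsub>M\<^esub> (x [^] i) \<odot>\<^bsub>M\<^esub> (\<ominus>\<^bsub>M\<^esub> v) = \<ominus>\<^bsub>M\<^esub> (p \<oplus>\<^bsub>M\<^esub> (x [^] i) \<odot>\<^bsub>M\<^esub> v)"
      using vc x by (simp add: smult_r_minus M.minus_add)
    then show ?thesis
      using v P(4)[of p] stable_subgroupD(4)[OF W] stable_subgroupD(4)[OF N v(3)]
      by (intro lead_partI[of _ "\<ominus>\<^bsub>M\<^esub> p"]) simp_all
  qed
  show "s \<odot>\<^bsub>M\<^esub> v \<in> lead_part i N" if s: "s \<in> \<Omega>" for s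
  proof -
    have "s \<odot>\<^bsub>M\<^esub> p \<oplus>\<^bsub>M\<^esub> (x [^] i) \<odot>\<^bsub>M\<^esub> (s \<odot>\<^bsub>M\<^esub> v) = s \<odot>\<^bsub>M\<^esub> (p \<oplus>\<^bsub>M\<^esub> (x [^] i) \<odot>\<^bsub>M\<^esub> v)"
      using vc x s \<Omega> smult_comm[of s "x [^] i" v] by (auto simp: smult_r_distr)
    then show ?thesis
      using v s P(6)[of s p] stable_subgroupD(6)[OF W] stable_subgroupD(6)[OF N _ v(3), of s]
      by (intro lead_partI[of _ "s \<odot>\<^bsub>M\<^esub> p"]) simp_all
  qed
  fix u assume "u \<in> lead_part i N"
  then obtain q where u: "u \<in> W" "q \<in> poly_part i" "q \<oplus>\<^bsub>M\<^esub> (x [^] i) \<odot>\<^bsub>M\<^esub> u \<in> N"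
    unfolding lead_part_def by blast
  have uc: "u \<in> carrier M" "q \<in> carrier M" using u memW memP by auto
  show "v \<oplus>\<^bsub>M\<^esub> u \<in> lead_part i N"
  proof -
    have "(p \<oplus>\<^bsub>M\<^esub> q) \<oplus>\<^bsub>M\<^esub> (x [^] i) \<odot>\<^bsub>M\<^esub> (v \<oplus>\<^bsub>M\<^esub> u) =
        (p \<oplus>\<^bsub>M\<^esub> (x [^] i) \<odot>\<^bsub>M\<^esub> v) \<oplus>\<^bsub>M\<^esub> (q \<oplus>\<^bsub>M\<^esub> (x [^] i) \<odot>\<^bsub>M\<^esub> u)"
      using vc uc x by (simp add: smult_r_distr M.add.m_ac)
    then show ?thesis
      using v u P(3)[of p q] stable_subgroupD(3)[OF W] stable_subgroupD(3)[OF N v(3) u(3)]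
      by (intro lead_partI[of _ "p \<oplus>\<^bsub>M\<^esub> q"]) simp_all
  qed
qed

lemma lead_part_mono:
  assumes N': "stable_subgroup M (insert x \<Omega>) N'" and "i \<le> j" "N \<subseteq> N'"
  shows "lead_part i N \<subseteq> lead_part j N'"
proof -
  have "lead_part n N' \<subseteq> lead_part (Suc n) N'" for n
  proof
    fix w assume "w \<in> lead_part n N'"
    then obtain p where w: "w \<in> W" "p \<in> poly_part n" "p \<oplus>\<^bsub>M\<^esub> (x [^] n) \<odot>\<^bsub>M\<^esub> w \<in> N'"
      unfolding lead_part_def by blast
    have c: "p \<in> carrier M" "w \<in> carrier M"
      using stable_subgroup_mem[OF stable_poly_part w(2)] stable_subgroup_mem[OF W w(1)] by auto
    have "x \<odot>\<^bsub>M\<^esub> (p \<oplus>\<^bsub>M\<^esub> (x [^] n) \<odot>\<^bsub>M\<^esub> w) \<in> N'" using stable_subgroupD(6)[OF N' _ w(3)] by simp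
    moreover have "x \<odot>\<^bsub>M\<^esub> (p \<oplus>\<^bsub>M\<^esub> (x [^] n) \<odot>\<^bsub>M\<^esub> w) = x \<odot>\<^bsub>M\<^esub> p \<oplus>\<^bsub>M\<^esub> (x [^] Suc n) \<odot>\<^bsub>M\<^esub> w"
      using c x by (simp add: smult_r_distr smult_assoc1[symmetric] R.m_comm)
    ultimately show "w \<in> lead_part (Suc n) N'"
      unfolding lead_part_def using w(1) smult_poly_part[OF w(2)] by auto
  qed
  from lift_Suc_mono_le[of "\<lambda>n. lead_part n N'", OF this assms(2)]
  have "lead_part i N' \<subseteq> lead_part j N'" .
  moreover have "lead_part i N \<subseteq> lead_part i N'" using assms(3) unfolding lead_part_def by blast
  ultimately show ?thesis by blast
qed

text \<open>
  An element of \<open>N'\<close> is reduced to lower degree in \<open>x\<close> by subtracting an element of \<open>N\<close> with the same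
  leading coefficient.
\<close>

lemma lead_part_determines:
  assumes N: "stable_subgroup M (insert x \<Omega>) N" and N': "stable_subgroup M (insert x \<Omega>) N'"
    and "N \<subseteq> N'" "N' \<subseteq> poly_closure" and lead: "\<And>i. lead_part i N' \<subseteq> lead_part i N"
  shows "N' = N"
proof -
  have "y \<in> N" if "y \<in> N'" "y \<in> poly_part i" for y i
    using that
  proof (induction i arbitrary: y)
    case 0
    then show ?case using stable_subgroupD(2)[OF N] by simp
  next
    case (Suc i)
    then obtain p w where pw: "p \<in> poly_part i" "w \<in> W" "y = p \<oplus>\<^bsub>M\<^esub> (x [^] i) \<odot>\<^bsub>M\<^esub> w"
      by (auto elim: plus_multipleE)
    then have "w \<in> lead_part i N'" unfolding lead_part_def using Suc.prems(1) by auto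
    then obtain q where q: "q \<in> poly_part i" "q \<oplus>\<^bsub>M\<^esub> (x [^] i) \<odot>\<^bsub>M\<^esub> w \<in> N"
      using lead unfolding lead_part_def by blast
    let ?z = "q \<oplus>\<^bsub>M\<^esub> (x [^] i) \<odot>\<^bsub>M\<^esub> w"
    have c: "p \<in> carrier M" "q \<in> carrier M" "w \<in> carrier M"
      using stable_subgroup_mem[OF stable_poly_part] pw q stable_subgroup_mem[OF W] by auto
    have zy: "?z \<in> carrier M" "y \<in> carrier M" using c pw(3) x by auto
    have "y \<ominus>\<^bsub>M\<^esub> ?z = p \<ominus>\<^bsub>M\<^esub> q"
      unfolding pw(3) using c x by (simp add: a_minus_def M.minus_add M.add.m_ac M.r_neg1 M.r_neg)
    moreover have "p \<ominus>\<^bsub>M\<^esub> q \<in> poly_part i"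
      using stable_subgroupD(5)[OF stable_poly_part pw(1) q(1)] .
    moreover have "y \<ominus>\<^bsub>M\<^esub> ?z \<in> N'" using stable_subgroupD(5)[OF N' Suc.prems(1)] q(2) assms(3) by blast
    ultimately have "y \<ominus>\<^bsub>M\<^esub> ?z \<in> N" using Suc.IH by simp
    then have "?z \<oplus>\<^bsub>M\<^esub> (y \<ominus>\<^bsub>M\<^esub> ?z) \<in> N" using stable_subgroupD(3)[OF N q(2)] by blast
    then show ?case using diff_add_cancel_right[OF zy(2,1)] by simp
  qed
  then show ?thesis using assms(3,4) unfolding poly_closure_def by blast
qed

text \<open>
  For an ascending chain \<open>F\<close> the leading parts \<open>lead_part i (F k)\<close> grow with both \<open>i\<close> and \<open>k\<close>. The
  diagonal becomes stationary at some \<open>k0\<close>, which settles all degrees \<open>i \<ge> k0\<close> at once; the finitely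
  many smaller degrees become stationary one by one.
\<close>

lemma hilbert_basis_step:
  assumes acc: "stable_acc M \<Omega> {\<zero>\<^bsub>M\<^esub>} W"
  shows "stable_acc M (insert x \<Omega>) {\<zero>\<^bsub>M\<^esub>} poly_closure"
  unfolding stable_acc_def
proof (intro allI impI)
  fix F :: "nat \<Rightarrow> 'c set"
  assume F: "\<forall>i. F i \<in> stable_interval M (insert x \<Omega>) {\<zero>\<^bsub>M\<^esub>} poly_closure" and inc: "\<forall>i. F i \<subseteq> F (Suc i)"
  have st: "stable_subgroup M (insert x \<Omega>) (F i)" and sub: "F i \<subseteq> poly_closure" for i
    using F[rule_format, of i] by (auto simp: stable_interval_def)
  have mono: "F i \<subseteq> F j" if "i \<le> j" for i j by (rule lift_Suc_mono_le[of F, OF inc[rule_format] that])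
  have L: "lead_part i (F k) \<in> stable_interval M \<Omega> {\<zero>\<^bsub>M\<^esub>} W" for i k
    using stable_lead_part[OF st] stable_subgroupD(2)[OF stable_lead_part[OF st]]
    by (auto simp: stable_interval_def lead_part_def)
  have Lmono: "lead_part i (F k) \<subseteq> lead_part j (F l)" if "i \<le> j" "k \<le> l" for i j k l
    by (rule lead_part_mono[OF st that(1) mono[OF that(2)]])
  have "\<exists>k0. \<forall>k\<ge>k0. lead_part k (F k) = lead_part k0 (F k0)"
    by (rule stable_accD[OF acc, of "\<lambda>k. lead_part k (F k)"]) (rule L, rule Lmono, simp_all)
  then obtain k0 where k0: "\<forall>k\<ge>k0. lead_part k (F k) = lead_part k0 (F k0)" by (rule exE)
  have "\<exists>K. \<forall>k\<ge>K. lead_part i (F k) = lead_part i (F K)" for i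
    by (rule stable_accD[OF acc, of "\<lambda>k. lead_part i (F k)"]) (rule L, rule Lmono, simp_all)
  then have "\<forall>i. \<exists>K. \<forall>k\<ge>K. lead_part i (F k) = lead_part i (F K)" by (rule allI)
  then obtain K where K: "\<forall>i. \<forall>k\<ge>K i. lead_part i (F k) = lead_part i (F (K i))"
    by (rule choice[THEN exE])
  \<comment> \<open>an index beyond \<open>k0\<close> and beyond every \<open>K i\<close> with \<open>i < k0\<close>\<close>
  define m where "m = k0 + (\<Sum>i<k0. K i)"
  have lead: "lead_part i (F k) \<subseteq> lead_part i (F m)" if k: "m \<le> k" for i k
  proof (cases "i < k0")
    case True
    then have "K i \<le> (\<Sum>i<k0. K i)" by (intro member_le_sum) auto
    then have "K i \<le> m" unfolding m_def by simp
    then have "lead_part i (F k) = lead_part i (F (K i))" "lead_part i (F m) = lead_part i (F (K i))"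
      using K[rule_format, of i k] K[rule_format, of i m] k by linarith+
    then show ?thesis by simp
  next
    case False
    have "lead_part i (F k) \<subseteq> lead_part (max i k) (F (max i k))" by (rule Lmono) auto
    also have "\<dots> = lead_part k0 (F k0)" by (rule k0[rule_format]) (use False in auto)
    also have "\<dots> \<subseteq> lead_part i (F m)" by (rule Lmono) (use False in \<open>auto simp: m_def\<close>)
    finally show ?thesis .
  qed
  have "F k = F m" if "m \<le> k" for k
    by (rule lead_part_determines[OF st st mono[OF that] sub lead[OF that]])
  then show "\<exists>k. \<forall>i\<ge>k. F i = F k" by (intro exI allI impI)
qed

end

text \<open>The elements of \<open>T\<close> are adjoined one at a time.\<close>

theorem hilbert_basis:
  assumes "finite T" "T \<subseteq> carrier R" and \<Omega>: "\<Omega> \<subseteq> carrier R"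
    and W: "stable_subgroup M \<Omega> W" "stable_acc M \<Omega> {\<zero>\<^bsub>M\<^esub>} W"
  shows "\<exists>W'. stable_subgroup M (\<Omega> \<union> T) W' \<and> W \<subseteq> W' \<and> stable_acc M (\<Omega> \<union> T) {\<zero>\<^bsub>M\<^esub>} W'"
  using assms(1,2)
proof (induction T rule: finite_induct)
  case empty
  then show ?case using W by auto
next
  case (insert x T)
  then obtain W' where W': "stable_subgroup M (\<Omega> \<union> T) W'" "W \<subseteq> W'" "stable_acc M (\<Omega> \<union> T) {\<zero>\<^bsub>M\<^esub>} W'"
    by auto
  have c: "\<Omega> \<union> T \<subseteq> carrier R" "x \<in> carrier R" using insert.prems \<Omega> by auto
  have "\<Omega> \<union> insert x T = insert x (\<Omega> \<union> T)" by simp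
  then show ?case
    using stable_poly_closure[OF c(1) W'(1) c(2)] subset_poly_closure[OF c(1) W'(1) c(2)] W'(2)
      hilbert_basis_step[OF c(1) W'(1) c(2) W'(3)] by (metis order_trans)
qed

end

section \<open>Homogeneous components and graded families\<close>

text \<open>The homogeneous component of degree \<open>n\<close>, read off from the unique decomposition of \<open>x\<close>.\<close>

definition hcomp :: "('g, 'x) ring_scheme \<Rightarrow> ('d multi \<Rightarrow> 'g set) \<Rightarrow> 'd multi \<Rightarrow> 'g \<Rightarrow> 'g" where
  "hcomp G gr n x = (THE f. (\<forall>n. f n \<in> gr n) \<and> finite {n. f n \<noteq> \<zero>\<^bsub>G\<^esub>} \<and>
     x = (\<Oplus>\<^bsub>G\<^esub>n\<in>{n. f n \<noteq> \<zero>\<^bsub>G\<^esub>}. f n)) n"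

context multigraded_group
begin

lemma gr_closed [simp]: "x \<in> gr n \<Longrightarrow> x \<in> carrier G"
  using additive_subgroup.a_subset[OF gr_subgroup] by blast

lemma gr_zero [simp]: "\<zero> \<in> gr n" by (rule additive_subgroup.zero_closed[OF gr_subgroup])

lemma gr_add [simp]: "x \<in> gr n \<Longrightarrow> y \<in> gr n \<Longrightarrow> x \<oplus> y \<in> gr n"
  by (rule additive_subgroup.a_closed[OF gr_subgroup])

lemma gr_minus [simp]: "x \<in> gr n \<Longrightarrow> \<ominus> x \<in> gr n"
  by (rule additive_subgroup.a_inv_closed[OF gr_subgroup])

abbreviation (input) decomposes where
  "decomposes x f \<equiv> (\<forall>n. f n \<in> gr n) \<and> finite {n. f n \<noteq> \<zero>} \<and> x = (\<Oplus>n\<in>{n. f n \<noteq> \<zero>}. f n)"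

lemma decomposes_hcomp:
  assumes "x \<in> carrier G"
  shows "decomposes x (\<lambda>n. hcomp G gr n x)"
  using theI'[OF gr_decomposition[OF assms]] unfolding hcomp_def .

lemma hcomp_in_gr [simp]: "x \<in> carrier G \<Longrightarrow> hcomp G gr n x \<in> gr n"
  using decomposes_hcomp by blast

lemma finite_hcomp: "x \<in> carrier G \<Longrightarrow> finite {n. hcomp G gr n x \<noteq> \<zero>}"
  using decomposes_hcomp by blast

lemma hcomp_sum: "x \<in> carrier G \<Longrightarrow> x = (\<Oplus>n\<in>{n. hcomp G gr n x \<noteq> \<zero>}. hcomp G gr n x)"
  using decomposes_hcomp by blast

lemma hcomp_unique:
  assumes "x \<in> carrier G" "\<And>n. f n \<in> gr n" "finite F" "\<And>n. n \<notin> F \<Longrightarrow> f n = \<zero>" "x = (\<Oplus>n\<in>F. f n)"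
  shows "hcomp G gr n x = f n"
proof -
  have sub: "{n. f n \<noteq> \<zero>} \<subseteq> F" using assms(4) by blast
  have "(\<Oplus>n\<in>F. f n) = (\<Oplus>n\<in>{n. f n \<noteq> \<zero>}. f n)"
    by (rule add.finprod_mono_neutral_cong_right[OF assms(3) sub])
      (auto intro: gr_closed[OF assms(2)])
  moreover have "finite {n. f n \<noteq> \<zero>}" using sub assms(3) finite_subset by blast
  ultimately have "decomposes x f" using assms(2,5) by simp
  then have "(THE f. decomposes x f) = f"
    by (rule the1_equality[OF gr_decomposition[OF assms(1)]])
  then show ?thesis unfolding hcomp_def by simp
qed

lemma hcomp_homogeneous:
  assumes "x \<in> gr k"
  shows "hcomp G gr n x = (if n = k then x else \<zero>)"
  by (rule hcomp_unique[of x "\<lambda>n. if n = k then x else \<zero>" "{k}"]) (use assms in auto)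

lemma hcomp_zero [simp]: "hcomp G gr n \<zero> = \<zero>"
  using hcomp_homogeneous[OF gr_zero, of n] by simp

lemma hcomp_add:
  assumes "x \<in> carrier G" "y \<in> carrier G"
  shows "hcomp G gr n (x \<oplus> y) = hcomp G gr n x \<oplus> hcomp G gr n y"
proof -
  let ?F = "{n. hcomp G gr n x \<noteq> \<zero>} \<union> {n. hcomp G gr n y \<noteq> \<zero>}"
  have fin: "finite ?F" using finite_hcomp assms by simp
  have *: "(\<Oplus>n\<in>?F. hcomp G gr n z) = z"
    if z: "z \<in> carrier G" and sub: "{n. hcomp G gr n z \<noteq> \<zero>} \<subseteq> ?F" for z
  proof -
    have "(\<Oplus>n\<in>?F. hcomp G gr n z) = (\<Oplus>n\<in>{n. hcomp G gr n z \<noteq> \<zero>}. hcomp G gr n z)"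
      by (rule add.finprod_mono_neutral_cong_right[OF fin sub]) (use z gr_closed[OF hcomp_in_gr[OF z]] in auto)
    then show ?thesis using hcomp_sum[OF z] by simp
  qed
  have "(\<Oplus>n\<in>?F. hcomp G gr n x \<oplus> hcomp G gr n y) =
      (\<Oplus>n\<in>?F. hcomp G gr n x) \<oplus> (\<Oplus>n\<in>?F. hcomp G gr n y)"
    by (rule finsum_addf) (use assms gr_closed[OF hcomp_in_gr] in auto)
  also have "\<dots> = x \<oplus> y" by (simp only: *[OF assms(1) Un_upper1] *[OF assms(2) Un_upper2])
  finally show ?thesis
    by (intro hcomp_unique[of "x \<oplus> y" "\<lambda>n. hcomp G gr n x \<oplus> hcomp G gr n y" ?F]) (use assms fin in auto)
qed

lemma hcomp_minus:
  assumes "x \<in> carrier G"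
  shows "hcomp G gr n (\<ominus> x) = \<ominus> hcomp G gr n x"
proof -
  have c: "hcomp G gr n x \<in> carrier G" "hcomp G gr n (\<ominus> x) \<in> carrier G"
    using assms gr_closed[OF hcomp_in_gr] by auto
  have "hcomp G gr n (\<ominus> x) \<oplus> hcomp G gr n x = \<zero>"
    using hcomp_add[of "\<ominus> x" x n] assms by (simp add: l_neg)
  then show ?thesis using c by (simp add: minus_equality)
qed

lemma hcomp_induct [consumes 1, case_names zero homogeneous add]:
  assumes x: "x \<in> carrier G" and "P \<zero>" and "\<And>n. P (hcomp G gr n x)"
    and "\<And>y z. y \<in> carrier G \<Longrightarrow> z \<in> carrier G \<Longrightarrow> P y \<Longrightarrow> P z \<Longrightarrow> P (y \<oplus> z)"
  shows "P x"
proof -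
  have "P (\<Oplus>n\<in>F. hcomp G gr n x)" if "finite F" for F
    using that
  proof (induction F rule: finite_induct)
    case empty then show ?case using assms(2) by simp
  next
    case (insert n F)
    have c: "(\<lambda>n. hcomp G gr n x) \<in> A \<rightarrow> carrier G" for A using x gr_closed[OF hcomp_in_gr] by auto
    then have "(\<Oplus>n\<in>insert n F. hcomp G gr n x) = hcomp G gr n x \<oplus> (\<Oplus>n\<in>F. hcomp G gr n x)"
      using insert.hyps by (intro finsum_insert) auto
    then show ?case using assms(4)[OF _ _ assms(3) insert.IH] c x gr_closed[OF hcomp_in_gr[OF x]]
      by (simp add: finsum_closed)
  qed
  from this[OF finite_hcomp[OF x]] show ?thesis using hcomp_sum[OF x] by simp
qed

end

context multigraded_module
begin

abbreviation "mcomp \<equiv> hcomp M Mg"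

lemma hcomp_smult:
  assumes s: "s \<in> Sg k" "s \<in> carrier S" and m: "m \<in> carrier M"
  shows "mcomp n (s \<odot> m) = (if k \<le> n then s \<odot> mcomp (n - k) m else \<zero>)"
  using m
proof (induction m rule: grading.hcomp_induct)
  case zero
  then show ?case using s by simp
next
  case (homogeneous i)
  let ?x = "mcomp i m"
  have x: "?x \<in> Mg i" using m by simp
  have "(n = k + i) \<longleftrightarrow> (k \<le> n \<and> n - k = i)"
    by (auto simp: fun_eq_iff le_fun_def) (metis le_add_diff_inverse)
  then show ?case
    using grading.hcomp_homogeneous[OF smult_gr[OF s(1) x]] grading.hcomp_homogeneous[OF x] s(2) by auto
next
  case (add y z)
  then show ?case
    using s grading.gr_closed[OF grading.hcomp_in_gr]
    by (cases "k \<le> n") (simp_all add: smult_r_distr grading.hcomp_add)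
qed

lemma hcomp_smult_shift:
  assumes "s \<in> Sg k" "s \<in> carrier S" "m \<in> carrier M"
  shows "mcomp (n + k) (s \<odot> m) = s \<odot> mcomp n m"
proof -
  have "k \<le> n + k" "n + k - k = n" by (auto simp: le_fun_def fun_eq_iff)
  then show ?thesis using hcomp_smult[OF assms, of "n + k"] by simp
qed

end

text \<open>
  A graded module that is Noetherian over finitely many elements of total degree one together with
  scalars \<open>\<Omega>\<close> of degree zero. The function \<open>dg\<close> assigns to each generator one direction, because the
  zero element lies in every component.
\<close>

locale graded_generators = multigraded_module S Sg M Mg
  for S and Sg :: "'d::finite multi \<Rightarrow> _ set" and M (structure) and Mg +
  fixes \<Omega> T :: "'a set" and dg :: "'a \<Rightarrow> 'd"
  assumes \<Omega>_gr: "\<Omega> \<subseteq> Sg 0" and \<Omega>_closed: "\<Omega> \<subseteq> carrier S"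
    and T_finite: "finite T" and T_closed: "T \<subseteq> carrier S"
    and T_gr: "t \<in> T \<Longrightarrow> t \<in> Sg (unit_multi (dg t))"
    and gr_stable: "stable_subgroup M \<Omega> (Mg n)"
    and noetherian: "stable_acc M (\<Omega> \<union> T) {\<zero>} (carrier M)"
begin

lemma \<Omega>T_closed: "\<Omega> \<union> T \<subseteq> carrier S"
  using \<Omega>_closed T_closed by blast

lemma word_closed: "set w \<subseteq> T \<Longrightarrow> m \<in> carrier M \<Longrightarrow> foldr (\<odot>) w m \<in> carrier M"
  using T_closed by (induction w) auto

lemma word_degree:
  assumes "set w \<subseteq> T" "m \<in> Mg n"
  shows "\<exists>k. foldr (\<odot>) w m \<in> Mg (k + n) \<and> (w \<noteq> [] \<longrightarrow> k \<noteq> 0)"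
  using assms
proof (induction w)
  case Nil
  then show ?case by (intro exI[of _ 0]) simp
next
  case (Cons t w)
  have "\<exists>k. foldr (\<odot>) w m \<in> Mg (k + n) \<and> (w \<noteq> [] \<longrightarrow> k \<noteq> 0)"
    by (rule Cons.IH) (use Cons.prems in simp_all)
  then obtain k where k: "foldr (\<odot>) w m \<in> Mg (k + n)" by blast
  have "t \<odot> foldr (\<odot>) w m \<in> Mg (unit_multi (dg t) + (k + n))"
    by (rule smult_gr[OF T_gr k]) (use Cons.prems in simp)
  moreover have "unit_multi (dg t) + k \<noteq> 0"
  proof
    assume "unit_multi (dg t) + k = 0"
    from fun_cong[OF this, of "dg t"] show False by (simp add: unit_multi_def)
  qed
  ultimately show ?case by (intro exI[of _ "unit_multi (dg t) + k"]) (simp only: add.assoc foldr.simps o_apply simp_thms)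
qed

lemma word_add:
  "set w \<subseteq> T \<Longrightarrow> m \<in> carrier M \<Longrightarrow> m' \<in> carrier M \<Longrightarrow>
    foldr (\<odot>) w (m \<oplus> m') = foldr (\<odot>) w m \<oplus> foldr (\<odot>) w m'"
  using T_closed by (induction w) (auto simp: word_closed smult_r_distr)

lemma word_smult:
  "set w \<subseteq> T \<Longrightarrow> m \<in> carrier M \<Longrightarrow> s \<in> carrier S \<Longrightarrow>
    foldr (\<odot>) w (s \<odot> m) = s \<odot> foldr (\<odot>) w m"
  using T_closed by (induction w) (auto simp: word_closed smult_comm)

text \<open>
  A submodule of \<open>M\<close> whose part of degree \<open>n\<close> is \<open>V\<close>: all elements that words in the generators carry
  into \<open>V\<close> whenever they reach degree \<open>n\<close>. It embeds the \<open>\<Omega>\<close>-submodules of \<open>M\<^sub>n\<close> into the submodules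
  of \<open>M\<close>, which transfers the ascending chain condition to the components.
\<close>

definition pull_component :: "'d multi \<Rightarrow> 'c set \<Rightarrow> 'c set" where
  "pull_component n V = {m \<in> carrier M. \<forall>w. set w \<subseteq> T \<longrightarrow> mcomp n (foldr (\<odot>) w m) \<in> V}"

lemma pull_component_stable:
  assumes V: "stable_subgroup M \<Omega> V"
  shows "stable_subgroup M (\<Omega> \<union> T) (pull_component n V)"
proof (rule stable_subgroupI)
  show "pull_component n V \<subseteq> carrier M" by (auto simp: pull_component_def)
  have "foldr (\<odot>) w \<zero> = \<zero>" if "set w \<subseteq> T" for w using that T_closed by (induction w) auto
  then show "\<zero> \<in> pull_component n V"
    using stable_subgroupD(2)[OF V] by (simp add: pull_component_def)
  have neg: "foldr (\<odot>) w (\<ominus> m) = \<ominus> foldr (\<odot>) w m" if "set w \<subseteq> T" "m \<in> carrier M" for w m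
    using that T_closed by (induction w) (auto simp: word_closed smult_r_minus)
  fix x assume "x \<in> pull_component n V"
  then have x: "x \<in> carrier M" "\<And>w. set w \<subseteq> T \<Longrightarrow> mcomp n (foldr (\<odot>) w x) \<in> V"
    by (auto simp: pull_component_def)
  show "\<ominus> x \<in> pull_component n V"
    using x stable_subgroupD(4)[OF V]
    by (auto simp: pull_component_def neg word_closed grading.hcomp_minus)
  show "x \<oplus> y \<in> pull_component n V" if "y \<in> pull_component n V" for y
    using x that stable_subgroupD(3)[OF V]
    by (auto simp: pull_component_def word_add word_closed grading.hcomp_add)
  fix s assume "s \<in> \<Omega> \<union> T"
  then show "s \<odot> x \<in> pull_component n V"
  proof
    assume s: "s \<in> \<Omega>"
    then have sc: "s \<in> carrier S" "s \<in> Sg 0" using \<Omega>_closed \<Omega>_gr by auto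
    have "mcomp n (s \<odot> foldr (\<odot>) w x) = s \<odot> mcomp n (foldr (\<odot>) w x)" if "set w \<subseteq> T" for w
      using hcomp_smult_shift[OF sc(2,1) word_closed[OF that x(1)], of n] by simp
    then show ?thesis
      using x sc stable_subgroupD(6)[OF V s] by (auto simp: pull_component_def word_smult)
  next
    assume s: "s \<in> T"
    have "mcomp n (foldr (\<odot>) w (s \<odot> x)) \<in> V" if "set w \<subseteq> T" for w
      using x(2)[of "w @ [s]"] that s by simp
    then show ?thesis using x(1) s T_closed by (auto simp: pull_component_def)
  qed
qed

lemma pull_component_inter:
  assumes V: "stable_subgroup M \<Omega> V" "V \<subseteq> Mg n"
  shows "pull_component n V \<inter> Mg n = V"
proof
  show "pull_component n V \<inter> Mg n \<subseteq> V"
  proof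
    fix m assume m: "m \<in> pull_component n V \<inter> Mg n"
    then have "mcomp n (foldr (\<odot>) [] m) \<in> V" unfolding pull_component_def by (auto dest: spec[of _ "[]"])
    then show "m \<in> V" using m grading.hcomp_homogeneous[of m n n] by simp
  qed
  show "V \<subseteq> pull_component n V \<inter> Mg n"
  proof
    fix m assume m: "m \<in> V"
    have mn: "m \<in> Mg n" using m V(2) by blast
    have "mcomp n (foldr (\<odot>) w m) \<in> V" if w: "set w \<subseteq> T" for w
    proof (cases "w = []")
      case True
      then show ?thesis using m grading.hcomp_homogeneous[OF mn, of n] by simp
    next
      case False
      from word_degree[OF w mn] obtain k where k: "foldr (\<odot>) w m \<in> Mg (k + n)" "k \<noteq> 0"
        using False by blast
      have "n \<noteq> k + n"
      proof
        assume "n = k + n"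
        then have "k i = 0" for i using fun_cong[of n "k + n" i] by simp
        with k(2) show False by (auto simp: fun_eq_iff)
      qed
      then show ?thesis using grading.hcomp_homogeneous[OF k(1), of n] stable_subgroupD(2)[OF V(1)] by simp
    qed
    then show "m \<in> pull_component n V \<inter> Mg n" using mn by (simp add: pull_component_def)
  qed
qed

lemma component_acc: "stable_acc M \<Omega> {\<zero>} (Mg n)"
  unfolding stable_acc_def
proof (intro allI impI)
  fix F :: "nat \<Rightarrow> 'c set"
  assume F: "\<forall>i. F i \<in> stable_interval M \<Omega> {\<zero>} (Mg n)" and inc: "\<forall>i. F i \<subseteq> F (Suc i)"
  have st: "stable_subgroup M \<Omega> (F i)" "F i \<subseteq> Mg n" for i
    using F[rule_format, of i] by (auto simp: stable_interval_def)
  have "\<exists>k. \<forall>i\<ge>k. pull_component n (F i) = pull_component n (F k)"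
  proof (rule stable_accD[OF noetherian, of "\<lambda>i. pull_component n (F i)"])
    show "pull_component n (F i) \<in> stable_interval M (\<Omega> \<union> T) {\<zero>} (carrier M)" for i
      using pull_component_stable[OF st(1)] stable_subgroupD(1,2)[OF pull_component_stable[OF st(1)]]
      by (auto simp: stable_interval_def)
    show "pull_component n (F i) \<subseteq> pull_component n (F (Suc i))" for i
      using inc[rule_format, of i] by (auto simp: pull_component_def)
  qed
  then obtain k where k: "\<forall>i\<ge>k. pull_component n (F i) = pull_component n (F k)" by (rule exE)
  have "F i = F k" if "i \<ge> k" for i
  proof -
    have "pull_component n (F i) \<inter> Mg n = pull_component n (F k) \<inter> Mg n"
      by (simp only: k[rule_format, OF that])
    then show ?thesis by (simp only: pull_component_inter[OF st])
  qed
  then show "\<exists>k. \<forall>i\<ge>k. F i = F k" by (intro exI allI impI)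
qed

text \<open>
  Graded submodules are represented by their components. Closure is required only under the
  generators in \<open>I\<close>, since the construction of the Hilbert polynomial discards generators one by one.
\<close>

definition graded_family :: "'a set \<Rightarrow> ('d multi \<Rightarrow> 'c set) \<Rightarrow> bool" where
  "graded_family I N \<longleftrightarrow> (\<forall>n. stable_subgroup M \<Omega> (N n) \<and> N n \<subseteq> Mg n) \<and>
     (\<forall>t\<in>I. \<forall>n. \<forall>m\<in>N n. t \<odot> m \<in> N (n + unit_multi (dg t)))"

definition family_acc :: "'a set \<Rightarrow> ('d multi \<Rightarrow> 'c set) \<Rightarrow> ('d multi \<Rightarrow> 'c set) \<Rightarrow> bool" where
  "family_acc I N L \<longleftrightarrow>
     (\<forall>F::nat \<Rightarrow> 'd multi \<Rightarrow> 'c set.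
        (\<forall>i. graded_family I (F i) \<and> N \<le> F i \<and> F i \<le> L) \<longrightarrow> (\<forall>i. F i \<le> F (Suc i)) \<longrightarrow>
        (\<exists>k. \<forall>i\<ge>k. F i = F k))"

lemma graded_familyD:
  assumes "graded_family I N"
  shows "stable_subgroup M \<Omega> (N n)" "N n \<subseteq> Mg n"
    "t \<in> I \<Longrightarrow> m \<in> N n \<Longrightarrow> t \<odot> m \<in> N (n + unit_multi (dg t))"
  using assms unfolding graded_family_def by simp_all

lemma graded_familyI:
  assumes "\<And>n. stable_subgroup M \<Omega> (N n)" "\<And>n. N n \<subseteq> Mg n"
    "\<And>t m n. t \<in> I \<Longrightarrow> m \<in> N n \<Longrightarrow> t \<odot> m \<in> N (n + unit_multi (dg t))"
  shows "graded_family I N"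
  using assms unfolding graded_family_def by simp

lemma graded_family_subset: "graded_family I N \<Longrightarrow> J \<subseteq> I \<Longrightarrow> graded_family J N"
  unfolding graded_family_def by blast

lemma graded_family_mem: "graded_family I N \<Longrightarrow> m \<in> N n \<Longrightarrow> m \<in> carrier M"
  using graded_familyD(2) by fastforce

lemma graded_family_whole: "graded_family T Mg"
proof (rule graded_familyI)
  show "t \<odot> m \<in> Mg (n + unit_multi (dg t))" if "t \<in> T" "m \<in> Mg n" for t m n
    using smult_gr[OF T_gr[OF that(1)] that(2)] by (simp add: add.commute)
qed (use gr_stable in auto)

text \<open>
  The submodule with the given components. It transfers the ascending chain condition from ordinary
  submodules to graded families.
\<close>

definition family_total :: "('d multi \<Rightarrow> 'c set) \<Rightarrow> 'c set" where
  "family_total N = {m \<in> carrier M. \<forall>n. mcomp n m \<in> N n}"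

lemma family_total_stable:
  assumes N: "graded_family T N"
  shows "stable_subgroup M (\<Omega> \<union> T) (family_total N)"
proof (rule stable_subgroupI)
  note D = stable_subgroupD[OF graded_familyD(1)[OF N]]
  show "family_total N \<subseteq> carrier M" by (auto simp: family_total_def)
  show "\<zero> \<in> family_total N" using D(2) by (simp add: family_total_def)
  fix x assume x: "x \<in> family_total N"
  then have xc: "x \<in> carrier M" by (simp add: family_total_def)
  show "\<ominus> x \<in> family_total N" using x D(4) by (simp add: family_total_def grading.hcomp_minus)
  show "x \<oplus> y \<in> family_total N" if "y \<in> family_total N" for y
    using x that D(3) by (simp add: family_total_def grading.hcomp_add)
  fix s assume "s \<in> \<Omega> \<union> T"
  then show "s \<odot> x \<in> family_total N"
  proof
    assume s: "s \<in> \<Omega>"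
    then have sc: "s \<in> carrier S" "s \<in> Sg 0" using \<Omega>_closed \<Omega>_gr by auto
    then show ?thesis
      using x D(6)[OF s] hcomp_smult_shift[OF sc(2,1) xc] by (simp add: family_total_def)
  next
    assume s: "s \<in> T"
    then have sc: "s \<in> carrier S" "s \<in> Sg (unit_multi (dg s))" using T_closed T_gr by auto
    have "mcomp n (s \<odot> x) \<in> N n" for n
    proof (cases "unit_multi (dg s) \<le> n")
      case True
      then have "n - unit_multi (dg s) + unit_multi (dg s) = n" by (auto simp: le_fun_def fun_eq_iff)
      moreover have "s \<odot> mcomp (n - unit_multi (dg s)) x \<in> N (n - unit_multi (dg s) + unit_multi (dg s))"
        by (rule graded_familyD(3)[OF N s]) (use x in \<open>simp add: family_total_def\<close>)
      ultimately show ?thesis using hcomp_smult[OF sc(2,1) xc, of n] True by simp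
    next
      case False
      then show ?thesis using hcomp_smult[OF sc(2,1) xc, of n] D(2) by simp
    qed
    then show ?thesis using sc xc by (simp add: family_total_def)
  qed
qed

lemma family_total_inter:
  assumes N: "graded_family T N"
  shows "family_total N \<inter> Mg n = N n"
proof
  show "family_total N \<inter> Mg n \<subseteq> N n"
  proof
    fix m assume m: "m \<in> family_total N \<inter> Mg n"
    then have "mcomp n m \<in> N n" by (simp add: family_total_def)
    then show "m \<in> N n" using m grading.hcomp_homogeneous[of m n n] by simp
  qed
  show "N n \<subseteq> family_total N \<inter> Mg n"
  proof
    fix m assume m: "m \<in> N n"
    then have mn: "m \<in> Mg n" using graded_familyD(2)[OF N] by blast
    then show "m \<in> family_total N \<inter> Mg n"
      using m grading.hcomp_homogeneous[OF mn] stable_subgroupD(2)[OF graded_familyD(1)[OF N]]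
      by (simp add: family_total_def)
  qed
qed

lemma family_acc_whole: "family_acc T N L"
  unfolding family_acc_def
proof (intro allI impI)
  fix F :: "nat \<Rightarrow> 'd multi \<Rightarrow> 'c set"
  assume F: "\<forall>i. graded_family T (F i) \<and> N \<le> F i \<and> F i \<le> L" and inc: "\<forall>i. F i \<le> F (Suc i)"
  have gf: "graded_family T (F i)" for i using F by blast
  have "\<exists>k. \<forall>i\<ge>k. family_total (F i) = family_total (F k)"
  proof (rule stable_accD[OF noetherian, of "\<lambda>i. family_total (F i)"])
    show "family_total (F i) \<in> stable_interval M (\<Omega> \<union> T) {\<zero>} (carrier M)" for i
      using family_total_stable[OF gf] stable_subgroupD(1,2)[OF family_total_stable[OF gf]]
      by (auto simp: stable_interval_def)
    show "family_total (F i) \<subseteq> family_total (F (Suc i))" for i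
      using inc[rule_format, of i] by (auto simp: family_total_def le_fun_def)
  qed
  then obtain k where k: "\<forall>i\<ge>k. family_total (F i) = family_total (F k)" by (rule exE)
  have "F i = F k" if "i \<ge> k" for i
  proof
    fix n
    have "family_total (F i) \<inter> Mg n = family_total (F k) \<inter> Mg n"
      by (simp only: k[rule_format, OF that])
    then show "F i n = F k n" by (simp only: family_total_inter[OF gf])
  qed
  then show "\<exists>k. \<forall>i\<ge>k. F i = F k" by (intro exI allI impI)
qed

lemma family_acc_sub:
  assumes acc: "family_acc I N L" and "N \<le> N'" "L' \<le> L"
    and gf: "\<And>F. graded_family J F \<Longrightarrow> N' \<le> F \<Longrightarrow> F \<le> L' \<Longrightarrow> graded_family I F"
  shows "family_acc J N' L'"
  unfolding family_acc_def
proof (intro allI impI)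
  fix F :: "nat \<Rightarrow> 'd multi \<Rightarrow> 'c set"
  assume F: "\<forall>i. graded_family J (F i) \<and> N' \<le> F i \<and> F i \<le> L'" and inc: "\<forall>i. F i \<le> F (Suc i)"
  have "\<forall>i. graded_family I (F i) \<and> N \<le> F i \<and> F i \<le> L"
  proof (rule allI)
    fix i
    from F have "graded_family J (F i)" "N' \<le> F i" "F i \<le> L'" by blast+
    then show "graded_family I (F i) \<and> N \<le> F i \<and> F i \<le> L"
      using gf assms(2,3) order_trans by blast
  qed
  then show "\<exists>k. \<forall>i\<ge>k. F i = F k"
    using acc[unfolded family_acc_def, THEN spec, of F] inc by (simp only: simp_thms)
qed

text \<open>
  Replacing \<open>N n\<close> by \<open>L n\<close> in all degrees with \<open>n j \<le> k\<close> produces a graded submodule, because the only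
  generators that leave this range send \<open>L\<close> into \<open>N\<close>. These submodules ascend with \<open>k\<close>, so they become
  stationary, which means \<open>L n = N n\<close> far out in direction \<open>j\<close>.
\<close>

lemma truncation:
  assumes acc: "family_acc I N L" and N: "graded_family I N" and L: "graded_family I L" and NL: "N \<le> L"
    and kill: "\<And>t n m. t \<in> I \<Longrightarrow> dg t = j \<Longrightarrow> m \<in> L n \<Longrightarrow> t \<odot> m \<in> N (n + unit_multi j)"
  shows "\<exists>k. \<forall>n. k < n j \<longrightarrow> L n \<subseteq> N n"
proof -
  \<comment> \<open>the truncations, ascending in \<open>k\<close>\<close>
  define F where "F k n = (if n j \<le> k then L n else N n)" for k :: nat and n
  have NLn: "N n \<subseteq> L n" for n using NL by (simp add: le_fun_def)
  have NF: "N n \<subseteq> F k n" for k n using NLn by (simp add: F_def)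
  have "graded_family I (F k)" for k
  proof (rule graded_familyI)
    fix t m n assume t: "t \<in> I" and m: "m \<in> F k n"
    show "t \<odot> m \<in> F k (n + unit_multi (dg t))"
    proof (cases "n j \<le> k \<and> dg t \<noteq> j")
      case True
      then have "m \<in> L n" "(n + unit_multi (dg t)) j \<le> k" using m by (auto simp: F_def unit_multi_def)
      then show ?thesis using graded_familyD(3)[OF L t] by (simp add: F_def)
    next
      case False
      then have "t \<odot> m \<in> N (n + unit_multi (dg t))"
        using m kill[OF t _ , of m n] graded_familyD(3)[OF N t, of m n] by (auto simp: F_def split: if_splits)
      then show ?thesis using NF by blast
    qed
  qed (use graded_familyD(1,2)[OF N] graded_familyD(1,2)[OF L] in \<open>auto simp: F_def\<close>)
  moreover have "N \<le> F k" "F k \<le> L" "F k \<le> F (Suc k)" for k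
    using NLn by (auto simp: le_fun_def F_def)
  ultimately have "\<forall>k. graded_family I (F k) \<and> N \<le> F k \<and> F k \<le> L" "\<forall>k. F k \<le> F (Suc k)" by blast+
  with acc[unfolded family_acc_def, THEN spec, of F] have "\<exists>k. \<forall>i\<ge>k. F i = F k" by (simp only: simp_thms)
  then obtain k where k: "\<forall>i\<ge>k. F i = F k" by (rule exE)
  have "L n \<subseteq> N n" if "k < n j" for n
  proof -
    have "F (n j) n = F k n" using k[rule_format, of "n j"] that by simp
    then show ?thesis using that by (simp add: F_def)
  qed
  then show ?thesis by blast
qed

end

section \<open>The Hilbert polynomial\<close>

context graded_generators
begin

definition quotient_length :: "('d multi \<Rightarrow> 'c set) \<Rightarrow> ('d multi \<Rightarrow> 'c set) \<Rightarrow> 'd multi \<Rightarrow> int" where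
  "quotient_length N L n = int (the_enat (rel_length M \<Omega> (N n) (L n)))"

end

locale graded_generators_finite = graded_generators +
  assumes finite_components: "rel_length M \<Omega> {\<zero>} (Mg n) \<noteq> \<infinity>"
begin

lemma quotient_length:
  assumes "graded_family I N" "graded_family J L"
  shows "rel_length M \<Omega> (N n) (L n) = enat (nat (quotient_length N L n))"
proof -
  have "rel_length M \<Omega> (N n) (L n) \<le> rel_length M \<Omega> {\<zero>} (Mg n)"
    by (rule rel_length_mono)
      (use graded_familyD(2)[OF assms(2)] stable_subgroupD(2)[OF graded_familyD(1)[OF assms(1)]] in auto)
  with finite_components[of n] obtain l where "rel_length M \<Omega> (N n) (L n) = enat l"
    by (cases "rel_length M \<Omega> (N n) (L n)") auto
  then show ?thesis by (simp add: quotient_length_def zero_enat_def)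
qed

lemma quotient_length_nonneg: "0 \<le> quotient_length N L n"
  by (simp add: quotient_length_def)

lemma quotient_length_add:
  assumes "graded_family I N" "graded_family J K" "graded_family I' L" "N n \<subseteq> K n" "K n \<subseteq> L n"
  shows "quotient_length N L n = quotient_length N K n + quotient_length K L n"
proof -
  have "enat (nat (quotient_length N L n)) =
      enat (nat (quotient_length N K n)) + enat (nat (quotient_length K L n))"
    unfolding quotient_length[OF assms(1,3), symmetric] quotient_length[OF assms(1,2), symmetric]
      quotient_length[OF assms(2,3), symmetric]
    by (rule rel_length_add[OF graded_familyD(1)[OF assms(1)] graded_familyD(1)[OF assms(2)]
          graded_familyD(1)[OF assms(3)] assms(4,5) \<Omega>_closed])
  then show ?thesis
    using quotient_length_nonneg[of N L n] quotient_length_nonneg[of N K n]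
      quotient_length_nonneg[of K L n] by simp
qed

definition colon_family where
  "colon_family N i j L n = colon_in M (N (n + unit_multi j)) i (L n)"

text \<open>
  The graded submodule \<open>N + iL\<close> for a homogeneous \<open>i\<close> in direction \<open>j\<close>. Multiples of \<open>i\<close> do not occur in
  degrees with \<open>n j = 0\<close>, where \<open>n - unit_multi j\<close> would be truncated.
\<close>

definition image_family where
  "image_family N i j L n =
     (if n j = 0 then N n else plus_multiple M (N n) i (L (n - unit_multi j)))"

lemma image_family_shift:
  "image_family N i j L (n + unit_multi j) = plus_multiple M (N (n + unit_multi j)) i (L n)"
proof -
  have "(n + unit_multi j) j \<noteq> 0" by (simp add: unit_multi_def)
  moreover have "n + unit_multi j - unit_multi j = n" by (simp add: fun_eq_iff)
  ultimately show ?thesis unfolding image_family_def by (simp only: if_False)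
qed

context
  fixes I N L i j
  assumes N: "graded_family I N" and L: "graded_family I L" and NL: "\<And>n. N n \<subseteq> L n"
    and I: "I \<subseteq> T" and i: "i \<in> carrier S" and i_gr: "i \<in> Sg (unit_multi j)"
    and iL: "\<And>m n. m \<in> L n \<Longrightarrow> i \<odot> m \<in> L (n + unit_multi j)"
    and iN: "\<And>m n. m \<in> N n \<Longrightarrow> i \<odot> m \<in> N (n + unit_multi j)"
begin

lemma colon_family_graded: "graded_family I (colon_family N i j L)"
proof (rule graded_familyI)
  show "stable_subgroup M \<Omega> (colon_family N i j L n)" for n
    unfolding colon_family_def
    by (rule stable_subgroup_colon_in[OF graded_familyD(1)[OF N] graded_familyD(1)[OF L] i \<Omega>_closed])
  show "colon_family N i j L n \<subseteq> Mg n" for n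
    using graded_familyD(2)[OF L] by (auto simp: colon_family_def colon_in_def)
  fix t m n assume t: "t \<in> I" and m: "m \<in> colon_family N i j L n"
  then have mL: "m \<in> L n" "i \<odot> m \<in> N (n + unit_multi j)" by (auto simp: colon_family_def colon_in_def)
  have "i \<odot> (t \<odot> m) = t \<odot> (i \<odot> m)"
    using t I T_closed i graded_family_mem[OF L mL(1)] by (intro smult_comm) auto
  moreover have "t \<odot> (i \<odot> m) \<in> N (n + unit_multi j + unit_multi (dg t))"
    by (rule graded_familyD(3)[OF N t mL(2)])
  moreover have "n + unit_multi j + unit_multi (dg t) = n + unit_multi (dg t) + unit_multi j"
    by (simp only: add_ac)
  ultimately have "i \<odot> (t \<odot> m) \<in> N (n + unit_multi (dg t) + unit_multi j)" by (simp only:)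
  then show "t \<odot> m \<in> colon_family N i j L (n + unit_multi (dg t))"
    using graded_familyD(3)[OF L t mL(1)] by (simp only: colon_family_def colon_in_def mem_Collect_eq simp_thms)
qed

lemma image_family_graded: "graded_family I (image_family N i j L)"
proof (rule graded_familyI)
  note sN = graded_familyD(1)[OF N] and sL = graded_familyD(1)[OF L]
  have sub: "N n \<subseteq> image_family N i j L n" for n
    using subset_plus_multiple[OF sN sL i] by (simp add: image_family_def)
  show "stable_subgroup M \<Omega> (image_family N i j L n)" for n
    using stable_subgroup_plus_multiple[OF sN sL i \<Omega>_closed] sN by (simp add: image_family_def)
  show "image_family N i j L n \<subseteq> Mg n" for n
  proof (cases "n j = 0")
    case True
    then show ?thesis using graded_familyD(2)[OF N] by (simp add: image_family_def)
  next
    case False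
    then have n: "n = n - unit_multi j + unit_multi j" by (rule multi_diff_add_unit[symmetric])
    have "plus_multiple M (N n) i (L (n - unit_multi j)) \<subseteq> Mg n"
    proof (rule plus_multiple_subset[OF gr_stable graded_familyD(2)[OF N]])
      fix m assume "m \<in> L (n - unit_multi j)"
      from iL[OF this] show "i \<odot> m \<in> Mg n" using n graded_familyD(2)[OF L, of n] by auto
    qed
    then show ?thesis using False by (simp add: image_family_def)
  qed
  fix t m n assume t: "t \<in> I" and m: "m \<in> image_family N i j L n"
  let ?n' = "n + unit_multi (dg t)"
  show "t \<odot> m \<in> image_family N i j L ?n'"
  proof (cases "n j = 0")
    case True
    then have "m \<in> N n" using m by (simp add: image_family_def)
    from graded_familyD(3)[OF N t this] show ?thesis using sub by blast
  next
    case False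
    then obtain a m' where am: "a \<in> N n" "m' \<in> L (n - unit_multi j)" "m = a \<oplus> i \<odot> m'"
      using m by (auto simp: image_family_def elim: plus_multipleE)
    have tc: "t \<in> carrier S" using t I T_closed by blast
    have c: "a \<in> carrier M" "m' \<in> carrier M"
      using graded_family_mem[OF N am(1)] graded_family_mem[OF L am(2)] by auto
    have "t \<odot> m = t \<odot> a \<oplus> i \<odot> (t \<odot> m')"
      using am(3) c tc i by (simp add: smult_r_distr smult_comm[of t i])
    moreover have "t \<odot> m' \<in> L (?n' - unit_multi j)"
    proof -
      have "n - unit_multi j + unit_multi (dg t) = ?n' - unit_multi j"
        using False by (auto simp: fun_eq_iff unit_multi_def)
      then show ?thesis using graded_familyD(3)[OF L t am(2)] by (simp only:)
    qed
    moreover have "t \<odot> a \<in> N ?n'" by (rule graded_familyD(3)[OF N t am(1)])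
    moreover have "?n' j \<noteq> 0" using False by simp
    ultimately show ?thesis
      unfolding image_family_def by (simp only: if_False plus_multipleI)
  qed
qed

lemma subset_colon_family: "N n \<subseteq> colon_family N i j L n" "colon_family N i j L n \<subseteq> L n"
  using NL iN by (auto simp: colon_family_def colon_in_def)

lemma subset_image_family: "N n \<subseteq> image_family N i j L n" "image_family N i j L n \<subseteq> L n"
proof -
  show "N n \<subseteq> image_family N i j L n"
    using subset_plus_multiple[OF graded_familyD(1)[OF N] graded_familyD(1)[OF L] i]
    by (simp add: image_family_def)
  show "image_family N i j L n \<subseteq> L n"
  proof (cases "n j = 0")
    case True
    then show ?thesis using NL by (simp add: image_family_def)
  next
    case False
    then have n: "n = n - unit_multi j + unit_multi j" by (rule multi_diff_add_unit[symmetric])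
    have "plus_multiple M (N n) i (L (n - unit_multi j)) \<subseteq> L n"
    proof (rule plus_multiple_subset[OF graded_familyD(1)[OF L] NL])
      fix m assume "m \<in> L (n - unit_multi j)"
      from iL[OF this] show "i \<odot> m \<in> L n" using n by simp
    qed
    then show ?thesis using False by (simp add: image_family_def)
  qed
qed

text \<open>
  With \<open>K\<close> and \<open>C\<close> the kernel and cokernel of multiplication by \<open>i\<close> on \<open>L/N\<close>, this is the count of
  lengths in the exact sequence
  \<open>0 \<rightarrow> K\<^sub>n \<rightarrow> (L/N)\<^sub>n \<rightarrow> (L/N)\<^sub>m \<rightarrow> C\<^sub>m \<rightarrow> 0\<close> with \<open>m = n + unit_multi j\<close>.
\<close>

lemma quotient_length_difference:
  "quotient_length N L (n + unit_multi j) - quotient_length N L n =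
     quotient_length (image_family N i j L) L (n + unit_multi j) - quotient_length N (colon_family N i j L) n"
proof -
  let ?C = "image_family N i j L" and ?K = "colon_family N i j L" and ?n = "n + unit_multi j"
  have "quotient_length N L ?n = quotient_length N ?C ?n + quotient_length ?C L ?n"
    by (rule quotient_length_add[OF N image_family_graded L subset_image_family])
  moreover have "quotient_length N L n = quotient_length N ?K n + quotient_length ?K L n"
    by (rule quotient_length_add[OF N colon_family_graded L subset_colon_family])
  moreover have "quotient_length N ?C ?n = quotient_length ?K L n"
    unfolding quotient_length_def image_family_shift unfolding colon_family_def
    by (simp only: rel_length_colon_in[OF graded_familyD(1)[OF N] graded_familyD(1)[OF L] i \<Omega>_closed])
  ultimately show ?thesis by simp
qed

end

text \<open>
  Induction on the set of generators. If some direction \<open>j\<close> has no generator, the subquotient vanishes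
  far out in that direction. Otherwise each direction \<open>j\<close> has a generator \<open>i\<close>; it kills the kernel and
  the cokernel of its own action, so both are Noetherian over the remaining generators and have
  Hilbert polynomials. Hence all differences of the length function are eventually polynomial.
\<close>

theorem hilbert_polynomial:
  assumes "I \<subseteq> T" "graded_family I N" "graded_family I L" "N \<le> L" "family_acc I N L"
  shows "eventually_poly (quotient_length N L)"
proof -
  have "finite I" using assms(1) T_finite finite_subset by blast
  then show ?thesis using assms
  proof (induction I arbitrary: N L rule: finite_psubset_induct)
    case (psubset I)
    note N = psubset.prems(2) and L = psubset.prems(3) and NL = psubset.prems(4) and acc = psubset.prems(5)
    have NLn: "N n \<subseteq> L n" for n using NL by (simp add: le_fun_def)
    show ?case
    proof (cases "\<exists>j. j \<notin> dg ` I")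
      case True
      then obtain j where j: "j \<notin> dg ` I" by blast
      have "\<exists>k. \<forall>n. k < n j \<longrightarrow> L n \<subseteq> N n"
        by (rule truncation[OF acc N L NL]) (use j in blast)
      then obtain k where k: "\<forall>n. k < n j \<longrightarrow> L n \<subseteq> N n" by (rule exE)
      have zero: "quotient_length N L n = 0" if "k < n j" for n
      proof -
        have "N n = L n" using k[rule_format, of n] that NLn[of n] by blast
        then have "rel_length M \<Omega> (N n) (L n) = 0" using rel_length_self[OF graded_familyD(1)[OF L]] by simp
        then show ?thesis by (simp add: quotient_length_def zero_enat_def)
      qed
      have "for_all_large (\<lambda>n. quotient_length N L n = hsum (\<lambda>_. 0) n)"
        unfolding for_all_large_def
      proof (intro exI allI impI)
        fix n :: "'c multi" assume "\<forall>i. Suc k \<le> n i"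
        then have "k < n j" by (simp add: Suc_le_eq)
        then show "quotient_length N L n = hsum (\<lambda>_. 0) n" by (simp add: zero hsum_def)
      qed
      then show ?thesis unfolding eventually_poly_def by (intro exI[of _ "\<lambda>_. 0"] conjI) simp_all
    next
      case False
      show ?thesis
      proof (rule eventually_poly_from_differences)
        fix j
        have "j \<in> dg ` I" using False by simp
        then obtain i where i: "i \<in> I" "dg i = j" by auto
        have ic: "i \<in> carrier S" "i \<in> Sg (unit_multi j)" using i psubset.prems(1) T_closed T_gr by auto
        have iL: "i \<odot> m \<in> L (n + unit_multi j)" if "m \<in> L n" for m n
          using graded_familyD(3)[OF L i(1) that] unfolding i(2) .
        have iN: "i \<odot> m \<in> N (n + unit_multi j)" if "m \<in> N n" for m n
          using graded_familyD(3)[OF N i(1) that] unfolding i(2) .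
        note ctx = N L NLn psubset.prems(1) ic iL iN
        let ?C = "image_family N i j L" and ?K = "colon_family N i j L"
        have gC: "graded_family I ?C" by (rule image_family_graded[OF ctx])
        have gK: "graded_family I ?K" by (rule colon_family_graded[OF ctx])
        have NK: "N \<le> ?K" "?K \<le> L" using subset_colon_family[OF ctx] by (auto simp: le_fun_def)
        have CL: "N \<le> ?C" "?C \<le> L" using subset_image_family[OF ctx] by (auto simp: le_fun_def)
        have sub: "I - {i} \<subset> I" "I - {i} \<subseteq> T" using i(1) psubset.prems(1) by auto
        have accK: "family_acc (I - {i}) N ?K"
        proof (rule family_acc_sub[OF acc order_refl NK(2)])
          fix F assume F: "graded_family (I - {i}) F" "N \<le> F" "F \<le> ?K"
          show "graded_family I F"
          proof (rule graded_familyI[OF graded_familyD(1,2)[OF F(1)]])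
            fix t m n assume t: "t \<in> I" and m: "m \<in> F n"
            show "t \<odot> m \<in> F (n + unit_multi (dg t))"
            proof (cases "t = i")
              case True
              have "m \<in> ?K n" using m F(3) by (auto simp: le_fun_def)
              then have "i \<odot> m \<in> N (n + unit_multi j)" by (simp add: colon_family_def colon_in_def)
              then show ?thesis using F(2) True i(2) by (auto simp: le_fun_def)
            next
              case False
              then show ?thesis using t by (intro graded_familyD(3)[OF F(1) _ m]) simp
            qed
          qed
        qed
        have accC: "family_acc (I - {i}) ?C L"
        proof (rule family_acc_sub[OF acc CL(1) order_refl])
          fix F assume F: "graded_family (I - {i}) F" "?C \<le> F" "F \<le> L"
          show "graded_family I F"
          proof (rule graded_familyI[OF graded_familyD(1,2)[OF F(1)]])
            fix t m n assume t: "t \<in> I" and m: "m \<in> F n"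
            show "t \<odot> m \<in> F (n + unit_multi (dg t))"
            proof (cases "t = i")
              case True
              have mL: "m \<in> L n" using m F(3) by (auto simp: le_fun_def)
              have "i \<odot> m \<in> ?C (n + unit_multi j)"
                unfolding image_family_shift
                by (rule smult_mem_plus_multiple[OF graded_familyD(1)[OF N] graded_familyD(1)[OF L] ic(1) mL])
              then show ?thesis using F(2) True i(2) by (auto simp: le_fun_def)
            next
              case False
              then show ?thesis using t by (intro graded_familyD(3)[OF F(1) _ m]) simp
            qed
          qed
        qed
        have pK: "eventually_poly (quotient_length N ?K)"
          by (rule psubset.IH[OF sub graded_family_subset[OF N Diff_subset]
                graded_family_subset[OF gK Diff_subset] NK(1) accK])
        have pC: "eventually_poly (quotient_length ?C L)"
          by (rule psubset.IH[OF sub graded_family_subset[OF gC Diff_subset]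
                graded_family_subset[OF L Diff_subset] CL(2) accC])
        from pC pK obtain e where e: "finite {k. e k \<noteq> 0}"
          "for_all_large (\<lambda>n. quotient_length ?C L (n + unit_multi j) - quotient_length N ?K n =
              hsum e (n + unit_multi j))"
          by (rule eventually_poly_diff_shift)
        show "\<exists>c. finite {k. c k \<noteq> 0} \<and> for_all_large (\<lambda>n. quotient_length N L (n + unit_multi j) -
            quotient_length N L n = hsum c (n + unit_multi j))"
        proof (intro exI conjI)
          show "finite {k. e k \<noteq> 0}" by (rule e(1))
          show "for_all_large (\<lambda>n. quotient_length N L (n + unit_multi j) -
              quotient_length N L n = hsum e (n + unit_multi j))"
            by (rule for_all_large_mono[OF e(2)]) (rule trans[OF quotient_length_difference[OF ctx]])
        qed
      qed
    qed
  qed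
qed

end

section \<open>Graded modules over an Artinian local base\<close>

definition base_scalars :: "('a, 'w) ring_scheme \<Rightarrow> ('a, 's, 'x) module_scheme \<Rightarrow> 's set" where
  "base_scalars A S = (\<lambda>a. a \<odot>\<^bsub>S\<^esub> \<one>\<^bsub>S\<^esub>) ` carrier A"

lemma (in module) submodule_iff_stable: "submodule N R M \<longleftrightarrow> stable_subgroup M (carrier R) N"
proof
  assume N: "submodule N R M"
  show "stable_subgroup M (carrier R) N"
  proof (rule stable_subgroupI)
    show "\<zero>\<^bsub>M\<^esub> \<in> N" using subgroup.one_closed[OF submodule.axioms(1)[OF N]] by simp
  qed (use submoduleE[OF N] in auto)
next
  assume "stable_subgroup M (carrier R) N"
  then show "submodule N R M" using stable_subgroupD by (intro submoduleI) auto
qed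

lemma (in module) stable_gen_submodule:
  assumes "B \<subseteq> carrier M"
  shows "stable_subgroup M (carrier R) (gen_submodule R M B)" "B \<subseteq> gen_submodule R M B"
proof -
  have "carrier M \<in> {N. submodule N R M \<and> B \<subseteq> N}" using assms carrier_is_submodule by blast
  then show "stable_subgroup M (carrier R) (gen_submodule R M B)"
    unfolding gen_submodule_def by (intro stable_subgroup_Inter) (auto simp: submodule_iff_stable)
  show "B \<subseteq> gen_submodule R M B" unfolding gen_submodule_def by blast
qed

lemma gen_submodule_least: "submodule N R M \<Longrightarrow> B \<subseteq> N \<Longrightarrow> gen_submodule R M B \<subseteq> N"
  unfolding gen_submodule_def by blast

lemma (in ring) generate_ring_finite_subset:
  assumes "y \<in> generate_ring R (B \<union> C)" "B \<subseteq> carrier R" "C \<subseteq> carrier R"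
  shows "\<exists>F. finite F \<and> F \<subseteq> B \<and> y \<in> generate_ring R (F \<union> C)"
proof -
  have mono: "generate_ring R (F \<union> C) \<subseteq> generate_ring R (F' \<union> C)" if "F \<subseteq> F'" "F' \<subseteq> B" for F F'
    by (rule mono_generate_ring) (use that assms(2,3) in auto)
  have union: "\<exists>F. finite F \<and> F \<subseteq> B \<and> y \<in> generate_ring R (F \<union> C) \<and> z \<in> generate_ring R (F \<union> C)"
    if "finite F1 \<and> F1 \<subseteq> B \<and> y \<in> generate_ring R (F1 \<union> C)"
      "finite F2 \<and> F2 \<subseteq> B \<and> z \<in> generate_ring R (F2 \<union> C)" for F1 F2 y z
  proof (intro exI conjI)
    note f1 = that(1)[THEN conjunct1] that(1)[THEN conjunct2, THEN conjunct1]
      that(1)[THEN conjunct2, THEN conjunct2]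
    note f2 = that(2)[THEN conjunct1] that(2)[THEN conjunct2, THEN conjunct1]
      that(2)[THEN conjunct2, THEN conjunct2]
    show sub: "F1 \<union> F2 \<subseteq> B" using f1(2) f2(2) by (rule Un_least)
    show "finite (F1 \<union> F2)" using f1(1) f2(1) by (rule finite_UnI)
    show "y \<in> generate_ring R (F1 \<union> F2 \<union> C)"
      by (rule subsetD[OF mono[OF Un_upper1 sub] f1(3)])
    show "z \<in> generate_ring R (F1 \<union> F2 \<union> C)"
      by (rule subsetD[OF mono[OF Un_upper2 sub] f2(3)])
  qed
  show ?thesis
    using assms(1)
  proof (induction y rule: generate_ring.induct)
    case one
    show ?case by (intro exI[of _ "{}"] conjI generate_ring.one) auto
  next
    case (incl h)
    then show ?case
    proof
      assume "h \<in> B"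
      then show ?thesis by (intro exI[of _ "{h}"] conjI generate_ring.incl) auto
    next
      assume "h \<in> C"
      then show ?thesis by (intro exI[of _ "{}"] conjI generate_ring.incl) auto
    qed
  next
    case (a_inv h)
    from a_inv.IH obtain F where "finite F \<and> F \<subseteq> B \<and> h \<in> generate_ring R (F \<union> C)" by (rule exE)
    then show ?case by (intro exI[of _ F] conjI generate_ring.a_inv) simp_all
  next
    case (eng_add h1 h2)
    obtain F1 where 1: "finite F1 \<and> F1 \<subseteq> B \<and> h1 \<in> generate_ring R (F1 \<union> C)"
      using eng_add.IH(1) by (rule exE)
    obtain F2 where 2: "finite F2 \<and> F2 \<subseteq> B \<and> h2 \<in> generate_ring R (F2 \<union> C)"
      using eng_add.IH(2) by (rule exE)
    obtain F where "finite F \<and> F \<subseteq> B \<and> h1 \<in> generate_ring R (F \<union> C) \<and> h2 \<in> generate_ring R (F \<union> C)"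
      using union[OF 1 2] by (rule exE)
    then show ?case by (intro exI[of _ F] conjI generate_ring.eng_add) simp_all
  next
    case (eng_mult h1 h2)
    obtain F1 where 1: "finite F1 \<and> F1 \<subseteq> B \<and> h1 \<in> generate_ring R (F1 \<union> C)"
      using eng_mult.IH(1) by (rule exE)
    obtain F2 where 2: "finite F2 \<and> F2 \<subseteq> B \<and> h2 \<in> generate_ring R (F2 \<union> C)"
      using eng_mult.IH(2) by (rule exE)
    obtain F where "finite F \<and> F \<subseteq> B \<and> h1 \<in> generate_ring R (F \<union> C) \<and> h2 \<in> generate_ring R (F \<union> C)"
      using union[OF 1 2] by (rule exE)
    then show ?case by (intro exI[of _ F] conjI generate_ring.eng_mult) simp_all
  qed
qed

lemma (in module) stable_subgroup_generate_ring:
  assumes N: "stable_subgroup M B N" and B: "B \<subseteq> carrier R"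
  shows "stable_subgroup M (generate_ring R B) N"
proof (rule stable_subgroupI)
  note D = stable_subgroupD[OF N]
  show "s \<odot>\<^bsub>M\<^esub> x \<in> N" if "s \<in> generate_ring R B" "x \<in> N" for s x
    using that
  proof (induction s arbitrary: x rule: generate_ring.induct)
    case one
    then show ?case using D(1) by auto
  next
    case (incl h)
    then show ?case using D(6) by blast
  next
    case (a_inv h)
    then show ?case
      using D(1,4) R.generate_ring_in_carrier[OF B a_inv.hyps] by (auto simp: smult_l_minus)
  next
    case (eng_add h1 h2)
    then show ?case
      using D(1,3) R.generate_ring_in_carrier[OF B eng_add.hyps(1)] R.generate_ring_in_carrier[OF B eng_add.hyps(2)]
      by (auto simp: smult_l_distr)
  next
    case (eng_mult h1 h2)
    then have "h1 \<odot>\<^bsub>M\<^esub> (h2 \<odot>\<^bsub>M\<^esub> x) \<in> N" by blast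
    moreover have "x \<in> carrier M" using D(1) eng_mult.prems by blast
    ultimately show ?case
      using R.generate_ring_in_carrier[OF B eng_mult.hyps(1)] R.generate_ring_in_carrier[OF B eng_mult.hyps(2)]
      by (simp add: smult_assoc1)
  qed
qed (use stable_subgroupD[OF N] in auto)

locale graded_setting =
  fixes A :: "('a, 'w) ring_scheme" and \<mm> :: "'a set" and S :: "('a, 's, 'x) module_scheme"
    and Sg :: "'d::finite multi \<Rightarrow> 's set" and M :: "('s, 'm, 'y) module_scheme"
    and Mg :: "'d multi \<Rightarrow> 'm set"
  assumes artinian: "artinian_local_ring A \<mm>"
    and standard_algebra: "standard_multigraded_algebra A S Sg"
    and graded_module: "multigraded_module S Sg M Mg"
    and fin_gen: "finitely_generated_module S M"
begin

sublocale Alg: standard_multigraded_algebra A S Sg by (rule standard_algebra)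
sublocale Md: multigraded_module S Sg M Mg by (rule graded_module)

abbreviation "\<Omega> \<equiv> base_scalars A S"

lemma S_ring: "ring S"
  using Md.module_axioms unfolding module_def cring_def by blast

lemma scalars_closed: "\<Omega> \<subseteq> carrier S"
  by (auto simp: base_scalars_def)

lemma scalars_gr: "\<Omega> \<subseteq> Sg 0"
  using submodule.smult_closed[OF Alg.gr_submodule[of 0] _ Alg.one_gr] by (auto simp: base_scalars_def)

lemma smult_gr_scalars: "s \<in> \<Omega> \<Longrightarrow> m \<in> Mg n \<Longrightarrow> s \<odot>\<^bsub>M\<^esub> m \<in> Mg n"
  using Md.smult_gr[of s 0 m n] scalars_gr by auto

lemma Mg_stable: "stable_subgroup M \<Omega> (Mg n)"
  by (rule Md.stable_subgroupI) (auto simp: smult_gr_scalars)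

lemma Sg_closed: "s \<in> Sg n \<Longrightarrow> s \<in> carrier S"
  by (rule Alg.grading.gr_closed)

text \<open>\<open>M\<close> with its scalars restricted to \<open>A\<close>, as the component of a constant family.\<close>

definition MA :: "('a, 'm) module" where
  "MA = component_module S M (\<lambda>_::'d multi. carrier M) 0"

lemma MA_module: "module A MA"
proof (rule moduleI)
  show "cring A" by (rule Alg.R_cring)
  show "abelian_group MA"
    using Md.abelian_group_axioms Md.abelian_monoid_axioms
    unfolding MA_def component_module_def
    by (intro abelian_groupI) (auto simp: Md.a_assoc Md.a_comm Md.a_lcomm intro: Md.l_neg)
  show "a \<odot>\<^bsub>MA\<^esub> x \<in> carrier MA" if "a \<in> carrier A" "x \<in> carrier MA" for a x
    using that by (simp add: MA_def component_module_def)
  show "(a \<oplus>\<^bsub>A\<^esub> b) \<odot>\<^bsub>MA\<^esub> x = (a \<odot>\<^bsub>MA\<^esub> x) \<oplus>\<^bsub>MA\<^esub> (b \<odot>\<^bsub>MA\<^esub> x)"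
    if "a \<in> carrier A" "b \<in> carrier A" "x \<in> carrier MA" for a b x
    using that by (simp add: MA_def component_module_def Alg.smult_l_distr Md.smult_l_distr)
  show "a \<odot>\<^bsub>MA\<^esub> (x \<oplus>\<^bsub>MA\<^esub> y) = (a \<odot>\<^bsub>MA\<^esub> x) \<oplus>\<^bsub>MA\<^esub> (a \<odot>\<^bsub>MA\<^esub> y)"
    if "a \<in> carrier A" "x \<in> carrier MA" "y \<in> carrier MA" for a x y
    using that by (simp add: MA_def component_module_def Md.smult_r_distr)
  show "(a \<otimes>\<^bsub>A\<^esub> b) \<odot>\<^bsub>MA\<^esub> x = a \<odot>\<^bsub>MA\<^esub> (b \<odot>\<^bsub>MA\<^esub> x)"
    if "a \<in> carrier A" "b \<in> carrier A" "x \<in> carrier MA" for a b x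
  proof -
    have "(a \<otimes>\<^bsub>A\<^esub> b) \<odot>\<^bsub>S\<^esub> \<one>\<^bsub>S\<^esub> = (a \<odot>\<^bsub>S\<^esub> \<one>\<^bsub>S\<^esub>) \<otimes>\<^bsub>S\<^esub> (b \<odot>\<^bsub>S\<^esub> \<one>\<^bsub>S\<^esub>)"
      using that by (simp add: Alg.smult_assoc1 Alg.smult_assoc2)
    then show ?thesis
      using that by (simp add: MA_def component_module_def Md.smult_assoc1)
  qed
  show "\<one>\<^bsub>A\<^esub> \<odot>\<^bsub>MA\<^esub> x = x" if "x \<in> carrier MA" for x
    using that by (simp add: MA_def component_module_def)
qed

lemma MA_over_artinian: "module_over_artinian A \<mm> MA"
  using artinian MA_module by (simp add: module_over_artinian_def)

lemma MA_stable: "stable_subgroup MA (carrier A) N \<longleftrightarrow> stable_subgroup M \<Omega> N"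
proof -
  have "additive_subgroup N MA \<longleftrightarrow> additive_subgroup N M"
    unfolding additive_subgroup_def subgroup_def m_inv_def
    by (simp add: MA_def component_module_def)
  then show ?thesis
    unfolding stable_subgroup_def by (simp add: MA_def component_module_def base_scalars_def)
qed

lemma MA_interval: "stable_interval MA (carrier A) N L = stable_interval M \<Omega> N L"
  by (simp add: stable_interval_def MA_stable)

lemma MA_length: "rel_length MA (carrier A) N L = rel_length M \<Omega> N L"
  by (simp add: rel_length_def MA_interval)

lemma MA_acc: "stable_acc MA (carrier A) N L = stable_acc M \<Omega> N L"
  by (simp add: stable_acc_def MA_interval)

lemma MA_zero: "\<zero>\<^bsub>MA\<^esub> = \<zero>\<^bsub>M\<^esub>" "carrier MA = carrier M"
  by (simp_all add: MA_def component_module_def)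

text \<open>
  Each of the finitely many algebra generators involves only finitely many elements of total degree
  one.
\<close>

lemma finite_degree_one_generators:
  obtains T where "finite T" "T \<subseteq> (\<Union>j. Sg (unit_multi j))" "generate_ring S (T \<union> \<Omega>) = carrier S"
proof -
  let ?B = "\<Union>j. Sg (unit_multi j)"
  have B: "?B \<subseteq> carrier S" using Sg_closed by blast
  obtain T0 where T0: "finite T0" "T0 \<subseteq> carrier S" "generate_ring S (T0 \<union> \<Omega>) = carrier S"
    using Alg.finitely_generated unfolding generates_algebra_def base_scalars_def by blast
  have std: "generate_ring S (?B \<union> \<Omega>) = carrier S"
    using Alg.standard unfolding generates_algebra_def base_scalars_def by blast
  have "\<exists>F. finite F \<and> F \<subseteq> ?B \<and> t \<in> generate_ring S (F \<union> \<Omega>)" if "t \<in> T0" for t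
    by (rule ring.generate_ring_finite_subset[OF S_ring, OF _ B scalars_closed]) (use that T0(2) std in auto)
  then have "\<forall>t\<in>T0. \<exists>F. finite F \<and> F \<subseteq> ?B \<and> t \<in> generate_ring S (F \<union> \<Omega>)" by blast
  from bchoice[OF this] obtain F where
    F: "\<forall>t\<in>T0. finite (F t) \<and> F t \<subseteq> ?B \<and> t \<in> generate_ring S (F t \<union> \<Omega>)" by (rule exE)
  let ?T = "\<Union>t\<in>T0. F t"
  have T: "finite ?T" "?T \<subseteq> ?B" using T0(1) F by auto
  have c: "?T \<union> \<Omega> \<subseteq> carrier S" using T(2) B scalars_closed by blast
  have "t \<in> generate_ring S (?T \<union> \<Omega>)" if "t \<in> T0" for t
    using F[rule_format, OF that] ring.mono_generate_ring[OF S_ring, OF _ c, of "F t \<union> \<Omega>"] that by blast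
  then have "T0 \<union> \<Omega> \<subseteq> generate_ring S (?T \<union> \<Omega>)" by (auto intro: generate_ring.incl)
  then have "generate_ring S (T0 \<union> \<Omega>) \<subseteq> generate_ring S (?T \<union> \<Omega>)"
    by (intro ring.generate_ring_min_subring1[OF S_ring] ring.generate_ring_is_subring[OF S_ring, OF c])
      (use T0(2) scalars_closed in auto)
  then have "generate_ring S (?T \<union> \<Omega>) = carrier S"
    using T0(3) ring.generate_ring_incl[OF S_ring, OF c] by blast
  with T show thesis by (rule that)
qed

text \<open>
  A finite set generating \<open>M\<close> is contained in an \<open>A\<close>-submodule of finite length. Hilbert's basis theorem
  enlarges the latter to a submodule that is Noetherian over \<open>A[T] = S\<close>, and this can only be \<open>M\<close>. The
  components inherit the ascending chain condition as \<open>A\<close>-modules, so they have finite length.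
\<close>

lemma graded_generators_exist:
  obtains T dg where "graded_generators_finite S Sg M Mg \<Omega> T dg" "generate_ring S (T \<union> \<Omega>) = carrier S"
proof -
  obtain T where T: "finite T" "T \<subseteq> (\<Union>j. Sg (unit_multi j))" and gen: "generate_ring S (T \<union> \<Omega>) = carrier S"
    by (rule finite_degree_one_generators)
  have Tc: "T \<subseteq> carrier S" using T(2) Sg_closed by blast
  have "\<forall>t\<in>T. \<exists>j. t \<in> Sg (unit_multi j)" using T(2) by blast
  from bchoice[OF this] obtain dg where dg: "\<forall>t\<in>T. t \<in> Sg (unit_multi (dg t))" by (rule exE)
  interpret MA: module_over_artinian A \<mm> MA by (rule MA_over_artinian)
  obtain Y where Y: "finite Y" "Y \<subseteq> carrier M" "gen_submodule S M Y = carrier M"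
    using fin_gen unfolding finitely_generated_module_def by blast
  obtain W where W: "stable_subgroup MA (carrier A) W" "Y \<subseteq> W" "rel_length MA (carrier A) {\<zero>\<^bsub>MA\<^esub>} W \<noteq> \<infinity>"
    by (rule MA.finite_length_cover[of Y]) (use Y(1,2) MA_zero in auto)
  have W': "stable_subgroup M \<Omega> W" "rel_length M \<Omega> {\<zero>\<^bsub>M\<^esub>} W \<noteq> \<infinity>"
    using W(1,3) unfolding MA_stable MA_length MA_zero by auto
  have acc: "stable_acc M \<Omega> {\<zero>\<^bsub>M\<^esub>} W"
    by (rule Md.finite_length_acc[OF Md.stable_subgroup_zero[OF scalars_closed] W'(2) scalars_closed])
  obtain W2 where W2: "stable_subgroup M (\<Omega> \<union> T) W2" "W \<subseteq> W2" "stable_acc M (\<Omega> \<union> T) {\<zero>\<^bsub>M\<^esub>} W2"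
    using Md.hilbert_basis[OF T(1) Tc scalars_closed W'(1) acc] by blast
  have "stable_subgroup M (carrier S) W2"
    using Md.stable_subgroup_generate_ring[OF W2(1)] scalars_closed Tc gen by (simp add: Un_commute)
  then have "submodule W2 S M" by (simp add: Md.submodule_iff_stable)
  then have "carrier M \<subseteq> W2" using gen_submodule_least[of W2 S M Y] Y(3) W(2) W2(2) by blast
  then have "W2 = carrier M" using Md.stable_subgroupD(1)[OF W2(1)] by blast
  then have noeth: "stable_acc M (\<Omega> \<union> T) {\<zero>\<^bsub>M\<^esub>} (carrier M)" using W2(3) by simp
  interpret gg: graded_generators S Sg M Mg \<Omega> T dg
    by unfold_locales (use scalars_gr scalars_closed T(1) Tc dg Mg_stable noeth in auto)
  have "graded_generators_finite S Sg M Mg \<Omega> T dg"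
  proof
    fix n
    have "rel_length MA (carrier A) {\<zero>\<^bsub>MA\<^esub>} (Mg n) \<noteq> \<infinity>"
      by (rule MA.acc_finite_length) (use gg.component_acc Mg_stable in \<open>simp_all add: MA_stable MA_acc MA_zero\<close>)
    then show "rel_length M \<Omega> {\<zero>\<^bsub>M\<^esub>} (Mg n) \<noteq> \<infinity>" unfolding MA_length MA_zero .
  qed
  then show thesis using gen by (rule that)
qed

end

section \<open>Quotient modules and localization\<close>

context module
begin

context
  fixes Q assumes Q: "submodule Q R M"
begin

abbreviation (input) quot where "quot \<equiv> quot_module M Q"
abbreviation (input) coset where "coset m \<equiv> Q +>\<^bsub>M\<^esub> m"

lemma Q_stable: "stable_subgroup M (carrier R) Q"
  using Q by (simp add: submodule_iff_stable)

lemma Q_subgroup: "subgroup Q (add_monoid M)"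
  by (rule submodule.axioms(1)[OF Q])

lemma Q_sub: "Q \<subseteq> carrier M"
  by (rule stable_subgroupD(1)[OF Q_stable])

lemma Q_abelian_subgroup: "abelian_subgroup Q M"
  by (rule abelian_subgroupI3[OF additive_subgroupI[OF Q_subgroup] M.abelian_group_axioms])

lemma coset_eq_iff:
  assumes "x \<in> carrier M" "y \<in> carrier M"
  shows "coset x = coset y \<longleftrightarrow> x \<ominus>\<^bsub>M\<^esub> y \<in> Q"
proof
  assume "coset x = coset y"
  from M.a_coset_add_inv2[OF this assms Q_sub] have "coset (x \<oplus>\<^bsub>M\<^esub> \<ominus>\<^bsub>M\<^esub> y) = Q" .
  from M.a_coset_join1[OF this _ Q_subgroup] show "x \<ominus>\<^bsub>M\<^esub> y \<in> Q" using assms by (simp add: a_minus_def)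
next
  assume "x \<ominus>\<^bsub>M\<^esub> y \<in> Q"
  then have "coset (x \<oplus>\<^bsub>M\<^esub> \<ominus>\<^bsub>M\<^esub> y) = Q"
    using M.a_coset_join2[OF _ Q_subgroup] assms by (simp add: a_minus_def)
  from M.a_coset_add_inv1[OF this assms Q_sub] show "coset x = coset y" .
qed

lemma coset_eq_Q_iff:
  assumes "x \<in> carrier M"
  shows "coset x = Q \<longleftrightarrow> x \<in> Q"
  using M.a_coset_join1[OF _ assms Q_subgroup] M.a_coset_join2[OF assms Q_subgroup] by blast

lemma quot_carrier: "carrier quot = coset ` carrier M"
  by (auto simp: quot_module_def A_RCOSETS_def')

lemma quot_zero: "\<zero>\<^bsub>quot\<^esub> = Q"
  by (simp add: quot_module_def)

lemma quot_add:
  "x \<in> carrier M \<Longrightarrow> y \<in> carrier M \<Longrightarrow> coset x \<oplus>\<^bsub>quot\<^esub> coset y = coset (x \<oplus>\<^bsub>M\<^esub> y)"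
  using abelian_subgroup.a_rcos_sum[OF Q_abelian_subgroup] by (simp add: quot_module_def)

lemma quot_smult:
  assumes s: "s \<in> carrier R" and x: "x \<in> carrier M"
  shows "s \<odot>\<^bsub>quot\<^esub> coset x = coset (s \<odot>\<^bsub>M\<^esub> x)"
proof -
  have "coset (s \<odot>\<^bsub>M\<^esub> y) = coset (s \<odot>\<^bsub>M\<^esub> x)" if y: "y \<in> coset x" for y
  proof -
    obtain q where q: "q \<in> Q" "y = q \<oplus>\<^bsub>M\<^esub> x" using y by (auto simp: a_r_coset_def')
    have qc: "q \<in> carrier M" using q(1) Q_sub by blast
    have "s \<odot>\<^bsub>M\<^esub> y \<ominus>\<^bsub>M\<^esub> s \<odot>\<^bsub>M\<^esub> x = s \<odot>\<^bsub>M\<^esub> q"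
      using q(2) qc s x by (simp add: smult_r_distr a_minus_def M.a_assoc M.r_neg)
    then have "s \<odot>\<^bsub>M\<^esub> y \<ominus>\<^bsub>M\<^esub> s \<odot>\<^bsub>M\<^esub> x \<in> Q"
      using stable_subgroupD(6)[OF Q_stable s q(1)] by simp
    then show ?thesis using coset_eq_iff s x qc q(2) by simp
  qed
  moreover have "x \<in> coset x" by (rule abelian_subgroup.a_rcos_self[OF Q_abelian_subgroup x])
  ultimately have "(\<Union>y\<in>coset x. coset (s \<odot>\<^bsub>M\<^esub> y)) = coset (s \<odot>\<^bsub>M\<^esub> x)" by blast
  then show ?thesis by (simp add: quot_module_def)
qed

lemma quot_module_module: "module R quot"
proof (rule moduleI)
  show "cring R" by (rule R.is_cring)
  show "abelian_group quot"
  proof (rule abelian_groupI)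
    show "\<zero>\<^bsub>quot\<^esub> \<in> carrier quot"
      using coset_eq_Q_iff[OF M.zero_closed] stable_subgroupD(2)[OF Q_stable]
      unfolding quot_zero quot_carrier by (intro image_eqI[of _ _ "\<zero>\<^bsub>M\<^esub>"]) auto
    show "x \<oplus>\<^bsub>quot\<^esub> y \<in> carrier quot" if "x \<in> carrier quot" "y \<in> carrier quot" for x y
      using that by (auto simp: quot_carrier quot_add)
    show "x \<oplus>\<^bsub>quot\<^esub> y \<oplus>\<^bsub>quot\<^esub> z = x \<oplus>\<^bsub>quot\<^esub> (y \<oplus>\<^bsub>quot\<^esub> z)"
      if "x \<in> carrier quot" "y \<in> carrier quot" "z \<in> carrier quot" for x y z
      using that by (auto simp: quot_carrier quot_add M.a_assoc)
    show "x \<oplus>\<^bsub>quot\<^esub> y = y \<oplus>\<^bsub>quot\<^esub> x" if "x \<in> carrier quot" "y \<in> carrier quot" for x y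
      using that by (auto simp: quot_carrier quot_add M.a_comm)
    have zero: "\<zero>\<^bsub>quot\<^esub> = coset \<zero>\<^bsub>M\<^esub>"
      using coset_eq_Q_iff[OF M.zero_closed] stable_subgroupD(2)[OF Q_stable] by (simp add: quot_zero)
    show "\<zero>\<^bsub>quot\<^esub> \<oplus>\<^bsub>quot\<^esub> x = x" if "x \<in> carrier quot" for x
      using that unfolding zero by (auto simp: quot_carrier quot_add)
    show "\<exists>y\<in>carrier quot. y \<oplus>\<^bsub>quot\<^esub> x = \<zero>\<^bsub>quot\<^esub>" if x: "x \<in> carrier quot" for x
    proof -
      obtain m where m: "m \<in> carrier M" "x = coset m" using x by (auto simp: quot_carrier)
      then have "coset (\<ominus>\<^bsub>M\<^esub> m) \<oplus>\<^bsub>quot\<^esub> x = \<zero>\<^bsub>quot\<^esub>" by (simp add: quot_add zero M.l_neg)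
      moreover have "coset (\<ominus>\<^bsub>M\<^esub> m) \<in> carrier quot" using m by (simp add: quot_carrier)
      ultimately show ?thesis by blast
    qed
  qed
qed (auto simp: quot_carrier quot_smult quot_add smult_l_distr smult_r_distr smult_assoc1)

lemma quot_minus:
  assumes "x \<in> carrier M"
  shows "\<ominus>\<^bsub>quot\<^esub> coset x = coset (\<ominus>\<^bsub>M\<^esub> x)"
proof -
  interpret q: module R quot by (rule quot_module_module)
  have "coset (\<ominus>\<^bsub>M\<^esub> x) \<oplus>\<^bsub>quot\<^esub> coset x = \<zero>\<^bsub>quot\<^esub>"
    using assms coset_eq_Q_iff[OF M.zero_closed] stable_subgroupD(2)[OF Q_stable]
    by (simp add: quot_add M.l_neg quot_zero)
  then show ?thesis using assms by (intro q.M.minus_equality) (auto simp: quot_carrier)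
qed

lemma stable_subgroup_image:
  assumes L: "stable_subgroup M \<Omega> L" and \<Omega>: "\<Omega> \<subseteq> carrier R"
  shows "stable_subgroup quot \<Omega> (coset ` L)"
proof -
  interpret q: module R quot by (rule quot_module_module)
  note D = stable_subgroupD[OF L] and mem = stable_subgroup_mem[OF L]
  show ?thesis
  proof (rule q.stable_subgroupI)
    show "coset ` L \<subseteq> carrier quot" using mem by (auto simp: quot_carrier)
    show "\<zero>\<^bsub>quot\<^esub> \<in> coset ` L"
      using coset_eq_Q_iff[OF M.zero_closed] stable_subgroupD(2)[OF Q_stable] D(2)
      unfolding quot_zero by (intro image_eqI[of _ _ "\<zero>\<^bsub>M\<^esub>"]) auto
    fix x assume "x \<in> coset ` L"
    then obtain m where m: "m \<in> L" "x = coset m" by blast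
    show "\<ominus>\<^bsub>quot\<^esub> x \<in> coset ` L" using m D(4) mem quot_minus by auto
    show "s \<odot>\<^bsub>quot\<^esub> x \<in> coset ` L" if "s \<in> \<Omega>" for s
      using m D(6)[OF that] mem that \<Omega> quot_smult by auto
    fix y assume "y \<in> coset ` L"
    then obtain m' where m': "m' \<in> L" "y = coset m'" by blast
    show "x \<oplus>\<^bsub>quot\<^esub> y \<in> coset ` L" using m m' D(3) mem by (auto simp: quot_add)
  qed
qed

lemma stable_subgroup_preimage:
  assumes L: "stable_subgroup M \<Omega> L" and V: "stable_subgroup quot \<Omega> V" and \<Omega>: "\<Omega> \<subseteq> carrier R"
  shows "stable_subgroup M \<Omega> {m \<in> L. coset m \<in> V}"
proof -
  interpret q: module R quot by (rule quot_module_module)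
  note D = stable_subgroupD[OF L] and mem = stable_subgroup_mem[OF L] and E = q.stable_subgroupD[OF V]
  show ?thesis
  proof (rule stable_subgroupI)
    show "{m \<in> L. coset m \<in> V} \<subseteq> carrier M" using mem by auto
    show "\<zero>\<^bsub>M\<^esub> \<in> {m \<in> L. coset m \<in> V}"
      using D(2) E(2) coset_eq_Q_iff[OF M.zero_closed] stable_subgroupD(2)[OF Q_stable] quot_zero by simp
    fix x assume x: "x \<in> {m \<in> L. coset m \<in> V}"
    then have xc: "x \<in> carrier M" using mem by simp
    show "\<ominus>\<^bsub>M\<^esub> x \<in> {m \<in> L. coset m \<in> V}" using x D(4) E(4) quot_minus[OF xc] by force
    show "s \<odot>\<^bsub>M\<^esub> x \<in> {m \<in> L. coset m \<in> V}" if "s \<in> \<Omega>" for s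
      using x D(6)[OF that] E(6)[OF that] quot_smult[OF _ xc, of s] that \<Omega> by force
    fix y assume y: "y \<in> {m \<in> L. coset m \<in> V}"
    then have yc: "y \<in> carrier M" using mem by simp
    show "x \<oplus>\<^bsub>M\<^esub> y \<in> {m \<in> L. coset m \<in> V}" using x y D(3) E(3) quot_add[OF xc yc] by force
  qed
qed

text \<open>
  Submodules of \<open>(L + Q)/Q\<close> correspond to submodules of \<open>L\<close> containing \<open>Q \<inter> L\<close>. For \<open>L = M\<^sub>n\<close> this
  turns the length of a component of \<open>M/Q\<close> into a length inside \<open>M\<close>.
\<close>

lemma rel_length_quot:
  assumes L: "stable_subgroup M \<Omega> L" and \<Omega>: "\<Omega> \<subseteq> carrier R"
  shows "rel_length quot \<Omega> {\<zero>\<^bsub>quot\<^esub>} (coset ` L) = rel_length M \<Omega> (Q \<inter> L) L"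
proof (rule antisym)
  interpret q: module R quot by (rule quot_module_module)
  note mem = stable_subgroup_mem[OF L]
  show "rel_length quot \<Omega> {\<zero>\<^bsub>quot\<^esub>} (coset ` L) \<le> rel_length M \<Omega> (Q \<inter> L) L"
  proof (rule rel_length_mono_map[where f = "\<lambda>V. {m \<in> L. coset m \<in> V}"])
    fix V assume V: "V \<in> stable_interval quot \<Omega> {\<zero>\<^bsub>quot\<^esub>} (coset ` L)"
    have "Q \<inter> L \<subseteq> {m \<in> L. coset m \<in> V}"
    proof
      fix m assume m: "m \<in> Q \<inter> L"
      then have "coset m = Q" using coset_eq_Q_iff mem by blast
      then show "m \<in> {m \<in> L. coset m \<in> V}" using m V by (auto simp: stable_interval_def quot_zero)
    qed
    then show "{m \<in> L. coset m \<in> V} \<in> stable_interval M \<Omega> (Q \<inter> L) L"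
      using V stable_subgroup_preimage[OF L _ \<Omega>] by (auto simp: stable_interval_def)
    fix W assume W: "W \<in> stable_interval quot \<Omega> {\<zero>\<^bsub>quot\<^esub>} (coset ` L)" and VW: "V \<subset> W"
    obtain w where w: "w \<in> W" "w \<notin> V" using VW by blast
    then obtain m where "m \<in> L" "w = coset m" using W by (auto simp: stable_interval_def)
    then show "{m \<in> L. coset m \<in> V} \<subset> {m \<in> L. coset m \<in> W}" using w VW by blast
  qed
  show "rel_length M \<Omega> (Q \<inter> L) L \<le> rel_length quot \<Omega> {\<zero>\<^bsub>quot\<^esub>} (coset ` L)"
  proof (rule rel_length_mono_map[where f = "\<lambda>V. coset ` V"])
    fix V assume V: "V \<in> stable_interval M \<Omega> (Q \<inter> L) L"
    then have sV: "stable_subgroup M \<Omega> V" "Q \<inter> L \<subseteq> V" "V \<subseteq> L" by (auto simp: stable_interval_def)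
    show "coset ` V \<in> stable_interval quot \<Omega> {\<zero>\<^bsub>quot\<^esub>} (coset ` L)"
      using stable_subgroup_image[OF sV(1) \<Omega>] q.stable_subgroupD(2)[OF stable_subgroup_image[OF sV(1) \<Omega>]] sV(3)
      by (auto simp: stable_interval_def)
    fix W assume W: "W \<in> stable_interval M \<Omega> (Q \<inter> L) L" and VW: "V \<subset> W"
    then have sW: "stable_subgroup M \<Omega> W" "W \<subseteq> L" by (auto simp: stable_interval_def)
    obtain w where w: "w \<in> W" "w \<notin> V" using VW by blast
    have "coset w \<notin> coset ` V"
    proof
      assume "coset w \<in> coset ` V"
      then obtain v where v: "v \<in> V" "coset w = coset v" by blast
      have c: "w \<in> carrier M" "v \<in> carrier M" using w v VW sW mem by auto
      have "w \<ominus>\<^bsub>M\<^esub> v \<in> Q" using coset_eq_iff[OF c] v(2) by simp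
      moreover have "w \<ominus>\<^bsub>M\<^esub> v \<in> L" using stable_subgroupD(5)[OF L] w(1) v(1) VW sW(2) by blast
      ultimately have "v \<oplus>\<^bsub>M\<^esub> (w \<ominus>\<^bsub>M\<^esub> v) \<in> V"
        using sV(2) v(1) stable_subgroupD(3)[OF sV(1)] by blast
      then show False using w(2) diff_add_cancel_right[OF c] by simp
    qed
    then show "coset ` V \<subset> coset ` W" using VW w(1) by blast
  qed
qed

end

lemma fraction_relI:
  assumes "m \<in> carrier M" "m' \<in> carrier M" "s \<in> carrier R - P" "s' \<in> carrier R - P"
    "u \<in> carrier R - P" "u \<odot>\<^bsub>M\<^esub> ((s' \<odot>\<^bsub>M\<^esub> m) \<ominus>\<^bsub>M\<^esub> (s \<odot>\<^bsub>M\<^esub> m')) = \<zero>\<^bsub>M\<^esub>"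
  shows "((m, s), (m', s')) \<in> fraction_rel R M P"
  unfolding fraction_rel_def using assms by blast

text \<open>
  If every element is killed by some \<open>u \<notin> P\<close>, then any two fractions are equivalent and there is only
  one class; if \<open>m\<close> is killed by no such \<open>u\<close>, then \<open>m/1\<close> differs from \<open>0/1\<close>.
\<close>

lemma localization_nonzero_iff:
  assumes P: "P \<subseteq> carrier R" "\<one> \<notin> P"
  shows "localization R M P \<noteq> {localization_zero R M P} \<longleftrightarrow>
    (\<exists>m\<in>carrier M. \<forall>u\<in>carrier R - P. u \<odot>\<^bsub>M\<^esub> m \<noteq> \<zero>\<^bsub>M\<^esub>)"
proof
  assume ne: "localization R M P \<noteq> {localization_zero R M P}"
  show "\<exists>m\<in>carrier M. \<forall>u\<in>carrier R - P. u \<odot>\<^bsub>M\<^esub> m \<noteq> \<zero>\<^bsub>M\<^esub>"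
  proof (rule ccontr)
    assume "\<not> ?thesis"
    then have kill: "\<exists>u\<in>carrier R - P. u \<odot>\<^bsub>M\<^esub> m = \<zero>\<^bsub>M\<^esub>" if "m \<in> carrier M" for m using that by blast
    let ?W = "carrier M \<times> (carrier R - P)"
    have cls: "fraction_rel R M P `` {(m, s)} = ?W" if "(m, s) \<in> ?W" for m s
    proof -
      have "((m, s), (m', s')) \<in> fraction_rel R M P" if m': "(m', s') \<in> ?W" for m' s'
      proof -
        have "(s' \<odot>\<^bsub>M\<^esub> m) \<ominus>\<^bsub>M\<^esub> (s \<odot>\<^bsub>M\<^esub> m') \<in> carrier M"
          using m' \<open>(m, s) \<in> ?W\<close> by auto
        from kill[OF this] show ?thesis
          using m' \<open>(m, s) \<in> ?W\<close> unfolding fraction_rel_def by blast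
      qed
      then show ?thesis by (auto simp: fraction_rel_def)
    qed
    have z: "(\<zero>\<^bsub>M\<^esub>, \<one>) \<in> ?W" using P(2) by simp
    have "localization R M P = {?W}"
      unfolding localization_def quotient_def using cls z by auto
    moreover have "localization_zero R M P = ?W"
      unfolding localization_zero_def by (rule cls[OF z])
    ultimately show False using ne by simp
  qed
next
  assume "\<exists>m\<in>carrier M. \<forall>u\<in>carrier R - P. u \<odot>\<^bsub>M\<^esub> m \<noteq> \<zero>\<^bsub>M\<^esub>"
  then obtain m where m: "m \<in> carrier M" "\<And>u. u \<in> carrier R - P \<Longrightarrow> u \<odot>\<^bsub>M\<^esub> m \<noteq> \<zero>\<^bsub>M\<^esub>" by blast
  have one: "\<one> \<in> carrier R - P" using P(2) by simp
  let ?c = "fraction_rel R M P `` {(m, \<one>)}"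
  have c_in: "?c \<in> localization R M P"
    unfolding localization_def using m(1) one by (intro quotientI) simp
  have c1: "(m, \<one>) \<in> ?c"
  proof -
    have "\<one> \<odot>\<^bsub>M\<^esub> ((\<one> \<odot>\<^bsub>M\<^esub> m) \<ominus>\<^bsub>M\<^esub> (\<one> \<odot>\<^bsub>M\<^esub> m)) = \<zero>\<^bsub>M\<^esub>"
      using m(1) by (simp add: a_minus_def M.r_neg)
    then have "((m, \<one>), (m, \<one>)) \<in> fraction_rel R M P"
      by (intro fraction_relI[OF m(1) m(1) one one one])
    then show ?thesis by simp
  qed
  have c0: "(m, \<one>) \<notin> localization_zero R M P"
  proof
    assume "(m, \<one>) \<in> localization_zero R M P"
    then obtain u where u: "u \<in> carrier R - P"
      "u \<odot>\<^bsub>M\<^esub> ((\<one> \<odot>\<^bsub>M\<^esub> \<zero>\<^bsub>M\<^esub>) \<ominus>\<^bsub>M\<^esub> (\<one> \<odot>\<^bsub>M\<^esub> m)) = \<zero>\<^bsub>M\<^esub>"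
      by (auto simp: localization_zero_def fraction_rel_def)
    then have "\<ominus>\<^bsub>M\<^esub> (u \<odot>\<^bsub>M\<^esub> m) = \<zero>\<^bsub>M\<^esub>"
      using m(1) by (simp add: a_minus_def smult_r_minus)
    then have "u \<odot>\<^bsub>M\<^esub> m = \<zero>\<^bsub>M\<^esub>"
      using u(1) m(1) M.minus_minus[of "u \<odot>\<^bsub>M\<^esub> m"] by simp
    then show False using m(2)[OF u(1)] by simp
  qed
  show "localization R M P \<noteq> {localization_zero R M P}"
  proof
    assume "localization R M P = {localization_zero R M P}"
    with c_in have "?c = localization_zero R M P" by simp
    with c0 c1 show False by simp
  qed
qed

end

text \<open>
  Submodules of the component record are closed under negation because \<open>-1\<close> acts as a scalar;
  conversely, additive inverses formed in the smaller carrier have to be identified with those of \<open>M\<close>.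
\<close>

lemma component_length_eq:
  fixes A :: "('a, 'w) ring_scheme" and S :: "('a, 's, 'x) module_scheme" and M :: "('s, 'm, 'y) module_scheme"
  assumes alg: "algebra A S" and M: "module S M" and st: "stable_subgroup M (base_scalars A S) (Mg n)"
  shows "component_length A S M Mg n = rel_length M (base_scalars A S) {\<zero>\<^bsub>M\<^esub>} (Mg n)"
proof -
  interpret alg: algebra A S by (rule alg)
  interpret M: module S M by (rule M)
  let ?C = "component_module S M Mg n"
  have D: "Mg n \<subseteq> carrier M" by (rule M.stable_subgroupD(1)[OF st])
  have "submodule N A ?C \<longleftrightarrow> N \<in> stable_interval M (base_scalars A S) {\<zero>\<^bsub>M\<^esub>} (Mg n)" for N
  proof
    assume N: "submodule N A ?C"
    note sg = submodule.axioms(1)[OF N]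
    have sub: "N \<subseteq> Mg n" using subgroup.subset[OF sg] by (simp add: component_module_def)
    have zero: "\<zero>\<^bsub>M\<^esub> \<in> N" using subgroup.one_closed[OF sg] by (simp add: component_module_def)
    have add: "x \<oplus>\<^bsub>M\<^esub> y \<in> N" if "x \<in> N" "y \<in> N" for x y
      using subgroup.m_closed[OF sg that] by (simp add: component_module_def)
    have sm: "(a \<odot>\<^bsub>S\<^esub> \<one>\<^bsub>S\<^esub>) \<odot>\<^bsub>M\<^esub> x \<in> N" if "a \<in> carrier A" "x \<in> N" for a x
      using submodule.smult_closed[OF N that] by (simp add: component_module_def)
    have neg: "\<ominus>\<^bsub>M\<^esub> x \<in> N" if x: "x \<in> N" for x
    proof -
      have xc: "x \<in> carrier M" using x sub D by blast
      have "(\<ominus>\<^bsub>A\<^esub> \<one>\<^bsub>A\<^esub>) \<odot>\<^bsub>S\<^esub> \<one>\<^bsub>S\<^esub> = \<ominus>\<^bsub>S\<^esub> \<one>\<^bsub>S\<^esub>"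
        using alg.smult_l_minus[of "\<one>\<^bsub>A\<^esub>" "\<one>\<^bsub>S\<^esub>"] by simp
      then have "((\<ominus>\<^bsub>A\<^esub> \<one>\<^bsub>A\<^esub>) \<odot>\<^bsub>S\<^esub> \<one>\<^bsub>S\<^esub>) \<odot>\<^bsub>M\<^esub> x = \<ominus>\<^bsub>M\<^esub> x"
        using xc by (simp add: M.smult_l_minus)
      then show ?thesis using sm[of "\<ominus>\<^bsub>A\<^esub> \<one>\<^bsub>A\<^esub>" x] x by simp
    qed
    have "stable_subgroup M (base_scalars A S) N"
      by (rule M.stable_subgroupI) (use sub D zero add sm neg in \<open>auto simp: base_scalars_def\<close>)
    then show "N \<in> stable_interval M (base_scalars A S) {\<zero>\<^bsub>M\<^esub>} (Mg n)"
      using sub zero by (simp add: stable_interval_def)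
  next
    assume "N \<in> stable_interval M (base_scalars A S) {\<zero>\<^bsub>M\<^esub>} (Mg n)"
    then have N: "stable_subgroup M (base_scalars A S) N" and sub: "N \<subseteq> Mg n"
      by (auto simp: stable_interval_def)
    have inv: "m_inv (add_monoid ?C) x = \<ominus>\<^bsub>M\<^esub> x" if x: "x \<in> N" for x
    proof -
      have xc: "x \<in> carrier M" using x sub D by blast
      have "\<ominus>\<^bsub>M\<^esub> x \<in> Mg n" using M.stable_subgroupD(4)[OF N x] sub by blast
      then show ?thesis
        unfolding m_inv_def component_module_def using xc D
        by (intro the_equality) (auto simp: M.l_neg M.r_neg intro: M.minus_equality[symmetric])
    qed
    show "submodule N A ?C"
    proof (intro submodule.intro subgroup.intro submodule_axioms.intro)
      show "m_inv (add_monoid ?C) x \<in> N" if "x \<in> N" for x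
        using inv[OF that] M.stable_subgroupD(4)[OF N that] by simp
    qed (use sub M.stable_subgroupD[OF N] in \<open>auto simp: component_module_def base_scalars_def\<close>)
  qed
  then show ?thesis unfolding component_length_def module_length_def rel_length_def by simp
qed

section \<open>Filter-regular sequences\<close>

locale hilbert_setting = graded_setting A \<mm> S Sg M Mg
  for A :: "('a, 'w) ring_scheme" and \<mm> and S :: "('a, 's, 'x) module_scheme"
    and Sg :: "'d::finite multi \<Rightarrow> 's set" and M :: "('s, 'm, 'y) module_scheme"
    and Mg :: "'d multi \<Rightarrow> 'm set" +
  fixes T :: "'s set" and dg :: "'s \<Rightarrow> 'd"
  assumes generators: "graded_generators_finite S Sg M Mg (base_scalars A S) T dg"
    and generate: "generate_ring S (T \<union> base_scalars A S) = carrier S"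
begin

sublocale gg: graded_generators_finite S Sg M Mg "base_scalars A S" T dg by (rule generators)

definition homogeneous_submodule :: "'m set \<Rightarrow> bool" where
  "homogeneous_submodule Q \<longleftrightarrow> submodule Q S M \<and> (\<forall>m\<in>Q. \<forall>n. Md.mcomp n m \<in> Q)"

definition degree_part :: "'m set \<Rightarrow> 'd multi \<Rightarrow> 'm set" where
  "degree_part Q n = Q \<inter> Mg n"

lemma homogeneous_submoduleD:
  assumes "homogeneous_submodule Q"
  shows "submodule Q S M" "stable_subgroup M (carrier S) Q" "m \<in> Q \<Longrightarrow> Md.mcomp n m \<in> Q"
  using assms unfolding homogeneous_submodule_def by (simp_all add: Md.submodule_iff_stable)

lemma homogeneous_zero: "homogeneous_submodule {\<zero>\<^bsub>M\<^esub>}"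
  using Md.stable_subgroup_zero[OF order_refl]
  by (simp add: homogeneous_submodule_def Md.submodule_iff_stable)

lemma degree_part_graded:
  assumes Q: "homogeneous_submodule Q"
  shows "gg.graded_family T (degree_part Q)"
proof (rule gg.graded_familyI)
  note st = homogeneous_submoduleD(2)[OF Q]
  show "stable_subgroup M \<Omega> (degree_part Q n)" for n
    unfolding degree_part_def
    by (rule Md.stable_subgroup_inter[OF Md.stable_subgroup_subset[OF st scalars_closed] Mg_stable])
  fix t m n assume t: "t \<in> T" and m: "m \<in> degree_part Q n"
  then have "t \<odot>\<^bsub>M\<^esub> m \<in> Mg (n + unit_multi (dg t))"
    by (intro gg.graded_familyD(3)[OF gg.graded_family_whole t]) (simp add: degree_part_def)
  moreover have "t \<odot>\<^bsub>M\<^esub> m \<in> Q"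
    using Md.stable_subgroupD(6)[OF st] t m gg.T_closed by (auto simp: degree_part_def)
  ultimately show "t \<odot>\<^bsub>M\<^esub> m \<in> degree_part Q (n + unit_multi (dg t))" by (simp only: degree_part_def Int_iff simp_thms)
qed (auto simp: degree_part_def)

lemma homogeneous_plus_multiple:
  assumes Q: "homogeneous_submodule Q" and x: "x \<in> Sg k"
  shows "homogeneous_submodule (plus_multiple M Q x (carrier M))"
proof -
  have xc: "x \<in> carrier S" by (rule Sg_closed[OF x])
  note st = homogeneous_submoduleD(2)[OF Q]
  note wh = Md.stable_subgroup_carrier[of "carrier S", OF order_refl]
  have st': "stable_subgroup M (carrier S) (plus_multiple M Q x (carrier M))"
    by (rule Md.stable_subgroup_plus_multiple[OF st wh xc order_refl])
  have "Md.mcomp n y \<in> plus_multiple M Q x (carrier M)" if y: "y \<in> plus_multiple M Q x (carrier M)" for y n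
  proof -
    obtain q m where qm: "q \<in> Q" "m \<in> carrier M" "y = q \<oplus>\<^bsub>M\<^esub> x \<odot>\<^bsub>M\<^esub> m"
      using y by (rule Md.plus_multipleE)
    have qc: "q \<in> carrier M" by (rule Md.stable_subgroup_mem[OF st qm(1)])
    have "Md.mcomp n y = Md.mcomp n q \<oplus>\<^bsub>M\<^esub> Md.mcomp n (x \<odot>\<^bsub>M\<^esub> m)"
      unfolding qm(3) by (rule Md.grading.hcomp_add) (use qc qm(2) xc in auto)
    moreover have "Md.mcomp n (x \<odot>\<^bsub>M\<^esub> m) \<in> plus_multiple M Q x (carrier M)"
    proof (cases "k \<le> n")
      case True
      then show ?thesis
        using Md.hcomp_smult[OF x xc qm(2), of n] Md.smult_mem_plus_multiple[OF st wh xc]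
          Md.grading.gr_closed[OF Md.grading.hcomp_in_gr[OF qm(2)]] by simp
    next
      case False
      then show ?thesis
        using Md.hcomp_smult[OF x xc qm(2), of n] Md.stable_subgroupD(2)[OF st'] by simp
    qed
    moreover have "Md.mcomp n q \<in> plus_multiple M Q x (carrier M)"
      using homogeneous_submoduleD(3)[OF Q qm(1)] Md.subset_plus_multiple[OF st wh xc] by blast
    ultimately show ?thesis using Md.stable_subgroupD(3)[OF st'] by simp
  qed
  then show ?thesis using st' by (simp add: homogeneous_submodule_def Md.submodule_iff_stable)
qed

text \<open>
  An element \<open>q + x m\<close> of degree \<open>n + unit_multi j\<close> equals the sum of the corresponding components of
  \<open>q\<close> and \<open>x m\<close>; the former lies in \<open>Q\<close> because \<open>Q\<close> is homogeneous.
\<close>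

lemma image_family_degree_part:
  assumes Q: "homogeneous_submodule Q" and x: "x \<in> Sg (unit_multi j)"
  shows "gg.image_family (degree_part Q) x j Mg (n + unit_multi j) =
    degree_part (plus_multiple M Q x (carrier M)) (n + unit_multi j)"
proof -
  let ?n = "n + unit_multi j" and ?Q' = "plus_multiple M Q x (carrier M)"
  have xc: "x \<in> carrier S" by (rule Sg_closed[OF x])
  have comm: "unit_multi j + n = ?n" by (rule add.commute)
  have xm: "x \<odot>\<^bsub>M\<^esub> m \<in> Mg ?n" if "m \<in> Mg n" for m
    using Md.smult_gr[OF x that] unfolding comm .
  have "plus_multiple M (degree_part Q ?n) x (Mg n) = degree_part ?Q' ?n"
  proof
    show "plus_multiple M (degree_part Q ?n) x (Mg n) \<subseteq> degree_part ?Q' ?n"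
      using xm by (auto elim!: Md.plus_multipleE simp: degree_part_def intro!: Md.plus_multipleI)
    show "degree_part ?Q' ?n \<subseteq> plus_multiple M (degree_part Q ?n) x (Mg n)"
    proof
      fix y assume y: "y \<in> degree_part ?Q' ?n"
      then have yn: "y \<in> Mg ?n" by (simp add: degree_part_def)
      from y obtain q m where qm: "q \<in> Q" "m \<in> carrier M" "y = q \<oplus>\<^bsub>M\<^esub> x \<odot>\<^bsub>M\<^esub> m"
        unfolding degree_part_def by (blast elim: Md.plus_multipleE)
      have qc: "q \<in> carrier M" by (rule Md.stable_subgroup_mem[OF homogeneous_submoduleD(2)[OF Q] qm(1)])
      have "y = Md.mcomp ?n y" using Md.grading.hcomp_homogeneous[OF yn, of ?n] by simp
      also have "\<dots> = Md.mcomp ?n q \<oplus>\<^bsub>M\<^esub> Md.mcomp ?n (x \<odot>\<^bsub>M\<^esub> m)"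
        unfolding qm(3) by (rule Md.grading.hcomp_add) (use qc qm(2) xc in auto)
      also have "Md.mcomp ?n (x \<odot>\<^bsub>M\<^esub> m) = x \<odot>\<^bsub>M\<^esub> Md.mcomp n m"
        by (rule Md.hcomp_smult_shift[OF x xc qm(2)])
      finally have "y = Md.mcomp ?n q \<oplus>\<^bsub>M\<^esub> x \<odot>\<^bsub>M\<^esub> Md.mcomp n m" .
      moreover have "Md.mcomp ?n q \<in> degree_part Q ?n"
        unfolding degree_part_def
        using homogeneous_submoduleD(3)[OF Q qm(1)] Md.grading.hcomp_in_gr[OF qc] by (rule IntI)
      ultimately show "y \<in> plus_multiple M (degree_part Q ?n) x (Mg n)"
        using Md.plus_multipleI[OF _ Md.grading.hcomp_in_gr[OF qm(2)]] by (simp only:)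
    qed
  qed
  then show ?thesis by (simp only: gg.image_family_shift)
qed

lemma filter_regular_colon:
  assumes Q: "homogeneous_submodule Q" and x: "x \<in> Sg (unit_multi j)"
    and reg: "filter_regular Sg (quot_module M Q) (quot_gr M Mg Q) x"
  shows "for_all_large (\<lambda>n. gg.colon_family (degree_part Q) x j Mg n = degree_part Q n)"
proof -
  note sub = homogeneous_submoduleD(1)[OF Q] and st = homogeneous_submoduleD(2)[OF Q]
  have xc: "x \<in> carrier S" by (rule Sg_closed[OF x])
  have "for_all_large (\<lambda>n. {m \<in> carrier (quot_module M Q). x \<odot>\<^bsub>quot_module M Q\<^esub> m = \<zero>\<^bsub>quot_module M Q\<^esub>}
      \<inter> quot_gr M Mg Q n = {\<zero>\<^bsub>quot_module M Q\<^esub>})"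
    using reg unfolding filter_regular_def by (rule conjunct2)
  then show ?thesis
  proof (rule for_all_large_mono)
    fix n
    assume eq: "{m \<in> carrier (quot_module M Q). x \<odot>\<^bsub>quot_module M Q\<^esub> m = \<zero>\<^bsub>quot_module M Q\<^esub>}
      \<inter> quot_gr M Mg Q n = {\<zero>\<^bsub>quot_module M Q\<^esub>}"
    show "gg.colon_family (degree_part Q) x j Mg n = degree_part Q n"
    proof
      show "gg.colon_family (degree_part Q) x j Mg n \<subseteq> degree_part Q n"
      proof
        fix m assume "m \<in> gg.colon_family (degree_part Q) x j Mg n"
        then have m: "m \<in> Mg n" "x \<odot>\<^bsub>M\<^esub> m \<in> Q"
          unfolding gg.colon_family_def colon_in_def degree_part_def by blast+
        have mc: "m \<in> carrier M" using m(1) by simp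
        have "x \<odot>\<^bsub>quot_module M Q\<^esub> (Q +>\<^bsub>M\<^esub> m) = \<zero>\<^bsub>quot_module M Q\<^esub>"
          using Md.quot_smult[OF sub xc mc] Md.coset_eq_Q_iff[OF sub, of "x \<odot>\<^bsub>M\<^esub> m"] m(2) xc mc
          by (simp add: Md.quot_zero[OF sub])
        moreover have "Q +>\<^bsub>M\<^esub> m \<in> carrier (quot_module M Q)"
          unfolding Md.quot_carrier[OF sub] using mc by (rule imageI)
        moreover have "Q +>\<^bsub>M\<^esub> m \<in> quot_gr M Mg Q n"
          unfolding quot_gr_def using m(1) by (rule imageI)
        ultimately have "Q +>\<^bsub>M\<^esub> m = \<zero>\<^bsub>quot_module M Q\<^esub>" using eq by blast
        then have "m \<in> Q" using Md.coset_eq_Q_iff[OF sub mc] Md.quot_zero[OF sub] by simp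
        then show "m \<in> degree_part Q n" using m(1) by (simp add: degree_part_def)
      qed
      show "degree_part Q n \<subseteq> gg.colon_family (degree_part Q) x j Mg n"
      proof
        fix m assume m: "m \<in> degree_part Q n"
        then have "x \<odot>\<^bsub>M\<^esub> m \<in> Q" using Md.stable_subgroupD(6)[OF st xc] by (simp add: degree_part_def)
        moreover have "x \<odot>\<^bsub>M\<^esub> m \<in> Mg (n + unit_multi j)"
          using Md.smult_gr[OF x, of m n] m unfolding degree_part_def add.commute[of n] by blast
        ultimately show "m \<in> gg.colon_family (degree_part Q) x j Mg n"
          using m unfolding gg.colon_family_def colon_in_def degree_part_def by blast
      qed
    qed
  qed
qed

text \<open>
  Filter-regularity makes the kernel in the exact sequence of multiplication by \<open>x\<close> vanish in large
  degrees, so only the cokernel contributes to the difference of lengths.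
\<close>

lemma filter_regular_length:
  assumes Q: "homogeneous_submodule Q" and x: "x \<in> Sg (unit_multi j)"
    and reg: "filter_regular Sg (quot_module M Q) (quot_gr M Mg Q) x"
  shows "for_all_large (\<lambda>n. gg.quotient_length (degree_part (plus_multiple M Q x (carrier M))) Mg (n + unit_multi j) =
    gg.quotient_length (degree_part Q) Mg (n + unit_multi j) - gg.quotient_length (degree_part Q) Mg n)"
  using filter_regular_colon[OF assms]
proof (rule for_all_large_mono)
  fix n assume colon: "gg.colon_family (degree_part Q) x j Mg n = degree_part Q n"
  have xc: "x \<in> carrier S" by (rule Sg_closed[OF x])
  have xm: "x \<odot>\<^bsub>M\<^esub> m \<in> Mg (n + unit_multi j)" if "m \<in> Mg n" for m n
    using Md.smult_gr[OF x that] unfolding add.commute[of n] .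
  have xQ: "x \<odot>\<^bsub>M\<^esub> m \<in> degree_part Q (n + unit_multi j)" if "m \<in> degree_part Q n" for m n
    using xm[of m n] that Md.stable_subgroupD(6)[OF homogeneous_submoduleD(2)[OF Q] xc]
    unfolding degree_part_def by blast
  have "gg.quotient_length (degree_part Q) Mg (n + unit_multi j) - gg.quotient_length (degree_part Q) Mg n =
     gg.quotient_length (gg.image_family (degree_part Q) x j Mg) Mg (n + unit_multi j) -
     gg.quotient_length (degree_part Q) (gg.colon_family (degree_part Q) x j Mg) n"
    by (rule gg.quotient_length_difference[OF degree_part_graded[OF Q] gg.graded_family_whole _ order_refl xc x xm xQ])
      (auto simp: degree_part_def)
  moreover have "gg.quotient_length (degree_part Q) (gg.colon_family (degree_part Q) x j Mg) n = 0"
    unfolding gg.quotient_length_def colon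
    using Md.rel_length_self[OF gg.graded_familyD(1)[OF degree_part_graded[OF Q]]] by (simp add: zero_enat_def)
  moreover have "gg.quotient_length (gg.image_family (degree_part Q) x j Mg) Mg (n + unit_multi j) =
      gg.quotient_length (degree_part (plus_multiple M Q x (carrier M))) Mg (n + unit_multi j)"
    unfolding gg.quotient_length_def image_family_degree_part[OF Q x] ..
  ultimately show "gg.quotient_length (degree_part (plus_multiple M Q x (carrier M))) Mg (n + unit_multi j) =
    gg.quotient_length (degree_part Q) Mg (n + unit_multi j) - gg.quotient_length (degree_part Q) Mg n"
    by linarith
qed

lemma seq_mult_Nil: "seq_mult S M [] = {\<zero>\<^bsub>M\<^esub>}"
proof
  show "seq_mult S M [] \<subseteq> {\<zero>\<^bsub>M\<^esub>}"
    unfolding seq_mult_def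
    by (rule gen_submodule_least) (use Md.stable_subgroup_zero[OF order_refl] in \<open>auto simp: Md.submodule_iff_stable\<close>)
  have "stable_subgroup M (carrier S) (seq_mult S M [])"
    unfolding seq_mult_def by (rule Md.stable_gen_submodule) simp
  then show "{\<zero>\<^bsub>M\<^esub>} \<subseteq> seq_mult S M []" using Md.stable_subgroupD(2) by blast
qed

lemma seq_mult_snoc:
  assumes "set xs \<subseteq> carrier S" "x \<in> carrier S"
  shows "seq_mult S M (xs @ [x]) = plus_multiple M (seq_mult S M xs) x (carrier M)"
proof -
  let ?B = "\<lambda>xs. {x \<odot>\<^bsub>M\<^esub> m | x m. x \<in> set xs \<and> m \<in> carrier M}"
  have B: "?B ys \<subseteq> carrier M" if "set ys \<subseteq> carrier S" for ys using that by auto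
  have B1: "?B xs \<subseteq> carrier M" "?B (xs @ [x]) \<subseteq> carrier M"
    by (rule B, use assms in simp)+
  note g1 = Md.stable_gen_submodule[OF B1(1), folded seq_mult_def]
  note g2 = Md.stable_gen_submodule[OF B1(2), folded seq_mult_def]
  note wh = Md.stable_subgroup_carrier[of "carrier S", OF order_refl]
  have st: "stable_subgroup M (carrier S) (plus_multiple M (seq_mult S M xs) x (carrier M))"
    by (rule Md.stable_subgroup_plus_multiple[OF g1(1) wh assms(2) order_refl])
  show ?thesis
  proof
    show "seq_mult S M (xs @ [x]) \<subseteq> plus_multiple M (seq_mult S M xs) x (carrier M)"
      unfolding seq_mult_def[of S M "xs @ [x]"]
    proof (rule gen_submodule_least)
      show "submodule (plus_multiple M (seq_mult S M xs) x (carrier M)) S M"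
        using st by (simp add: Md.submodule_iff_stable)
      have "y \<odot>\<^bsub>M\<^esub> m \<in> plus_multiple M (seq_mult S M xs) x (carrier M)"
        if "y \<in> set xs" "m \<in> carrier M" for y m
        by (rule subsetD[OF Md.subset_plus_multiple[OF g1(1) wh assms(2)]], rule subsetD[OF g1(2)])
          (use that in blast)
      then show "?B (xs @ [x]) \<subseteq> plus_multiple M (seq_mult S M xs) x (carrier M)"
        using Md.smult_mem_plus_multiple[OF g1(1) wh assms(2)] by auto
    qed
    show "plus_multiple M (seq_mult S M xs) x (carrier M) \<subseteq> seq_mult S M (xs @ [x])"
    proof (rule Md.plus_multiple_subset[OF g2(1)])
      show "seq_mult S M xs \<subseteq> seq_mult S M (xs @ [x])"
        unfolding seq_mult_def[of S M xs]
        by (rule gen_submodule_least) (use g2 in \<open>auto simp: Md.submodule_iff_stable\<close>)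
      show "x \<odot>\<^bsub>M\<^esub> m \<in> seq_mult S M (xs @ [x])" if "m \<in> carrier M" for m
        by (rule subsetD[OF g2(2)]) (use that in auto)
    qed
  qed
qed

lemma filter_regular_seq_snoc:
  assumes "filter_regular_seq S Sg M Mg (xs @ [x])"
  shows "filter_regular_seq S Sg M Mg xs"
    "filter_regular Sg (quot_module M (seq_mult S M xs)) (quot_gr M Mg (seq_mult S M xs)) x"
proof -
  have *: "filter_regular Sg (quot_module M (seq_mult S M (take i (xs @ [x]))))
      (quot_gr M Mg (seq_mult S M (take i (xs @ [x])))) ((xs @ [x]) ! i)" if "i < length (xs @ [x])" for i
    using assms that unfolding filter_regular_seq_def Let_def by blast
  from *[of "length xs"] show
    "filter_regular Sg (quot_module M (seq_mult S M xs)) (quot_gr M Mg (seq_mult S M xs)) x" by simp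
  show "filter_regular_seq S Sg M Mg xs"
    unfolding filter_regular_seq_def Let_def
  proof (intro allI impI)
    fix i assume "i < length xs"
    with *[of i] show "filter_regular Sg (quot_module M (seq_mult S M (take i xs)))
      (quot_gr M Mg (seq_mult S M (take i xs))) (xs ! i)" by (simp add: nth_append)
  qed
qed

text \<open>
  Each term of the sequence drawn from \<open>S\<^sub>j\<close> replaces the Hilbert polynomial by its difference in
  direction \<open>j\<close>, that is, shifts the coefficients by the \<open>j\<close>-th unit vector.
\<close>

lemma filter_regular_seq_hilbert:
  assumes fin: "finite {k. e k \<noteq> 0}"
    and e: "for_all_large (\<lambda>n. gg.quotient_length (degree_part {\<zero>\<^bsub>M\<^esub>}) Mg n = hsum e n)"
    and "filter_regular_seq S Sg M Mg xs" "list_all2 (\<lambda>x j. x \<in> Sg (unit_multi j)) xs js"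
  shows "homogeneous_submodule (seq_mult S M xs) \<and>
    for_all_large (\<lambda>n. gg.quotient_length (degree_part (seq_mult S M xs)) Mg n =
      hsum (coeff_shift (count_list js) e) n)"
  using assms(3,4)
proof (induction xs arbitrary: js rule: rev_induct)
  case Nil
  then have js: "js = []" by simp
  have count: "h + count_list [] = h" for h :: "'d multi" by (simp add: fun_eq_iff)
  show ?case unfolding seq_mult_Nil js count using homogeneous_zero e by (rule conjI)
next
  case (snoc x xs)
  obtain js' j where js: "js = js' @ [j]" using snoc.prems(2) by (cases js rule: rev_cases) auto
  have l: "list_all2 (\<lambda>x j. x \<in> Sg (unit_multi j)) xs js'" and x: "x \<in> Sg (unit_multi j)"
    using snoc.prems(2) list_all2_lengthD[OF snoc.prems(2)] unfolding js
    by (auto simp: list_all2_append)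
  note reg = filter_regular_seq_snoc[OF snoc.prems(1)]
  let ?Q = "seq_mult S M xs"
  from snoc.IH[OF reg(1) l] have Q: "homogeneous_submodule ?Q" and
    f: "for_all_large (\<lambda>n. gg.quotient_length (degree_part ?Q) Mg n = hsum (coeff_shift (count_list js') e) n)"
    by (rule conjunct1, rule conjunct2)
  have "set xs \<subseteq> carrier S"
    using l by (induction xs js' rule: list_all2_induct) (auto intro: Sg_closed)
  then have Q': "seq_mult S M (xs @ [x]) = plus_multiple M ?Q x (carrier M)"
    by (rule seq_mult_snoc) (rule Sg_closed[OF x])
  have count: "h + unit_multi j + count_list js' = h + count_list js" for h
    by (auto simp: fun_eq_iff js unit_multi_def)
  let ?e = "coeff_shift (count_list js') e"
  have fin': "finite {k. ?e k \<noteq> 0}" by (rule finite_coeff_shift[OF fin])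
  have "for_all_large (\<lambda>n. gg.quotient_length (degree_part (plus_multiple M ?Q x (carrier M))) Mg (n + unit_multi j) =
      hsum (coeff_shift (unit_multi j) ?e) (n + unit_multi j))"
  proof (rule for_all_large_mono[OF for_all_large_conj[OF filter_regular_length[OF Q x reg(2)]
        for_all_large_conj[OF f for_all_large_shift[OF f]]]])
    fix n
    assume "gg.quotient_length (degree_part (plus_multiple M ?Q x (carrier M))) Mg (n + unit_multi j) =
        gg.quotient_length (degree_part ?Q) Mg (n + unit_multi j) - gg.quotient_length (degree_part ?Q) Mg n \<and>
      gg.quotient_length (degree_part ?Q) Mg n = hsum ?e n \<and>
      gg.quotient_length (degree_part ?Q) Mg (n + unit_multi j) = hsum ?e (n + unit_multi j)"
    then show "gg.quotient_length (degree_part (plus_multiple M ?Q x (carrier M))) Mg (n + unit_multi j) =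
      hsum (coeff_shift (unit_multi j) ?e) (n + unit_multi j)"
      using hsum_diff[OF fin', of n j] by linarith
  qed
  then have "for_all_large (\<lambda>n. gg.quotient_length (degree_part (plus_multiple M ?Q x (carrier M))) Mg n =
      hsum (coeff_shift (unit_multi j) ?e) n)"
    by (rule for_all_large_unshift)
  then show ?case
    unfolding Q' count using homogeneous_plus_multiple[OF Q x] by (intro conjI)
qed

lemma component_length_quot:
  assumes Q: "homogeneous_submodule Q"
  shows "component_length A S (quot_module M Q) (quot_gr M Mg Q) n =
    enat (nat (gg.quotient_length (degree_part Q) Mg n))"
proof -
  note sub = homogeneous_submoduleD(1)[OF Q]
  have alg: "algebra A S" by (rule Alg.algebra_axioms)
  have "component_length A S (quot_module M Q) (quot_gr M Mg Q) n =
      rel_length (quot_module M Q) \<Omega> {\<zero>\<^bsub>quot_module M Q\<^esub>} (quot_gr M Mg Q n)"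
    by (rule component_length_eq[where n = n, OF alg Md.quot_module_module[OF sub]])
      (unfold quot_gr_def, rule Md.stable_subgroup_image[OF sub Mg_stable scalars_closed])
  also have "\<dots> = rel_length M \<Omega> (Q \<inter> Mg n) (Mg n)"
    unfolding quot_gr_def by (rule Md.rel_length_quot[OF sub Mg_stable scalars_closed])
  also have "\<dots> = enat (nat (gg.quotient_length (degree_part Q) Mg n))"
    using gg.quotient_length[OF degree_part_graded[OF Q] gg.graded_family_whole, of n]
    by (simp only: degree_part_def)
  finally show ?thesis .
qed

lemma component_length_whole:
  "component_length A S M Mg n = enat (nat (gg.quotient_length (degree_part {\<zero>\<^bsub>M\<^esub>}) Mg n))"
proof -
  have "{\<zero>\<^bsub>M\<^esub>} \<inter> Mg n = {\<zero>\<^bsub>M\<^esub>}" by simp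
  then show ?thesis
    using gg.quotient_length[OF degree_part_graded[OF homogeneous_zero] gg.graded_family_whole, of n]
      component_length_eq[where Mg = Mg and n = n, OF Alg.algebra_axioms Md.module_axioms Mg_stable]
    by (simp only: degree_part_def)
qed

text \<open>Existence is the Hilbert polynomial, uniqueness that of expansions.\<close>

lemma hilbert_coeff_expansion:
  obtains e where "finite {k. e k \<noteq> 0}"
    "for_all_large (\<lambda>n. gg.quotient_length (degree_part {\<zero>\<^bsub>M\<^esub>}) Mg n = hsum e n)"
    "hilbert_coeff A S M Mg = e"
proof -
  have "eventually_poly (gg.quotient_length (degree_part {\<zero>\<^bsub>M\<^esub>}) Mg)"
    by (rule gg.hilbert_polynomial[OF order_refl degree_part_graded[OF homogeneous_zero]
          gg.graded_family_whole _ gg.family_acc_whole]) (auto simp: degree_part_def le_fun_def)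
  then have "\<exists>e. finite {k. e k \<noteq> 0} \<and>
      for_all_large (\<lambda>n. gg.quotient_length (degree_part {\<zero>\<^bsub>M\<^esub>}) Mg n = hsum e n)"
    by (simp only: eventually_poly_def)
  then obtain e where e: "finite {k. e k \<noteq> 0} \<and>
      for_all_large (\<lambda>n. gg.quotient_length (degree_part {\<zero>\<^bsub>M\<^esub>}) Mg n = hsum e n)" by (rule exE)
  have iff: "is_hilbert_expansion A S M Mg e' \<longleftrightarrow> finite {k. e' k \<noteq> 0} \<and>
      for_all_large (\<lambda>n. gg.quotient_length (degree_part {\<zero>\<^bsub>M\<^esub>}) Mg n = hsum e' n)" for e'
  proof -
    have "(\<exists>l::nat. component_length A S M Mg n = enat l \<and>
        int l = (\<Sum>k | e' k \<noteq> 0. e' k * int (\<Prod>i\<in>UNIV. (n i + k i) choose (k i)))) \<longleftrightarrow>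
      gg.quotient_length (degree_part {\<zero>\<^bsub>M\<^esub>}) Mg n = hsum e' n" for n
    proof -
      have "0 \<le> gg.quotient_length (degree_part {\<zero>\<^bsub>M\<^esub>}) Mg n"
        by (rule gg.quotient_length_nonneg)
      then show ?thesis unfolding component_length_whole hsum_def mbinom_def by auto
    qed
    then show ?thesis unfolding is_hilbert_expansion_def by (simp only:)
  qed
  have "hilbert_coeff A S M Mg = e"
    unfolding hilbert_coeff_def
  proof (rule the_equality)
    show "is_hilbert_expansion A S M Mg e" unfolding iff by (rule e)
    fix e' assume "is_hilbert_expansion A S M Mg e'"
    then have e': "finite {k. e' k \<noteq> 0} \<and>
      for_all_large (\<lambda>n. gg.quotient_length (degree_part {\<zero>\<^bsub>M\<^esub>}) Mg n = hsum e' n)" unfolding iff .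
    show "e' = e"
      by (rule hsum_eventually_unique[OF e'[THEN conjunct1] e[THEN conjunct1]
            e'[THEN conjunct2] e[THEN conjunct2]])
  qed
  with e show thesis by (intro that) (rule conjunct1 conjunct2, assumption)+
qed

text \<open>
  The coefficients of the Hilbert polynomial of the quotient are \<open>e (h + k)\<close>. Those with \<open>h \<noteq> 0\<close> vanish
  because \<open>e\<close> vanishes strictly above \<open>k\<close>, and the constant \<open>e k\<close> remains.
\<close>

theorem mixed_multiplicity_eq_length:
  assumes def: "mixed_multiplicity_defined A S M Mg k"
    and reg: "filter_regular_seq S Sg M Mg xs" and type: "seq_of_type Sg k xs"
  shows "homogeneous_submodule (seq_mult S M xs)"
    "for_all_large (\<lambda>n. gg.quotient_length (degree_part (seq_mult S M xs)) Mg n = hilbert_coeff A S M Mg k)"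
proof -
  obtain e where e: "finite {k. e k \<noteq> 0}"
    "for_all_large (\<lambda>n. gg.quotient_length (degree_part {\<zero>\<^bsub>M\<^esub>}) Mg n = hsum e n)"
    "hilbert_coeff A S M Mg = e" by (rule hilbert_coeff_expansion)
  obtain js where js: "list_all2 (\<lambda>x j. x \<in> Sg (unit_multi j)) xs js" "\<forall>j. count_list js j = k j"
    using type unfolding seq_of_type_def by blast
  have k: "count_list js = k" using js(2) by (simp add: fun_eq_iff)
  note res = filter_regular_seq_hilbert[OF e(1,2) reg js(1), unfolded k]
  show "homogeneous_submodule (seq_mult S M xs)" using res by (rule conjunct1)
  have zero: "e (h + k) = 0" if "h \<noteq> 0" for h
  proof -
    have "k < h + k"
    proof (rule le_neq_trans)
      show "k \<le> h + k" by (simp add: le_fun_def)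
      show "k \<noteq> h + k"
      proof
        assume "k = h + k"
        then have "h i = 0" for i using fun_cong[of k "h + k" i] by simp
        with that show False by (auto simp: fun_eq_iff)
      qed
    qed
    then show ?thesis using def unfolding mixed_multiplicity_defined_def e(3) by blast
  qed
  have "hsum (coeff_shift k e) n = e k" for n
  proof -
    have "{h. coeff_shift k e h \<noteq> 0} \<subseteq> {0}" using zero by blast
    then have "hsum (coeff_shift k e) n = (\<Sum>h\<in>{0}. coeff_shift k e h * mbinom n h)"
      by (intro hsum_superset) simp_all
    then show ?thesis by simp
  qed
  then show "for_all_large (\<lambda>n. gg.quotient_length (degree_part (seq_mult S M xs)) Mg n =
      hilbert_coeff A S M Mg k)"
    using res[THEN conjunct2] unfolding e(3) by (simp only:)
qed

end

section \<open>Supports of bounded graded modules\<close>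

text \<open>
  Pick \<open>p\<close> and \<open>q\<close> lexicographically largest, by maximizing one coordinate after the other: two
  coordinates bounded by their maxima \<open>a\<close> and \<open>b\<close> can add up to \<open>a + b\<close> only if they equal \<open>a\<close> and \<open>b\<close>.
\<close>

lemma unique_sum_coordinates:
  fixes A B :: "('d::finite multi) set"
  assumes "finite D" "finite A" "A \<noteq> {}" "finite B" "B \<noteq> {}"
  shows "\<exists>p\<in>A. \<exists>q\<in>B. \<forall>p'\<in>A. \<forall>q'\<in>B. p' + q' = p + q \<longrightarrow> (\<forall>i\<in>D. p' i = p i \<and> q' i = q i)"
  using assms
proof (induction D arbitrary: A B rule: finite_induct)
  case empty
  then show ?case by auto
next
  case (insert i D)
  define a where "a = Max ((\<lambda>p. p i) ` A)"
  define b where "b = Max ((\<lambda>q. q i) ` B)"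
  let ?A = "{p \<in> A. p i = a}" and ?B = "{q \<in> B. q i = b}"
  have a: "p i \<le> a" if "p \<in> A" for p unfolding a_def using insert.prems(1) that by (intro Max_ge) auto
  have b: "q i \<le> b" if "q \<in> B" for q unfolding b_def using insert.prems(3) that by (intro Max_ge) auto
  have "a \<in> (\<lambda>p. p i) ` A" unfolding a_def using insert.prems(1,2) by (intro Max_in) auto
  then have A: "?A \<noteq> {}" by auto
  have "b \<in> (\<lambda>q. q i) ` B" unfolding b_def using insert.prems(3,4) by (intro Max_in) auto
  then have B: "?B \<noteq> {}" by auto
  have fin: "finite ?A" "finite ?B" using insert.prems(1,3) by auto
  have "\<exists>p\<in>?A. \<exists>q\<in>?B. \<forall>p'\<in>?A. \<forall>q'\<in>?B. p' + q' = p + q \<longrightarrow> (\<forall>i\<in>D. p' i = p i \<and> q' i = q i)"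
    by (rule insert.IH[OF fin(1) A fin(2) B])
  then obtain p q where p: "p \<in> A" "p i = a" and q: "q \<in> B" "q i = b" and
    u: "\<forall>p'\<in>?A. \<forall>q'\<in>?B. p' + q' = p + q \<longrightarrow> (\<forall>i\<in>D. p' i = p i \<and> q' i = q i)" by auto
  have "\<forall>i\<in>insert i D. p' i = p i \<and> q' i = q i" if "p' \<in> A" "q' \<in> B" "p' + q' = p + q" for p' q'
  proof -
    have "p' i + q' i = a + b" using fun_cong[OF that(3), of i] p(2) q(2) by simp
    then have "p' i = a" "q' i = b" using a[OF that(1)] b[OF that(2)] by auto
    moreover from this have "\<forall>i\<in>D. p' i = p i \<and> q' i = q i" using u that by blast
    ultimately show ?thesis using p(2) q(2) by simp
  qed
  then show ?case using p(1) q(1) by blast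
qed

lemma unique_sum:
  fixes A B :: "('d::finite multi) set"
  assumes "finite A" "A \<noteq> {}" "finite B" "B \<noteq> {}"
  obtains p q where "p \<in> A" "q \<in> B" "\<And>p' q'. p' \<in> A \<Longrightarrow> q' \<in> B \<Longrightarrow> p' + q' = p + q \<Longrightarrow> p' = p"
proof -
  obtain p q where pq: "p \<in> A" "q \<in> B" and
    u: "\<forall>p'\<in>A. \<forall>q'\<in>B. p' + q' = p + q \<longrightarrow> (\<forall>i\<in>UNIV. p' i = p i \<and> q' i = q i)"
    using unique_sum_coordinates[OF finite_UNIV assms] by blast
  show thesis
  proof (rule that[OF pq])
    fix p' q' assume "p' \<in> A" "q' \<in> B" "p' + q' = p + q"
    then have "\<forall>i\<in>UNIV. p' i = p i \<and> q' i = q i" using u by blast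
    then show "p' = p" by (simp add: fun_eq_iff)
  qed
qed

text \<open>\<open>S\<close> as a module over itself, so that facts on homogeneous components of modules apply to \<open>S\<close>.\<close>

definition regular_module :: "('s, 'x) ring_scheme \<Rightarrow> ('s, 's) module" where
  "regular_module S = \<lparr>carrier = carrier S, monoid.mult = monoid.mult S, monoid.one = \<one>\<^bsub>S\<^esub>,
     ring.zero = \<zero>\<^bsub>S\<^esub>, ring.add = ring.add S, module.smult = monoid.mult S\<rparr>"

context hilbert_setting
begin

abbreviation "Sr \<equiv> regular_module S"

lemma Sr_simps [simp]:
  "carrier Sr = carrier S" "\<zero>\<^bsub>Sr\<^esub> = \<zero>\<^bsub>S\<^esub>" "x \<oplus>\<^bsub>Sr\<^esub> y = x \<oplus>\<^bsub>S\<^esub> y" "x \<odot>\<^bsub>Sr\<^esub> y = x \<otimes>\<^bsub>S\<^esub> y"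
  "\<ominus>\<^bsub>Sr\<^esub> x = \<ominus>\<^bsub>S\<^esub> x"
  by (simp_all add: regular_module_def a_inv_def m_inv_def)

lemma S_cring: "cring S"
  using Md.module_axioms unfolding module_def by blast

lemma regular_multigraded: "multigraded_module S Sg Sr Sg"
proof -
  have ag: "abelian_group Sr"
    by (rule abelian_groupI) (auto simp: Alg.a_assoc Alg.a_comm Alg.a_lcomm intro: Alg.l_neg)
  have m: "module S Sr"
    by (rule moduleI[OF S_cring ag]) (auto simp: Alg.l_distr Alg.r_distr Alg.m_assoc)
  have finsum: "finsum Sr f F = finsum S f F" for f :: "'d multi \<Rightarrow> 's" and F
    by (simp add: finsum_def finprod_def regular_module_def)
  have sub: "additive_subgroup N Sr \<longleftrightarrow> additive_subgroup N S" for N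
    unfolding additive_subgroup_def subgroup_def m_inv_def by (simp add: regular_module_def)
  have "multigraded_group Sr Sg"
    using ag Alg.grading.gr_subgroup Alg.grading.gr_decomposition
    by (simp add: multigraded_group_def multigraded_group_axioms_def sub finsum)
  then show ?thesis
    using m Alg.mult_gr by (simp add: multigraded_module_def multigraded_module_axioms_def)
qed

sublocale Rg: multigraded_module S Sg Sr Sg by (rule regular_multigraded)

abbreviation rcomp where "rcomp \<equiv> hcomp Sr Sg"

lemma rcomp_closed: "s \<in> carrier S \<Longrightarrow> rcomp n s \<in> carrier S"
  using Rg.grading.gr_closed[OF Rg.grading.hcomp_in_gr, of s n] by simp

lemma rcomp_gr: "s \<in> carrier S \<Longrightarrow> rcomp n s \<in> Sg n"
  using Rg.grading.hcomp_in_gr[of s n] by simp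

lemma rcomp_zero [simp]: "rcomp n \<zero>\<^bsub>S\<^esub> = \<zero>\<^bsub>S\<^esub>"
  using Rg.grading.hcomp_zero[of n] by simp

lemma hcomp_smult_homogeneous:
  assumes s: "s \<in> carrier S" and m: "m \<in> Mg n"
  shows "Md.mcomp (n + k) (s \<odot>\<^bsub>M\<^esub> m) = rcomp k s \<odot>\<^bsub>M\<^esub> m"
proof -
  have s': "s \<in> carrier Sr" using s by simp
  have mc: "m \<in> carrier M" using m by simp
  show ?thesis
    using s'
  proof (induction s rule: Rg.grading.hcomp_induct)
    case zero
    then show ?case using mc by simp
  next
    case (homogeneous i)
    let ?s = "rcomp i s"
    have gr: "?s \<in> Sg i" by (rule rcomp_gr[OF s])
    have "?s \<odot>\<^bsub>M\<^esub> m \<in> Mg (i + n)" by (rule Md.smult_gr[OF gr m])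
    moreover have "n + k = i + n \<longleftrightarrow> k = i" by (auto simp: fun_eq_iff)
    ultimately have "Md.mcomp (n + k) (?s \<odot>\<^bsub>M\<^esub> m) = (if k = i then ?s \<odot>\<^bsub>M\<^esub> m else \<zero>\<^bsub>M\<^esub>)"
      using Md.grading.hcomp_homogeneous[of "?s \<odot>\<^bsub>M\<^esub> m" "i + n" "n + k"] by (simp only:)
    then show ?case
      unfolding Rg.grading.hcomp_homogeneous[OF gr, of k]
      by (cases "k = i") (simp_all only: if_True if_False refl simp_thms Md.smult_l_null[OF mc] Sr_simps)
  next
    case (add y z)
    then show ?case
      using mc Md.grading.hcomp_add[of "y \<odot>\<^bsub>M\<^esub> m" "z \<odot>\<^bsub>M\<^esub> m"] Rg.grading.hcomp_add[of y z k]
      by (simp add: Md.smult_l_distr rcomp_closed)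
  qed
qed

lemma ideal_finsum:
  assumes "ideal P S" "finite F" "\<And>n. n \<in> F \<Longrightarrow> f n \<in> P"
  shows "(\<Oplus>\<^bsub>S\<^esub>n\<in>F. f n) \<in> P"
proof -
  interpret ideal P S by (rule assms(1))
  show ?thesis
    using assms(2,3)
  proof (induction F rule: finite_induct)
    case (insert n F)
    then have "f \<in> F \<rightarrow> carrier S" "f n \<in> carrier S" using a_subset by auto
    then show ?case using insert by (simp add: Alg.finsum_insert)
  qed simp
qed

text \<open>
  Suppose all generators in direction \<open>j\<close> lie in \<open>P\<close>. Let \<open>J\<close> be the set of elements whose components
  of degree \<open>n\<close> with \<open>n j \<noteq> 0\<close> all lie in \<open>P\<close>. Then \<open>J\<close> contains \<open>1\<close> and is closed under multiplication
  by the generators of \<open>S\<close>, so \<open>J = S\<close> and \<open>P\<close> contains the ideal \<open>S\<^sub>+\<^sub>+\<close>.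
\<close>

lemma degree_one_outside:
  assumes P: "ideal P S" and not: "\<not> S_plus_plus S Sg \<subseteq> P"
  shows "\<exists>t\<in>T. dg t = j \<and> t \<notin> P"
proof (rule ccontr)
  assume "\<not> ?thesis"
  then have TP: "t \<in> P" if "t \<in> T" "dg t = j" for t using that by blast
  interpret P: ideal P S by (rule P)
  define J where "J = {s \<in> carrier S. \<forall>n. n j \<noteq> 0 \<longrightarrow> rcomp n s \<in> P}"
  have "stable_subgroup Sr (T \<union> \<Omega>) J"
  proof (rule Rg.stable_subgroupI)
    show "J \<subseteq> carrier Sr" by (auto simp: J_def)
    show "\<zero>\<^bsub>Sr\<^esub> \<in> J" by (simp add: J_def)
    fix x assume x: "x \<in> J"
    then have xc: "x \<in> carrier S" and xJ: "\<forall>n. n j \<noteq> 0 \<longrightarrow> rcomp n x \<in> P"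
      unfolding J_def by blast+
    show "\<ominus>\<^bsub>Sr\<^esub> x \<in> J" using x Rg.grading.hcomp_minus[of x] by (simp add: J_def)
    show "x \<oplus>\<^bsub>Sr\<^esub> y \<in> J" if "y \<in> J" for y
      using x that Rg.grading.hcomp_add[of x y] by (simp add: J_def)
    have step: "rcomp n (s \<otimes>\<^bsub>S\<^esub> x) \<in> P"
      if n: "n j \<noteq> 0" and s: "s \<in> Sg k" and sP: "s \<in> P \<or> k j = 0" for n s k
    proof (cases "k \<le> n")
      case True
      have eq: "rcomp n (s \<otimes>\<^bsub>S\<^esub> x) = s \<otimes>\<^bsub>S\<^esub> rcomp (n - k) x"
        using Rg.hcomp_smult[OF s Sg_closed[OF s], of x n] True xc by simp
      show ?thesis
        using sP
      proof
        assume "s \<in> P"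
        then show ?thesis unfolding eq by (intro P.I_r_closed rcomp_closed[OF xc])
      next
        assume "k j = 0"
        then have "(n - k) j \<noteq> 0" using n by simp
        then have "rcomp (n - k) x \<in> P" by (rule xJ[rule_format])
        then show ?thesis unfolding eq by (intro P.I_l_closed Sg_closed[OF s])
      qed
    next
      case False
      then show ?thesis using Rg.hcomp_smult[OF s Sg_closed[OF s], of x n] xc by simp
    qed
    fix s assume "s \<in> T \<union> \<Omega>"
    then have "\<exists>k. s \<in> Sg k \<and> (s \<in> P \<or> k j = 0)"
    proof
      assume s: "s \<in> T"
      then have "s \<in> Sg (unit_multi (dg s))" by (rule gg.T_gr)
      moreover have "s \<in> P \<or> unit_multi (dg s) j = 0"
        using TP[OF s] by (cases "dg s = j") (auto simp: unit_multi_def)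
      ultimately show ?thesis by blast
    next
      assume "s \<in> \<Omega>"
      then show ?thesis using scalars_gr by (intro exI[of _ 0]) auto
    qed
    then obtain k where k: "s \<in> Sg k" "s \<in> P \<or> k j = 0" by blast
    show "s \<odot>\<^bsub>Sr\<^esub> x \<in> J"
      using step[OF _ k] xc Sg_closed[OF k(1)] by (simp add: J_def)
  qed
  then have J: "stable_subgroup Sr (carrier S) J"
    using Rg.stable_subgroup_generate_ring[of "T \<union> \<Omega>" J] gg.T_closed scalars_closed generate by simp
  have "\<one>\<^bsub>S\<^esub> \<in> J"
  proof -
    have "rcomp n \<one>\<^bsub>S\<^esub> \<in> P" if "n j \<noteq> 0" for n
    proof -
      have "n \<noteq> 0" using that by auto
      then show ?thesis using Rg.grading.hcomp_homogeneous[OF Alg.one_gr, of n] by simp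
    qed
    then show ?thesis by (simp add: J_def)
  qed
  then have all: "s \<in> J" if "s \<in> carrier S" for s
    using Rg.stable_subgroupD(6)[OF J that] that by fastforce
  have "S_plus_plus S Sg \<subseteq> P"
  proof
    fix x assume "x \<in> S_plus_plus S Sg"
    then obtain f F where x: "x = (\<Oplus>\<^bsub>S\<^esub>n\<in>F. f n)" "finite F" "\<forall>n\<in>F. 1 \<le> n \<and> f n \<in> Sg n"
      unfolding S_plus_plus_def by blast
    show "x \<in> P"
      unfolding x(1)
    proof (rule ideal_finsum[OF P x(2)])
      fix n assume "n \<in> F"
      then have n: "1 \<le> n" "f n \<in> Sg n" using x(3) by auto
      have "1 \<le> n j" using n(1) by (simp add: le_fun_def)
      then have "n j \<noteq> 0" by simp
      then have "rcomp n (f n) \<in> P" using all[OF Sg_closed[OF n(2)]] by (simp add: J_def)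
      then show "f n \<in> P" using Rg.grading.hcomp_homogeneous[OF n(2), of n] by simp
    qed
  qed
  with not show False by simp
qed

text \<open>Products of degree-one elements outside the prime \<open>P\<close> stay outside \<open>P\<close>.\<close>

lemma homogeneous_outside:
  assumes P: "primeideal P S" and out: "\<And>j. \<exists>t\<in>T. dg t = j \<and> t \<notin> P"
  shows "\<exists>u\<in>Sg n. u \<notin> P"
proof (induction n rule: multi_induct)
  interpret P: primeideal P S by (rule P)
  case zero
  have "\<one>\<^bsub>S\<^esub> \<notin> P" using P.one_imp_carrier P.I_notcarr by auto
  then show ?case using Alg.one_gr by blast
next
  interpret P: primeideal P S by (rule P)
  case (plus n j)
  then obtain u where u: "u \<in> Sg n" "u \<notin> P" by blast
  obtain t where t: "t \<in> T" "dg t = j" "t \<notin> P" using out[of j] by blast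
  have tg: "t \<in> Sg (unit_multi j)" using gg.T_gr[OF t(1)] t(2) by simp
  have "u \<otimes>\<^bsub>S\<^esub> t \<in> Sg (n + unit_multi j)" by (rule Alg.mult_gr[OF u(1) tg])
  moreover have "u \<otimes>\<^bsub>S\<^esub> t \<notin> P"
    using P.I_prime[OF Sg_closed[OF u(1)] Sg_closed[OF tg]] u(2) t(3) by blast
  ultimately show ?case by blast
qed

lemma Proj_homogeneous_outside:
  assumes "P \<in> Proj S Sg"
  shows "\<exists>u\<in>Sg n. u \<notin> P"
proof (rule homogeneous_outside)
  show P: "primeideal P S" using assms by (simp add: Proj_def)
  have "\<not> S_plus_plus S Sg \<subseteq> P" using assms by (simp add: Proj_def)
  then show "\<exists>t\<in>T. dg t = j \<and> t \<notin> P" for j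
    by (intro degree_one_outside primeideal.axioms(1)[OF P])
qed

lemma Supp_iff:
  assumes Q: "submodule Q S M"
  shows "P \<in> Supp_plus_plus S Sg (quot_module M Q) \<longleftrightarrow>
    P \<in> Proj S Sg \<and> (\<exists>m\<in>carrier M. \<forall>u\<in>carrier S - P. u \<odot>\<^bsub>M\<^esub> m \<notin> Q)"
proof (cases "P \<in> Proj S Sg")
  case True
  then have prime: "primeideal P S" by (simp add: Proj_def)
  interpret P: primeideal P S by (rule prime)
  interpret q: module S "quot_module M Q" by (rule Md.quot_module_module[OF Q])
  have one: "\<one>\<^bsub>S\<^esub> \<notin> P" using P.one_imp_carrier P.I_notcarr by auto
  have "u \<odot>\<^bsub>quot_module M Q\<^esub> (Q +>\<^bsub>M\<^esub> m) = \<zero>\<^bsub>quot_module M Q\<^esub> \<longleftrightarrow> u \<odot>\<^bsub>M\<^esub> m \<in> Q"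
    if "u \<in> carrier S" "m \<in> carrier M" for u m
    using that Md.coset_eq_Q_iff[OF Q, of "u \<odot>\<^bsub>M\<^esub> m"]
    by (simp add: Md.quot_smult[OF Q] Md.quot_zero[OF Q])
  then have "(\<exists>c\<in>carrier (quot_module M Q). \<forall>u\<in>carrier S - P. u \<odot>\<^bsub>quot_module M Q\<^esub> c \<noteq> \<zero>\<^bsub>quot_module M Q\<^esub>) \<longleftrightarrow>
    (\<exists>m\<in>carrier M. \<forall>u\<in>carrier S - P. u \<odot>\<^bsub>M\<^esub> m \<notin> Q)"
    unfolding Md.quot_carrier[OF Q] by auto
  then show ?thesis
    using True q.localization_nonzero_iff[OF P.a_subset one] by (simp add: Supp_plus_plus_def)
next
  case False
  then show ?thesis by (simp add: Supp_plus_plus_def)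
qed

text \<open>
  The elements of \<open>M\<close> that die in the localization of \<open>M/Q\<close> at \<open>P\<close> form a subgroup, so an element dies
  as soon as its components do.
\<close>

lemma killed_from_homogeneous:
  assumes Q: "submodule Q S M" and P: "primeideal P S" and m: "m \<in> carrier M"
    and hom: "\<And>n. \<exists>u\<in>carrier S - P. u \<odot>\<^bsub>M\<^esub> Md.mcomp n m \<in> Q"
  shows "\<exists>u\<in>carrier S - P. u \<odot>\<^bsub>M\<^esub> m \<in> Q"
  using m
proof (induction m rule: Md.grading.hcomp_induct)
  interpret P: primeideal P S by (rule P)
  note st = Md.Q_stable[OF Q]
  case zero
  have "\<one>\<^bsub>S\<^esub> \<notin> P" using P.one_imp_carrier P.I_notcarr by auto
  then show ?case using Md.stable_subgroupD(2)[OF st] by (intro bexI[of _ "\<one>\<^bsub>S\<^esub>"]) auto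
next
  case (homogeneous n)
  show ?case by (rule hom)
next
  interpret P: primeideal P S by (rule P)
  note st = Md.Q_stable[OF Q]
  case (add y z)
  then obtain u v where uv: "u \<in> carrier S - P" "u \<odot>\<^bsub>M\<^esub> y \<in> Q" "v \<in> carrier S - P" "v \<odot>\<^bsub>M\<^esub> z \<in> Q"
    by blast
  then have c: "u \<in> carrier S" "v \<in> carrier S" "u \<notin> P" "v \<notin> P" by auto
  have "(u \<otimes>\<^bsub>S\<^esub> v) \<odot>\<^bsub>M\<^esub> (y \<oplus>\<^bsub>M\<^esub> z) = v \<odot>\<^bsub>M\<^esub> (u \<odot>\<^bsub>M\<^esub> y) \<oplus>\<^bsub>M\<^esub> u \<odot>\<^bsub>M\<^esub> (v \<odot>\<^bsub>M\<^esub> z)"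
    using c(1,2) add.hyps by (simp add: Md.smult_assoc1 Md.smult_r_distr Md.smult_comm[of u v y])
  also have "\<dots> \<in> Q"
    using Md.stable_subgroupD(3)[OF st] Md.stable_subgroupD(6)[OF st] uv c by simp
  finally have "(u \<otimes>\<^bsub>S\<^esub> v) \<odot>\<^bsub>M\<^esub> (y \<oplus>\<^bsub>M\<^esub> z) \<in> Q" .
  moreover have "u \<otimes>\<^bsub>S\<^esub> v \<in> carrier S - P" using P.I_prime[OF c(1,2)] c by blast
  ultimately show ?case by blast
qed

text \<open>
  A prime \<open>P\<close> in \<open>Proj S\<close> omits homogeneous elements of every degree. One of sufficiently large degree
  moves every component of \<open>M\<close> into \<open>Q\<close>, so the localization of \<open>M/Q\<close> at \<open>P\<close> is zero.
\<close>

lemma Supp_empty: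
  assumes Q: "submodule Q S M" and large: "for_all_large (\<lambda>n. Mg n \<subseteq> Q)"
  shows "Supp_plus_plus S Sg (quot_module M Q) = {}"
proof (rule ccontr)
  assume "Supp_plus_plus S Sg (quot_module M Q) \<noteq> {}"
  then obtain P where "P \<in> Supp_plus_plus S Sg (quot_module M Q)" by blast
  then obtain m where P: "P \<in> Proj S Sg" and m: "m \<in> carrier M" "\<forall>u\<in>carrier S - P. u \<odot>\<^bsub>M\<^esub> m \<notin> Q"
    unfolding Supp_iff[OF Q] by blast
  have prime: "primeideal P S" using P by (simp add: Proj_def)
  obtain N where N: "\<forall>n. (\<forall>i. N \<le> n i) \<longrightarrow> Mg n \<subseteq> Q" using large unfolding for_all_large_def by (rule exE)
  obtain u where u: "u \<in> Sg (\<lambda>_. N)" "u \<notin> P" using Proj_homogeneous_outside[OF P] by blast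
  have "\<exists>u\<in>carrier S - P. u \<odot>\<^bsub>M\<^esub> m \<in> Q"
  proof (rule killed_from_homogeneous[OF Q prime m(1)])
    fix n
    have "u \<odot>\<^bsub>M\<^esub> Md.mcomp n m \<in> Mg ((\<lambda>_. N) + n)"
      by (rule Md.smult_gr[OF u(1) Md.grading.hcomp_in_gr[OF m(1)]])
    moreover have "Mg ((\<lambda>_. N) + n) \<subseteq> Q" using N by (simp add: trans_le_add1)
    ultimately show "\<exists>u\<in>carrier S - P. u \<odot>\<^bsub>M\<^esub> Md.mcomp n m \<in> Q"
      using u Sg_closed[OF u(1)] by blast
  qed
  with m(2) show False by blast
qed

context
  fixes N
  assumes N: "homogeneous_submodule N" and not_large: "\<not> for_all_large (\<lambda>n. Mg n \<subseteq> N)"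
    and maximal: "\<And>N'. homogeneous_submodule N' \<Longrightarrow> N \<subseteq> N' \<Longrightarrow>
      \<not> for_all_large (\<lambda>n. Mg n \<subseteq> N') \<Longrightarrow> N' = N"
begin

lemma N_stable: "stable_subgroup M (carrier S) N"
  by (rule homogeneous_submoduleD(2)[OF N])

text \<open>
  The module \<open>M/N\<close> is nonzero in arbitrarily large degrees, but every proper graded quotient of it
  vanishes in large degrees. Hence a homogeneous element either is injective on \<open>M/N\<close> or kills it in
  large degrees. The elements that kill it in large degrees will turn out to form a prime of the
  support.
\<close>

definition eventual_annihilator :: "'s set" where
  "eventual_annihilator = {s \<in> carrier S. for_all_large (\<lambda>n. \<forall>m\<in>Mg n. s \<odot>\<^bsub>M\<^esub> m \<in> N)}"

lemma eventual_annihilator_ideal: "ideal eventual_annihilator S"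
proof (rule idealI)
  note D = Md.stable_subgroupD[OF N_stable]
  show "ring S" by (rule S_ring)
  show "subgroup eventual_annihilator (add_monoid S)"
  proof (rule Alg.add.subgroupI)
    show "eventual_annihilator \<subseteq> carrier S" by (auto simp: eventual_annihilator_def)
    have "\<zero>\<^bsub>S\<^esub> \<in> eventual_annihilator"
      using D(2) by (simp add: eventual_annihilator_def for_all_large_def)
    then show "eventual_annihilator \<noteq> {}" by blast
    fix a assume "a \<in> eventual_annihilator"
    then have a: "a \<in> carrier S" "for_all_large (\<lambda>n. \<forall>m\<in>Mg n. a \<odot>\<^bsub>M\<^esub> m \<in> N)"
      by (simp_all add: eventual_annihilator_def)
    have "for_all_large (\<lambda>n. \<forall>m\<in>Mg n. (\<ominus>\<^bsub>S\<^esub> a) \<odot>\<^bsub>M\<^esub> m \<in> N)"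
      by (rule for_all_large_mono[OF a(2)]) (use a(1) D(4) in \<open>simp add: Md.smult_l_minus\<close>)
    then show "\<ominus>\<^bsub>S\<^esub> a \<in> eventual_annihilator" using a(1) by (simp add: eventual_annihilator_def)
    fix b assume "b \<in> eventual_annihilator"
    then have b: "b \<in> carrier S" "for_all_large (\<lambda>n. \<forall>m\<in>Mg n. b \<odot>\<^bsub>M\<^esub> m \<in> N)"
      by (simp_all add: eventual_annihilator_def)
    have "for_all_large (\<lambda>n. \<forall>m\<in>Mg n. (a \<oplus>\<^bsub>S\<^esub> b) \<odot>\<^bsub>M\<^esub> m \<in> N)"
      by (rule for_all_large_mono[OF for_all_large_conj[OF a(2) b(2)]])
        (use a(1) b(1) D(3) in \<open>simp add: Md.smult_l_distr\<close>)
    then show "a \<oplus>\<^bsub>S\<^esub> b \<in> eventual_annihilator" using a(1) b(1) by (simp add: eventual_annihilator_def)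
  qed
  fix a x assume "a \<in> eventual_annihilator" and x: "x \<in> carrier S"
  then have a: "a \<in> carrier S" "for_all_large (\<lambda>n. \<forall>m\<in>Mg n. a \<odot>\<^bsub>M\<^esub> m \<in> N)"
    by (simp_all add: eventual_annihilator_def)
  have "for_all_large (\<lambda>n. \<forall>m\<in>Mg n. (x \<otimes>\<^bsub>S\<^esub> a) \<odot>\<^bsub>M\<^esub> m \<in> N)"
    by (rule for_all_large_mono[OF a(2)]) (use a(1) x D(6) in \<open>simp add: Md.smult_assoc1\<close>)
  then show "x \<otimes>\<^bsub>S\<^esub> a \<in> eventual_annihilator" using a(1) x by (simp add: eventual_annihilator_def)
  then show "a \<otimes>\<^bsub>S\<^esub> x \<in> eventual_annihilator" using a(1) x by (simp add: Alg.m_comm)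
qed

lemma rcomp_eventual_annihilator:
  assumes "s \<in> eventual_annihilator"
  shows "rcomp k s \<in> eventual_annihilator"
proof -
  from assms have s: "s \<in> carrier S" "for_all_large (\<lambda>n. \<forall>m\<in>Mg n. s \<odot>\<^bsub>M\<^esub> m \<in> N)"
    by (simp_all add: eventual_annihilator_def)
  have "for_all_large (\<lambda>n. \<forall>m\<in>Mg n. rcomp k s \<odot>\<^bsub>M\<^esub> m \<in> N)"
    using s(2)
  proof (rule for_all_large_mono)
    fix n assume a: "\<forall>m\<in>Mg n. s \<odot>\<^bsub>M\<^esub> m \<in> N"
    show "\<forall>m\<in>Mg n. rcomp k s \<odot>\<^bsub>M\<^esub> m \<in> N"
    proof
      fix m assume m: "m \<in> Mg n"
      show "rcomp k s \<odot>\<^bsub>M\<^esub> m \<in> N"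
        using homogeneous_submoduleD(3)[OF N a[rule_format, OF m], of "n + k"]
        unfolding hcomp_smult_homogeneous[OF s(1) m] .
    qed
  qed
  then show ?thesis using rcomp_closed[OF s(1)] by (simp add: eventual_annihilator_def)
qed

lemma homogeneous_ideal_eventual_annihilator: "homogeneous_ideal eventual_annihilator S Sg"
proof -
  let ?P = eventual_annihilator
  note P = eventual_annihilator_ideal
  interpret P: ideal ?P S by (rule P)
  have sub: "?P \<inter> (\<Union>n. Sg n) \<subseteq> carrier S" using P.a_subset by blast
  interpret I: ideal "Idl\<^bsub>S\<^esub> (?P \<inter> (\<Union>n. Sg n))" S by (rule Alg.genideal_ideal[OF sub])
  have "s \<in> Idl\<^bsub>S\<^esub> (?P \<inter> (\<Union>n. Sg n))" if s: "s \<in> ?P" for s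
  proof -
    have "s \<in> carrier Sr" using s P.a_subset by auto
    then show ?thesis
    proof (induction s rule: Rg.grading.hcomp_induct)
      case (homogeneous n)
      have "rcomp n s \<in> ?P \<inter> (\<Union>n. Sg n)"
        using rcomp_eventual_annihilator[OF s] rcomp_gr[of s n] s P.a_subset by blast
      then show ?case using Alg.genideal_self[OF sub] by blast
    qed simp_all
  qed
  moreover have "Idl\<^bsub>S\<^esub> (?P \<inter> (\<Union>n. Sg n)) \<subseteq> ?P" by (rule Alg.genideal_minimal[OF P]) blast
  ultimately show ?thesis unfolding homogeneous_ideal_def using P by blast
qed

text \<open>
  The submodule \<open>(N : s)\<close> is homogeneous and contains \<open>N\<close>. Since \<open>s\<close> does not eventually annihilate
  \<open>M/N\<close>, maximality gives \<open>(N : s) = N\<close>.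
\<close>

lemma homogeneous_regular:
  assumes s: "s \<in> Sg k" "s \<notin> eventual_annihilator" and m: "m \<in> carrier M" "s \<odot>\<^bsub>M\<^esub> m \<in> N"
  shows "m \<in> N"
proof -
  have sc: "s \<in> carrier S" by (rule Sg_closed[OF s(1)])
  note wh = Md.stable_subgroup_carrier[of "carrier S", OF order_refl]
  let ?K = "colon_in M N s (carrier M)"
  have "Md.mcomp n y \<in> ?K" if "y \<in> ?K" for y n
  proof -
    have y: "y \<in> carrier M" "s \<odot>\<^bsub>M\<^esub> y \<in> N" using that by (auto simp: colon_in_def)
    have "s \<odot>\<^bsub>M\<^esub> Md.mcomp n y \<in> N"
      using homogeneous_submoduleD(3)[OF N y(2), of "n + k"]
      unfolding Md.hcomp_smult_shift[OF s(1) sc y(1)] .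
    then show ?thesis
      using Md.grading.gr_closed[OF Md.grading.hcomp_in_gr[OF y(1)]] by (simp add: colon_in_def)
  qed
  then have K: "homogeneous_submodule ?K"
    using Md.stable_subgroup_colon_in[OF N_stable wh sc order_refl]
    by (simp add: homogeneous_submodule_def Md.submodule_iff_stable)
  have NK: "N \<subseteq> ?K"
    using Md.stable_subgroupD(1,6)[OF N_stable] sc by (auto simp: colon_in_def)
  have "\<not> for_all_large (\<lambda>n. Mg n \<subseteq> ?K)"
  proof
    assume "for_all_large (\<lambda>n. Mg n \<subseteq> ?K)"
    then have "for_all_large (\<lambda>n. \<forall>m\<in>Mg n. s \<odot>\<^bsub>M\<^esub> m \<in> N)"
      by (rule for_all_large_mono) (auto simp: colon_in_def)
    then show False using s(2) sc by (simp add: eventual_annihilator_def)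
  qed
  from maximal[OF K NK this] m show ?thesis by (auto simp: colon_in_def)
qed

lemma homogeneous_prime:
  assumes a: "a \<in> Sg k" "a \<notin> eventual_annihilator" and b: "b \<in> carrier S"
    and ab: "a \<otimes>\<^bsub>S\<^esub> b \<in> eventual_annihilator"
  shows "b \<in> eventual_annihilator"
proof -
  have ac: "a \<in> carrier S" by (rule Sg_closed[OF a(1)])
  have "for_all_large (\<lambda>n. \<forall>m\<in>Mg n. (a \<otimes>\<^bsub>S\<^esub> b) \<odot>\<^bsub>M\<^esub> m \<in> N)"
    using ab by (simp add: eventual_annihilator_def)
  then have "for_all_large (\<lambda>n. \<forall>m\<in>Mg n. b \<odot>\<^bsub>M\<^esub> m \<in> N)"
  proof (rule for_all_large_mono)
    fix n assume h: "\<forall>m\<in>Mg n. (a \<otimes>\<^bsub>S\<^esub> b) \<odot>\<^bsub>M\<^esub> m \<in> N"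
    show "\<forall>m\<in>Mg n. b \<odot>\<^bsub>M\<^esub> m \<in> N"
    proof
      fix m assume m: "m \<in> Mg n"
      show "b \<odot>\<^bsub>M\<^esub> m \<in> N"
        by (rule homogeneous_regular[OF a]) (use h m ac b in \<open>simp_all add: Md.smult_assoc1[symmetric]\<close>)
    qed
  qed
  then show ?thesis using b by (simp add: eventual_annihilator_def)
qed

lemma mem_eventual_annihilatorI:
  assumes "s \<in> carrier S" "\<And>k. rcomp k s \<in> eventual_annihilator"
  shows "s \<in> eventual_annihilator"
proof -
  interpret P: ideal eventual_annihilator S by (rule eventual_annihilator_ideal)
  have "s \<in> carrier Sr" using assms(1) by simp
  then show ?thesis
    by (induction s rule: Rg.grading.hcomp_induct) (use assms(2) in simp_all)
qed

lemma one_not_eventual_annihilator: "\<one>\<^bsub>S\<^esub> \<notin> eventual_annihilator"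
proof
  assume "\<one>\<^bsub>S\<^esub> \<in> eventual_annihilator"
  then have "for_all_large (\<lambda>n. \<forall>m\<in>Mg n. \<one>\<^bsub>S\<^esub> \<odot>\<^bsub>M\<^esub> m \<in> N)" by (simp add: eventual_annihilator_def)
  then have "for_all_large (\<lambda>n. Mg n \<subseteq> N)" by (rule for_all_large_mono) auto
  with not_large show False by simp
qed

text \<open>
  For homogeneous factors primality is injectivity. In general, let \<open>p\<close> and \<open>q\<close> be degrees in which
  the components of \<open>a\<close> and \<open>b\<close> lie outside the ideal, chosen such that \<open>p + q\<close> is not the sum of
  another such pair. Then the component of \<open>a b\<close> of degree \<open>p + q\<close> is congruent to \<open>a\<^sub>p b\<^sub>q\<close>, which is
  outside the ideal.
\<close>

lemma eventual_annihilator_prime: "primeideal eventual_annihilator S"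
proof (rule primeidealI[OF eventual_annihilator_ideal S_cring])
  let ?P = eventual_annihilator
  interpret P: ideal ?P S by (rule eventual_annihilator_ideal)
  show "carrier S \<noteq> ?P" using one_not_eventual_annihilator by auto
  fix a b assume a: "a \<in> carrier S" and b: "b \<in> carrier S" and ab: "a \<otimes>\<^bsub>S\<^esub> b \<in> ?P"
  show "a \<in> ?P \<or> b \<in> ?P"
  proof (rule ccontr)
    assume "\<not> ?thesis"
    then have out: "a \<notin> ?P" "b \<notin> ?P" by auto
    define K where "K s = {k. rcomp k s \<notin> ?P}" for s
    have finK: "finite (K s)" if "s \<in> carrier S" for s
    proof -
      have "K s \<subseteq> {k. rcomp k s \<noteq> \<zero>\<^bsub>Sr\<^esub>}" by (auto simp: K_def)
      then show ?thesis using Rg.grading.finite_hcomp[of s] that finite_subset by fastforce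
    qed
    have neK: "K s \<noteq> {}" if "s \<in> carrier S" "s \<notin> ?P" for s
      using mem_eventual_annihilatorI[OF that(1)] that(2) by (auto simp: K_def)
    obtain p q where pq: "p \<in> K a" "q \<in> K b" and
      uniq: "\<And>p' q'. p' \<in> K a \<Longrightarrow> q' \<in> K b \<Longrightarrow> p' + q' = p + q \<Longrightarrow> p' = p"
      by (rule unique_sum[OF finK[OF a] neK[OF a out(1)] finK[OF b] neK[OF b out(2)]]) (rule that)
    let ?ap = "rcomp p a"
    define r where "r = q + p"
    have apc: "?ap \<in> carrier S" "?ap \<in> Sg p" by (rule rcomp_closed[OF a], rule rcomp_gr[OF a])
    \<comment> \<open>splitting off the component of degree \<open>p\<close>; the rest contributes only elements of the ideal in degree \<open>r\<close>\<close>
    define a' where "a' = a \<ominus>\<^bsub>S\<^esub> ?ap"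
    have a': "a' \<in> carrier S" 
      unfolding a'_def a_minus_def by (intro Alg.a_closed Alg.a_inv_closed a apc(1))
    have sum: "a = ?ap \<oplus>\<^bsub>S\<^esub> a'"
    proof -
      have "?ap \<oplus>\<^bsub>Sr\<^esub> (a \<ominus>\<^bsub>Sr\<^esub> ?ap) = a"
        by (rule Rg.diff_add_cancel_right) (simp_all only: Sr_simps a apc(1))
      then show ?thesis unfolding a'_def a_minus_def Sr_simps by (rule sym)
    qed
    have comp_a': "rcomp i a' = (if i = p then \<zero>\<^bsub>S\<^esub> else rcomp i a)" for i
    proof -
      have "rcomp i a' = rcomp i a \<ominus>\<^bsub>S\<^esub> rcomp i ?ap"
        unfolding a'_def a_minus_def
        using Rg.grading.hcomp_add[of a "\<ominus>\<^bsub>S\<^esub> ?ap" i] Rg.grading.hcomp_minus[of ?ap i] a apc by simp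
      then show ?thesis
        using Rg.grading.hcomp_homogeneous[OF apc(2), of i] a rcomp_closed[OF a]
        by (simp add: a_minus_def Alg.r_neg)
    qed
    have rest: "rcomp r (a' \<otimes>\<^bsub>S\<^esub> b) \<in> ?P"
    proof -
      have "a' \<in> carrier Sr" using a' by simp
      then show ?thesis
      proof (induction a' rule: Rg.grading.hcomp_induct)
        case zero
        then show ?case using b Rg.grading.hcomp_zero[of r] by simp
      next
        case (homogeneous i)
        show ?case
        proof (cases "i = p \<or> \<not> i \<le> r")
          case True
          then show ?thesis
          proof
            assume "i = p"
            then show ?thesis using comp_a'[of i] b Rg.grading.hcomp_zero[of r] by simp
          next
            assume "\<not> i \<le> r"
            have "rcomp r (rcomp i a' \<otimes>\<^bsub>S\<^esub> b) = \<zero>\<^bsub>S\<^esub>"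
              using Rg.hcomp_smult[OF rcomp_gr[OF a'] rcomp_closed[OF a'], of b r i] b
                \<open>\<not> i \<le> r\<close> by simp
            then show ?thesis by (simp only: P.zero_closed)
          qed
        next
          case False
          then have i: "i \<noteq> p" "i \<le> r" by auto
          have ir: "i + (r - i) = p + q" using i(2) by (auto simp: r_def le_fun_def fun_eq_iff)
          have eq: "rcomp r (rcomp i a' \<otimes>\<^bsub>S\<^esub> b) = rcomp i a' \<otimes>\<^bsub>S\<^esub> rcomp (r - i) b"
            using Rg.hcomp_smult[OF rcomp_gr[OF a'] rcomp_closed[OF a'], of b r i] b i(2) by simp
          have "rcomp i a \<in> ?P \<or> rcomp (r - i) b \<in> ?P"
            using uniq[of i "r - i", OF _ _ ir] i(1) unfolding K_def by blast
          then have "rcomp i a' \<in> ?P \<or> rcomp (r - i) b \<in> ?P"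
            unfolding comp_a'[of i] using i(1) by (simp only: if_False)
          then show ?thesis
            unfolding eq
          proof
            assume "rcomp i a' \<in> ?P"
            then show "rcomp i a' \<otimes>\<^bsub>S\<^esub> rcomp (r - i) b \<in> ?P" by (rule P.I_r_closed[OF _ rcomp_closed[OF b]])
          next
            assume "rcomp (r - i) b \<in> ?P"
            then show "rcomp i a' \<otimes>\<^bsub>S\<^esub> rcomp (r - i) b \<in> ?P" by (rule P.I_l_closed[OF _ rcomp_closed[OF a']])
          qed
        qed
      next
        case (add y z)
        then show ?case
          using b Rg.grading.hcomp_add[of "y \<otimes>\<^bsub>S\<^esub> b" "z \<otimes>\<^bsub>S\<^esub> b" r] by (simp add: Alg.l_distr)
      qed
    qed
    have "rcomp r (a \<otimes>\<^bsub>S\<^esub> b) = rcomp r (?ap \<otimes>\<^bsub>S\<^esub> b) \<oplus>\<^bsub>S\<^esub> rcomp r (a' \<otimes>\<^bsub>S\<^esub> b)"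
      using Rg.grading.hcomp_add[of "?ap \<otimes>\<^bsub>S\<^esub> b" "a' \<otimes>\<^bsub>S\<^esub> b" r] apc a' b
      by (subst sum) (simp add: Alg.l_distr)
    moreover have "rcomp r (?ap \<otimes>\<^bsub>S\<^esub> b) = ?ap \<otimes>\<^bsub>S\<^esub> rcomp q b"
      unfolding r_def using Rg.hcomp_smult_shift[OF apc(2,1), of b q] b by simp
    ultimately have "?ap \<otimes>\<^bsub>S\<^esub> rcomp q b = rcomp r (a \<otimes>\<^bsub>S\<^esub> b) \<ominus>\<^bsub>S\<^esub> rcomp r (a' \<otimes>\<^bsub>S\<^esub> b)"
      using apc rcomp_closed[OF b] rcomp_closed[of "a' \<otimes>\<^bsub>S\<^esub> b"] a' b
      by (simp add: a_minus_def Alg.a_assoc Alg.r_neg)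
    also have "\<dots> \<in> ?P"
      unfolding a_minus_def using rcomp_eventual_annihilator[OF ab] rest by simp
    finally have "rcomp q b \<in> ?P"
      using homogeneous_prime[OF apc(2) _ rcomp_closed[OF b]] pq(1) by (simp add: K_def)
    then show False using pq(2) by (simp add: K_def)
  qed
qed

text \<open>
  Otherwise let \<open>N'\<close> consist of the elements that all generators in direction \<open>j\<close> move into \<open>N\<close>. It
  contains \<open>M\<close> in large degrees, and truncation shows that \<open>N'\<close> and \<open>N\<close> agree far out in direction \<open>j\<close>.
  So \<open>N\<close> would contain \<open>M\<close> in large degrees.
\<close>

lemma eventual_annihilator_degree_one: "\<exists>t\<in>T. dg t = j \<and> t \<notin> eventual_annihilator"
proof (rule ccontr)
  assume "\<not> ?thesis"
  then have TP: "t \<in> eventual_annihilator" if "t \<in> T" "dg t = j" for t using that by blast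
  let ?T = "{t \<in> T. dg t = j}"
  define N' where "N' = {m \<in> carrier M. \<forall>t\<in>?T. t \<odot>\<^bsub>M\<^esub> m \<in> N}"
  note D = Md.stable_subgroupD[OF N_stable]
  have Tc: "t \<in> carrier S" if "t \<in> ?T" for t using that gg.T_closed by blast
  have st: "stable_subgroup M (carrier S) N'"
  proof (rule Md.stable_subgroupI)
    show "s \<odot>\<^bsub>M\<^esub> x \<in> N'" if "s \<in> carrier S" "x \<in> N'" for s x
      using that D(6) Tc by (auto simp: N'_def Md.smult_comm[of _ s x])
  qed (use D Tc in \<open>auto simp: N'_def Md.smult_r_distr Md.smult_r_minus\<close>)
  have "Md.mcomp n y \<in> N'" if y: "y \<in> N'" for y n
  proof -
    have yc: "y \<in> carrier M" using y by (simp add: N'_def)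
    have "t \<odot>\<^bsub>M\<^esub> Md.mcomp n y \<in> N" if t: "t \<in> ?T" for t
    proof -
      have tg: "t \<in> Sg (unit_multi (dg t))" using t gg.T_gr by blast
      have "t \<odot>\<^bsub>M\<^esub> y \<in> N" using y t by (simp add: N'_def)
      from homogeneous_submoduleD(3)[OF N this, of "n + unit_multi (dg t)"] show ?thesis
        unfolding Md.hcomp_smult_shift[OF tg Tc[OF t] yc] .
    qed
    then show ?thesis
      using Md.grading.gr_closed[OF Md.grading.hcomp_in_gr[OF yc]] by (simp add: N'_def)
  qed
  then have N': "homogeneous_submodule N'"
    using st by (simp add: homogeneous_submodule_def Md.submodule_iff_stable)
  have sub: "N \<subseteq> N'" using D(1,6) Tc by (auto simp: N'_def)
  have finT: "finite ?T" using gg.T_finite by simp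
  have "for_all_large (\<lambda>n. \<forall>t\<in>?T. \<forall>m\<in>Mg n. t \<odot>\<^bsub>M\<^esub> m \<in> N)"
    by (rule for_all_large_finite[OF finT]) (use TP in \<open>simp add: eventual_annihilator_def\<close>)
  then have largeN': "for_all_large (\<lambda>n. Mg n \<subseteq> N')"
    by (rule for_all_large_mono) (auto simp: N'_def)
  have le: "degree_part N \<le> degree_part N'" using sub by (auto simp: le_fun_def degree_part_def)
  have "\<exists>k. \<forall>n. k < n j \<longrightarrow> degree_part N' n \<subseteq> degree_part N n"
  proof (rule gg.truncation[OF gg.family_acc_whole degree_part_graded[OF N] degree_part_graded[OF N'] le])
    fix t n m assume t: "t \<in> T" "dg t = j" and m: "m \<in> degree_part N' n"
    have "t \<odot>\<^bsub>M\<^esub> m \<in> degree_part N' (n + unit_multi (dg t))"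
      by (rule gg.graded_familyD(3)[OF degree_part_graded[OF N'] t(1) m])
    moreover have "t \<odot>\<^bsub>M\<^esub> m \<in> N" using m t by (simp add: degree_part_def N'_def)
    ultimately show "t \<odot>\<^bsub>M\<^esub> m \<in> degree_part N (n + unit_multi j)"
      unfolding t(2) degree_part_def by blast
  qed
  then obtain k where k: "\<forall>n. k < n j \<longrightarrow> degree_part N' n \<subseteq> degree_part N n" by (rule exE)
  have "for_all_large (\<lambda>n. k < n j)"
    unfolding for_all_large_def by (rule exI[of _ "Suc k"]) (simp add: Suc_le_eq)
  from for_all_large_conj[OF largeN' this] have "for_all_large (\<lambda>n. Mg n \<subseteq> N)"
  proof (rule for_all_large_mono)
    fix n assume n: "Mg n \<subseteq> N' \<and> k < n j"
    then have "degree_part N' n \<subseteq> degree_part N n" using k by simp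
    then show "Mg n \<subseteq> N" using n unfolding degree_part_def by blast
  qed
  with not_large show False by simp
qed

lemma eventual_annihilator_Proj: "eventual_annihilator \<in> Proj S Sg"
proof -
  obtain u where u: "u \<in> Sg 1" "u \<notin> eventual_annihilator"
    using homogeneous_outside[OF eventual_annihilator_prime eventual_annihilator_degree_one] by blast
  have "u = (\<Oplus>\<^bsub>S\<^esub>n\<in>{1}. (\<lambda>_. u) n)"
    using Sg_closed[OF u(1)] by simp
  then have "u \<in> S_plus_plus S Sg"
    unfolding S_plus_plus_def using u(1)
    by (intro CollectI exI[of _ "\<lambda>_. u"] exI[of _ "{1}"] conjI) auto
  then show ?thesis
    using u(2) eventual_annihilator_prime homogeneous_ideal_eventual_annihilator by (auto simp: Proj_def)
qed

lemma eventual_annihilator_support: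
  "\<exists>m\<in>carrier M. \<forall>u\<in>carrier S - eventual_annihilator. u \<odot>\<^bsub>M\<^esub> m \<notin> N"
proof -
  have "\<exists>n. \<not> Mg n \<subseteq> N" using not_large unfolding for_all_large_def by blast
  then obtain n m where m: "m \<in> Mg n" "m \<notin> N" by blast
  have mc: "m \<in> carrier M" using m(1) by simp
  have "u \<odot>\<^bsub>M\<^esub> m \<notin> N" if u: "u \<in> carrier S - eventual_annihilator" for u
  proof
    assume um: "u \<odot>\<^bsub>M\<^esub> m \<in> N"
    obtain k where k: "rcomp k u \<notin> eventual_annihilator" using mem_eventual_annihilatorI u by blast
    have uc: "u \<in> carrier S" using u by blast
    have "rcomp k u \<odot>\<^bsub>M\<^esub> m \<in> N"
      using homogeneous_submoduleD(3)[OF N um, of "n + k"] unfolding hcomp_smult_homogeneous[OF uc m(1)] .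
    then have "m \<in> N" by (rule homogeneous_regular[OF rcomp_gr[OF uc] k mc])
    then show False using m(2) by simp
  qed
  then show ?thesis using mc by blast
qed

end

text \<open>
  By the ascending chain condition there is a homogeneous submodule \<open>N\<close> above \<open>Q\<close> that is maximal among
  those not containing \<open>M\<close> in large degrees; its eventual annihilator is a prime of the support.
\<close>

theorem Supp_nonempty:
  assumes Q: "homogeneous_submodule Q" and not_large: "\<not> for_all_large (\<lambda>n. Mg n \<subseteq> Q)"
  shows "Supp_plus_plus S Sg (quot_module M Q) \<noteq> {}"
proof -
  let ?\<C> = "{N. homogeneous_submodule N \<and> Q \<subseteq> N \<and> \<not> for_all_large (\<lambda>n. Mg n \<subseteq> N)}"
  have C: "?\<C> \<subseteq> stable_interval M (\<Omega> \<union> T) {\<zero>\<^bsub>M\<^esub>} (carrier M)"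
  proof
    fix N assume "N \<in> ?\<C>"
    then have st: "stable_subgroup M (carrier S) N" using homogeneous_submoduleD(2) by blast
    then show "N \<in> stable_interval M (\<Omega> \<union> T) {\<zero>\<^bsub>M\<^esub>} (carrier M)"
      using Md.stable_subgroup_subset[OF st gg.\<Omega>T_closed] Md.stable_subgroupD(1,2)[OF st]
      by (simp add: stable_interval_def)
  qed
  have "Q \<in> ?\<C>" using Q not_large by simp
  then obtain N where N: "N \<in> ?\<C>" and max: "\<And>N'. N' \<in> ?\<C> \<Longrightarrow> N \<subseteq> N' \<Longrightarrow> N' = N"
    by (rule stable_acc_maximal[OF gg.noetherian C]) (rule that)
  from N have h: "homogeneous_submodule N" "\<not> for_all_large (\<lambda>n. Mg n \<subseteq> N)" and QN: "Q \<subseteq> N" by auto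
  have max': "N' = N" if "homogeneous_submodule N'" "N \<subseteq> N'" "\<not> for_all_large (\<lambda>n. Mg n \<subseteq> N')" for N'
    using max[of N'] that QN by blast
  note ctx = h max'
  have "\<exists>m\<in>carrier M. \<forall>u\<in>carrier S - eventual_annihilator N. u \<odot>\<^bsub>M\<^esub> m \<notin> N"
    by (rule eventual_annihilator_support[OF ctx])
  then have "\<exists>m\<in>carrier M. \<forall>u\<in>carrier S - eventual_annihilator N. u \<odot>\<^bsub>M\<^esub> m \<notin> Q" using QN by blast
  then have "eventual_annihilator N \<in> Supp_plus_plus S Sg (quot_module M Q)"
    using Supp_iff[OF homogeneous_submoduleD(1)[OF Q]] eventual_annihilator_Proj[OF ctx] by blast
  then show ?thesis by blast
qed

text \<open>
  Take a homogeneous \<open>b\<close> in \<open>P'\<close> outside \<open>P\<close> and a homogeneous \<open>m\<close> whose annihilator in \<open>M/Q\<close> lies in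
  \<open>P\<close>. The submodules generated by \<open>b\<^sup>i m\<close> strictly descend in every degree where \<open>P'\<close> omits a
  homogeneous element: if \<open>b\<^sup>i u m\<close> with \<open>u \<notin> P'\<close> were a multiple \<open>b\<^sup>i\<^sup>+\<^sup>1 s m\<close> modulo \<open>Q\<close>, then
  \<open>u - b s \<in> P\<close> and so \<open>u \<in> P'\<close>. Hence the lengths of the components of \<open>M/Q\<close> would be unbounded.
\<close>

lemma Supp_no_chain:
  assumes Q: "homogeneous_submodule Q"
    and bounded: "for_all_large (\<lambda>n. gg.quotient_length (degree_part Q) Mg n = c)"
    and P: "P \<in> Supp_plus_plus S Sg (quot_module M Q)" and P': "P' \<in> Proj S Sg"
  shows "\<not> P \<subset> P'"
proof
  assume PP': "P \<subset> P'"
  note sub = homogeneous_submoduleD(1)[OF Q] and stQ = homogeneous_submoduleD(2)[OF Q]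
  have PProj: "P \<in> Proj S Sg" using P by (simp add: Supp_plus_plus_def)
  have primes: "primeideal P S" "primeideal P' S" and hom': "homogeneous_ideal P' S Sg"
    using PProj P' by (auto simp: Proj_def)
  interpret P: primeideal P S by (rule primes(1))
  interpret P': primeideal P' S by (rule primes(2))
  have "\<not> P' \<inter> (\<Union>n. Sg n) \<subseteq> P"
  proof
    assume "P' \<inter> (\<Union>n. Sg n) \<subseteq> P"
    from Alg.genideal_minimal[OF P.ideal_axioms this] have "P' \<subseteq> P"
      using hom' by (simp add: homogeneous_ideal_def)
    with PP' show False by blast
  qed
  then obtain b h where b: "b \<in> P'" "b \<in> Sg h" "b \<notin> P" by blast
  have bc: "b \<in> carrier S" by (rule Sg_closed[OF b(2)])
  obtain m0 where m0: "m0 \<in> carrier M" "\<forall>u\<in>carrier S - P. u \<odot>\<^bsub>M\<^esub> m0 \<notin> Q"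
    using P unfolding Supp_iff[OF sub] by blast
  have "\<exists>g. \<forall>u\<in>carrier S - P. u \<odot>\<^bsub>M\<^esub> Md.mcomp g m0 \<notin> Q"
    using killed_from_homogeneous[OF sub primes(1) m0(1)] m0(2) by blast
  then obtain g where g: "\<forall>u\<in>carrier S - P. u \<odot>\<^bsub>M\<^esub> Md.mcomp g m0 \<notin> Q" by (rule exE)
  define m where "m = Md.mcomp g m0"
  have m: "m \<in> Mg g" unfolding m_def by (rule Md.grading.hcomp_in_gr[OF m0(1)])
  then have mc: "m \<in> carrier M" by simp
  have ann: "s \<in> P" if "s \<in> carrier S" "s \<odot>\<^bsub>M\<^esub> m \<in> Q" for s
    using g that unfolding m_def by blast
  obtain z where z: "\<forall>n. (\<forall>i. z \<le> n i) \<longrightarrow> gg.quotient_length (degree_part Q) Mg n = c"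
    using bounded unfolding for_all_large_def by (rule exE)
  \<comment> \<open>one more than the length that is available\<close>
  define r where "r = Suc (nat c)"
  define hm :: "nat \<Rightarrow> 'd multi" where "hm i = (\<lambda>x. i * h x)" for i
  have hm_Suc: "h + hm i = hm (Suc i)" for i by (auto simp: hm_def fun_eq_iff)
  have hm_add: "hm i + hm j = hm (i + j)" for i j by (auto simp: hm_def fun_eq_iff algebra_simps)
  let ?z = "\<lambda>_. z"
  \<comment> \<open>the summand \<open>?z\<close> moves the degree into the range where the length is \<open>c\<close>\<close>
  define n where "n = hm r + ?z + g"
  have bpow: "b [^]\<^bsub>S\<^esub> i \<in> Sg (hm i)" "b [^]\<^bsub>S\<^esub> i \<notin> P" for i :: nat
  proof (induction i)
    case 0
    {
      case 1
      have "hm 0 = 0" by (simp add: hm_def fun_eq_iff)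
      then show ?case using Alg.one_gr by (simp only: Alg.nat_pow_0)
    next
      case 2
      show ?case using P.one_imp_carrier P.I_notcarr by auto
    }
  next
    case (Suc i)
    {
      case 1
      have "b [^]\<^bsub>S\<^esub> i \<otimes>\<^bsub>S\<^esub> b \<in> Sg (hm i + h)" by (rule Alg.mult_gr[OF Suc(1) b(2)])
      then show ?case using hm_Suc[of i] by (simp only: add.commute[of "hm i"] Alg.nat_pow_Suc)
    next
      case 2
      show ?case using P.I_prime[of "b [^]\<^bsub>S\<^esub> i" b] Suc(2) b(3) bc by auto
    }
  qed
  define orbit where "orbit d = (\<lambda>s. s \<odot>\<^bsub>M\<^esub> m) ` Sg d" for d
  have orbit: "stable_subgroup M \<Omega> (orbit d)" for d
  proof (rule Md.stable_subgroupI)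
    show "orbit d \<subseteq> carrier M" using mc Sg_closed by (auto simp: orbit_def)
    show "\<zero>\<^bsub>M\<^esub> \<in> orbit d" unfolding orbit_def using mc by (intro image_eqI[of _ _ "\<zero>\<^bsub>S\<^esub>"]) simp_all
    fix x assume "x \<in> orbit d"
    then obtain s where s: "s \<in> Sg d" "x = s \<odot>\<^bsub>M\<^esub> m" by (auto simp: orbit_def)
    note sc = Sg_closed[OF s(1)]
    show "\<ominus>\<^bsub>M\<^esub> x \<in> orbit d"
      unfolding orbit_def using s mc sc by (intro image_eqI[of _ _ "\<ominus>\<^bsub>S\<^esub> s"]) (simp_all add: Md.smult_l_minus)
    show "a \<odot>\<^bsub>M\<^esub> x \<in> orbit d" if "a \<in> \<Omega>" for a
    proof -
      have a: "a \<in> carrier S" "a \<in> Sg 0" using that scalars_closed scalars_gr by auto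
      have "a \<otimes>\<^bsub>S\<^esub> s \<in> Sg d" using Alg.mult_gr[OF a(2) s(1)] by simp
      then show ?thesis
        unfolding orbit_def using s mc sc a by (intro image_eqI[of _ _ "a \<otimes>\<^bsub>S\<^esub> s"]) (simp_all add: Md.smult_assoc1)
    qed
    fix y assume "y \<in> orbit d"
    then obtain s' where s': "s' \<in> Sg d" "y = s' \<odot>\<^bsub>M\<^esub> m" by (auto simp: orbit_def)
    show "x \<oplus>\<^bsub>M\<^esub> y \<in> orbit d"
      unfolding orbit_def using s s' mc sc Sg_closed[OF s'(1)]
      by (intro image_eqI[of _ _ "s \<oplus>\<^bsub>S\<^esub> s'"]) (simp_all add: Md.smult_l_distr)
  qed
  let ?Qn = "degree_part Q n"
  have Qn: "stable_subgroup M \<Omega> ?Qn" by (rule gg.graded_familyD(1)[OF degree_part_graded[OF Q]])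
  \<comment> \<open>the chain \<open>b\<^sup>r\<^sup>-\<^sup>i S m + Q\<close> in degree \<open>n\<close>, ascending in \<open>i\<close>\<close>
  define V where "V i = plus_multiple M ?Qn (b [^]\<^bsub>S\<^esub> (r - i)) (orbit (hm i + ?z))" for i
  have V_interval: "V i \<in> stable_interval M \<Omega> ?Qn (Mg n)" if i: "i \<le> r" for i
  proof -
    have pc: "b [^]\<^bsub>S\<^esub> (r - i) \<in> carrier S" using bc by simp
    have "b [^]\<^bsub>S\<^esub> (r - i) \<odot>\<^bsub>M\<^esub> x \<in> Mg n" if "x \<in> orbit (hm i + ?z)" for x
    proof -
      obtain s where s: "s \<in> Sg (hm i + ?z)" "x = s \<odot>\<^bsub>M\<^esub> m" using \<open>x \<in> _\<close> by (auto simp: orbit_def)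
      have "b [^]\<^bsub>S\<^esub> (r - i) \<odot>\<^bsub>M\<^esub> x \<in> Mg (hm (r - i) + ((hm i + ?z) + g))"
        unfolding s(2) by (intro Md.smult_gr bpow s(1) m)
      moreover have "hm (r - i) + ((hm i + ?z) + g) = n"
        unfolding n_def add.assoc[symmetric] hm_add using i by simp
      ultimately show ?thesis by (simp only:)
    qed
    then have "V i \<subseteq> Mg n"
      unfolding V_def by (intro Md.plus_multiple_subset[OF Mg_stable]) (auto simp: degree_part_def)
    then show ?thesis
      using Md.stable_subgroup_plus_multiple[OF Qn orbit pc scalars_closed]
        Md.subset_plus_multiple[OF Qn orbit pc]
      unfolding stable_interval_def V_def by blast
  qed
  have V_strict: "V i \<subset> V (Suc i)" if i: "i < r" for i
  proof
    let ?p = "b [^]\<^bsub>S\<^esub> (r - Suc i)"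
    have pc: "?p \<in> carrier S" using bc by simp
    have ri: "r - i = Suc (r - Suc i)" using i by simp
    have pb: "b [^]\<^bsub>S\<^esub> (r - i) = ?p \<otimes>\<^bsub>S\<^esub> b" unfolding ri by simp
    show "V i \<subseteq> V (Suc i)"
    proof
      fix y assume "y \<in> V i"
      then obtain q x where qx: "q \<in> ?Qn" "x \<in> orbit (hm i + ?z)" "y = q \<oplus>\<^bsub>M\<^esub> b [^]\<^bsub>S\<^esub> (r - i) \<odot>\<^bsub>M\<^esub> x"
        unfolding V_def by (rule Md.plus_multipleE)
      from qx(2) obtain s where s: "s \<in> Sg (hm i + ?z)" "x = s \<odot>\<^bsub>M\<^esub> m" by (auto simp: orbit_def)
      note sc = Sg_closed[OF s(1)]
      have "b [^]\<^bsub>S\<^esub> (r - i) \<odot>\<^bsub>M\<^esub> x = ?p \<odot>\<^bsub>M\<^esub> ((b \<otimes>\<^bsub>S\<^esub> s) \<odot>\<^bsub>M\<^esub> m)"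
        unfolding pb s(2) using pc bc sc mc by (simp add: Md.smult_assoc1)
      moreover have "b \<otimes>\<^bsub>S\<^esub> s \<in> Sg (hm (Suc i) + ?z)"
        using Alg.mult_gr[OF b(2) s(1)] unfolding add.assoc[symmetric] hm_Suc .
      then have "(b \<otimes>\<^bsub>S\<^esub> s) \<odot>\<^bsub>M\<^esub> m \<in> orbit (hm (Suc i) + ?z)" unfolding orbit_def by (rule imageI)
      ultimately show "y \<in> V (Suc i)"
        unfolding V_def qx(3) using qx(1) by (simp only: Md.plus_multipleI)
    qed
    show "V i \<noteq> V (Suc i)"
    proof
      assume eq: "V i = V (Suc i)"
      obtain u where u: "u \<in> Sg (hm (Suc i) + ?z)" "u \<notin> P'" using Proj_homogeneous_outside[OF P'] by blast
      note uc = Sg_closed[OF u(1)]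
      have "u \<odot>\<^bsub>M\<^esub> m \<in> orbit (hm (Suc i) + ?z)" unfolding orbit_def using u(1) by (rule imageI)
      from Md.smult_mem_plus_multiple[OF Qn orbit pc this]
      have "?p \<odot>\<^bsub>M\<^esub> (u \<odot>\<^bsub>M\<^esub> m) \<in> V (Suc i)" unfolding V_def .
      then have "?p \<odot>\<^bsub>M\<^esub> (u \<odot>\<^bsub>M\<^esub> m) \<in> V i" unfolding eq .
      then obtain q x where qx: "q \<in> ?Qn" "x \<in> orbit (hm i + ?z)"
        "?p \<odot>\<^bsub>M\<^esub> (u \<odot>\<^bsub>M\<^esub> m) = q \<oplus>\<^bsub>M\<^esub> b [^]\<^bsub>S\<^esub> (r - i) \<odot>\<^bsub>M\<^esub> x"
        unfolding V_def by (rule Md.plus_multipleE)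
      from qx(2) obtain s where s: "s \<in> Sg (hm i + ?z)" "x = s \<odot>\<^bsub>M\<^esub> m" by (auto simp: orbit_def)
      note sc = Sg_closed[OF s(1)]
      have qc: "q \<in> carrier M" by (rule Md.stable_subgroup_mem[OF Qn qx(1)])
      have "(?p \<otimes>\<^bsub>S\<^esub> (u \<ominus>\<^bsub>S\<^esub> b \<otimes>\<^bsub>S\<^esub> s)) \<odot>\<^bsub>M\<^esub> m =
          ?p \<odot>\<^bsub>M\<^esub> (u \<odot>\<^bsub>M\<^esub> m) \<ominus>\<^bsub>M\<^esub> b [^]\<^bsub>S\<^esub> (r - i) \<odot>\<^bsub>M\<^esub> x"
        unfolding pb s(2) using pc uc bc sc mc
        by (simp add: a_minus_def Md.smult_assoc1 Md.smult_l_distr Md.smult_r_distr Md.smult_l_minus Md.smult_r_minus)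
      also have "\<dots> = q"
        unfolding qx(3) using qc pc bc sc mc unfolding s(2)
        by (simp add: a_minus_def Md.a_assoc Md.r_neg)
      finally have "(?p \<otimes>\<^bsub>S\<^esub> (u \<ominus>\<^bsub>S\<^esub> b \<otimes>\<^bsub>S\<^esub> s)) \<odot>\<^bsub>M\<^esub> m \<in> Q" using qx(1) by (simp add: degree_part_def)
      then have "?p \<otimes>\<^bsub>S\<^esub> (u \<ominus>\<^bsub>S\<^esub> b \<otimes>\<^bsub>S\<^esub> s) \<in> P" using pc uc bc sc by (intro ann) auto
      then have "u \<ominus>\<^bsub>S\<^esub> b \<otimes>\<^bsub>S\<^esub> s \<in> P"
        using P.I_prime[OF pc, of "u \<ominus>\<^bsub>S\<^esub> b \<otimes>\<^bsub>S\<^esub> s"] bpow(2) uc bc sc by auto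
      then have "u \<ominus>\<^bsub>S\<^esub> b \<otimes>\<^bsub>S\<^esub> s \<in> P'" using PP' by blast
      then have "(u \<ominus>\<^bsub>S\<^esub> b \<otimes>\<^bsub>S\<^esub> s) \<oplus>\<^bsub>S\<^esub> b \<otimes>\<^bsub>S\<^esub> s \<in> P'" using P'.I_r_closed[OF b(1) sc] by simp
      moreover have "(u \<ominus>\<^bsub>S\<^esub> b \<otimes>\<^bsub>S\<^esub> s) \<oplus>\<^bsub>S\<^esub> b \<otimes>\<^bsub>S\<^esub> s = u"
        using uc bc sc by (simp add: a_minus_def Alg.a_assoc Alg.l_neg)
      ultimately show False using u(2) by simp
    qed
  qed
  have "r \<in> chain_lengths (stable_interval M \<Omega> ?Qn (Mg n))"
    by (rule chain_lengths_of_fun[of r V, OF V_interval V_strict])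
  then have "enat r \<le> rel_length M \<Omega> ?Qn (Mg n)"
    using enat_le_rel_length_iff[OF Qn, of "Mg n" r] by (simp add: degree_part_def)
  also have "\<dots> = enat (nat (gg.quotient_length (degree_part Q) Mg n))"
    by (rule gg.quotient_length[OF degree_part_graded[OF Q] gg.graded_family_whole])
  also have "gg.quotient_length (degree_part Q) Mg n = c"
    using z by (simp add: n_def trans_le_add1 trans_le_add2)
  finally show False by (simp add: r_def)
qed

text \<open>
  The constant is zero exactly when \<open>Q\<close> contains \<open>M\<close> in large degrees. In that case the support is
  empty and its dimension is \<open>-\<infinity>\<close>; otherwise it is nonempty without proper inclusions, so that all
  chains have length \<open>0\<close>.
\<close>

lemma prime_dim_Supp:
  assumes Q: "homogeneous_submodule Q"
    and const: "for_all_large (\<lambda>n. gg.quotient_length (degree_part Q) Mg n = c)"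
  shows "c \<noteq> 0 \<longleftrightarrow> prime_dim (Supp_plus_plus S Sg (quot_module M Q)) = 0"
proof -
  let ?S = "Supp_plus_plus S Sg (quot_module M Q)"
  have iff: "gg.quotient_length (degree_part Q) Mg n = 0 \<longleftrightarrow> Mg n \<subseteq> Q" for n
  proof -
    have "gg.quotient_length (degree_part Q) Mg n = 0 \<longleftrightarrow> rel_length M \<Omega> (degree_part Q n) (Mg n) = 0"
      using gg.quotient_length[OF degree_part_graded[OF Q] gg.graded_family_whole, of n]
        gg.quotient_length_nonneg[where N = "degree_part Q" and L = Mg and n = n]
      by (auto simp: zero_enat_def)
    also have "\<dots> \<longleftrightarrow> degree_part Q n = Mg n"
      by (rule Md.rel_length_eq_0_iff[OF gg.graded_familyD(1)[OF degree_part_graded[OF Q]] Mg_stable])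
        (simp add: degree_part_def)
    also have "\<dots> \<longleftrightarrow> Mg n \<subseteq> Q" by (auto simp: degree_part_def)
    finally show ?thesis .
  qed
  show ?thesis
  proof (cases "c = 0")
    case True
    have "for_all_large (\<lambda>n. Mg n \<subseteq> Q)"
      using const by (rule for_all_large_mono) (simp add: True iff)
    then have "?S = {}" by (rule Supp_empty[OF homogeneous_submoduleD(1)[OF Q]])
    then have "chain_lengths ?S = {}" by (auto simp: chain_lengths_def)
    then show ?thesis using True by (simp add: prime_dim_def bot_ereal_def)
  next
    case False
    have "\<not> for_all_large (\<lambda>n. Mg n \<subseteq> Q)"
    proof
      assume "for_all_large (\<lambda>n. Mg n \<subseteq> Q)"
      from for_all_large_ex[OF for_all_large_conj[OF this const]] iff False show False by auto
    qed
    then obtain P where P: "P \<in> ?S" using Supp_nonempty[OF Q] by blast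
    have "chain_lengths ?S = {0}"
    proof
      show "{0} \<subseteq> chain_lengths ?S" using zero_in_chain_lengths[OF P] by simp
      show "chain_lengths ?S \<subseteq> {0}"
      proof
        fix r assume "r \<in> chain_lengths ?S"
        then obtain Xs where Xs: "length Xs = Suc r" "set Xs \<subseteq> ?S" "sorted_wrt (\<subset>) Xs"
          unfolding chain_lengths_def by blast
        show "r \<in> {0}"
        proof (rule ccontr)
          assume "r \<notin> {0}"
          then have l: "1 < length Xs" using Xs(1) by simp
          have "Xs ! 0 \<subset> Xs ! 1" using sorted_wrt_nth_less[OF Xs(3), of 0 1] l by simp
          moreover have "Xs ! i \<in> ?S" if "i \<le> 1" for i
            by (rule subsetD[OF Xs(2) nth_mem]) (use l that in linarith)
          then have "Xs ! 0 \<in> ?S" "Xs ! 1 \<in> ?S" by blast+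
          moreover from this(2) have "Xs ! 1 \<in> Proj S Sg" by (simp add: Supp_plus_plus_def)
          ultimately show False using Supp_no_chain[OF Q const] by blast
        qed
      qed
    qed
    then show ?thesis using False by (simp add: prime_dim_def)
  qed
qed

end

section \<open>Mixed multiplicities as lengths\<close>

theorem theorem1p1:
  fixes A :: "('a, 'w) ring_scheme"
    and \<mm> :: "'a set"
    and S :: "('a, 's, 'x) module_scheme"
    and Sg :: "'d::finite multi \<Rightarrow> 's set"
    and M :: "('s, 'm, 'y) module_scheme"
    and Mg :: "'d multi \<Rightarrow> 'm set"
    and k :: "'d multi"
    and xs :: "'s list"
  assumes "artinian_local_ring A \<mm>"
    and "infinite (carrier (A Quot \<mm>))"
    and "standard_multigraded_algebra A S Sg"
    and "multigraded_module S Sg M Mg"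
    and "finitely_generated_module S M"
    and "mixed_multiplicity_defined A S M Mg k"
    and "filter_regular_seq S Sg M Mg xs"
    and "seq_of_type Sg k xs"
  shows "let xM = seq_mult S M xs in
           for_all_large (\<lambda>n. \<exists>l::nat.
             component_length A S (quot_module M xM) (quot_gr M Mg xM) n = enat l \<and>
             hilbert_coeff A S M Mg k = int l) \<and>
           (hilbert_coeff A S M Mg k \<noteq> 0 \<longleftrightarrow>
             prime_dim (Supp_plus_plus S Sg (quot_module M xM)) = 0)"
proof -
  interpret G: graded_setting A \<mm> S Sg M Mg
    by (rule graded_setting.intro[OF assms(1,3,4,5)])
  obtain T dg where T: "graded_generators_finite S Sg M Mg (base_scalars A S) T dg"
    "generate_ring S (T \<union> base_scalars A S) = carrier S"
    by (rule G.graded_generators_exist)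
  interpret H: hilbert_setting A \<mm> S Sg M Mg T dg
    by (rule hilbert_setting.intro[OF G.graded_setting_axioms hilbert_setting_axioms.intro[OF T]])
  let ?Q = "seq_mult S M xs"
  note hom = H.mixed_multiplicity_eq_length(1)[OF assms(6,7,8)]
    and const = H.mixed_multiplicity_eq_length(2)[OF assms(6,7,8)]
  have "for_all_large (\<lambda>n. \<exists>l::nat.
      component_length A S (quot_module M ?Q) (quot_gr M Mg ?Q) n = enat l \<and>
      hilbert_coeff A S M Mg k = int l)"
    using const
  proof (rule for_all_large_mono)
    fix n assume eq: "H.gg.quotient_length (H.degree_part ?Q) Mg n = hilbert_coeff A S M Mg k"
    have "0 \<le> hilbert_coeff A S M Mg k"
      unfolding eq[symmetric] by (rule H.gg.quotient_length_nonneg)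
    then show "\<exists>l::nat. component_length A S (quot_module M ?Q) (quot_gr M Mg ?Q) n = enat l \<and>
        hilbert_coeff A S M Mg k = int l"
      using H.component_length_quot[OF hom, of n] eq
      by (intro exI[of _ "nat (hilbert_coeff A S M Mg k)"]) simp
  qed
  then show ?thesis unfolding Let_def using H.prime_dim_Supp[OF hom const] by (rule conjI)
qed

end
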